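(* Let $\mathcal A$ be a category with finite limits and colimits. Let $\underline{\mathsf{Cyl}}=(\mathsf{Cyl},i_0,i_1,p,v,\mathsf S,r_0,r_1,s,\Gamma_{ul},\Gamma_{lr})$ be a cylinder in $\mathcal A$ equipped with a contraction structure $p$, an involution structure $v$ compatible with $p$, a subdivision structure $(\mathsf S,r_0,r_1,s)$ compatible with $p$, an upper left connection structure $\Gamma_{ul}$, and a lower right connection structure $\Gamma_{lr}$ compatible with $p$. Suppose that $\mathsf{Cyl}$ preserves mapping cylinders with respect to $\underline{\mathsf{Cyl}}$, and that $\underline{\mathsf{Cyl}}$ has strictness of identities. Let $\underline{\mathsf{coCyl}}=(\mathsf{coCyl},e_0,e_1,c,v',\mathsf S',r_0',r_1',s',\Gamma_{ul}',\Gamma_{lr}',\Gamma_{ur}')$ be a co-cylinder in $\mathcal A$ equipped with a contraction structure $c$, an involution structure $v'$ compatible with $c$, a subdivision structure $(\mathsf S',r_0',r_1',s')$ compatible with $c$, an upper left connection structure $\Gamma_{ul}'$, a lower right connection structure $\Gamma_{lr}'$ compatible with $c$, and an upper right connection structure $\Gamma_{ur}'$. Suppose that $\Gamma_{lr}'$ and $\Gamma_{ur}'$ are compatible with $(\mathsf S',r_0',r_1',s')$, that $\mathsf{coCyl}$ preserves mapping co-cylinders with respect to $\underline{\mathsf{coCyl}}$, and that $\underline{\mathsf{coCyl}}$ has strictness of identities. Suppose moreover that $\underline{\mathsf{Cyl}}$ is left adjoint to $\underline{\mathsf{coCyl}}$, and that the adjunction between $\mathsf{Cyl}$ and $\mathsf{coCyl}$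 is compatible with $p$ and $c$. Then one obtains a model structure on $\mathcal A$ by taking: weak equivalences to be the homotopy equivalences with respect to $\underline{\mathsf{Cyl}}$ (equivalently, the homotopy equivalences with respect to $\underline{\mathsf{coCyl}}$); fibrations to be the fibrations with respect to $\underline{\mathsf{coCyl}}$; cofibrations to be the normally cloven cofibrations with respect to $\underline{\mathsf{Cyl}}$.
   Context: Notation: for a natural transformation $\eta$ between endofunctors of $\mathcal A$ and an endofunctor $F$, $\eta\cdot F$ has components $\eta(F(a))$ and $F\cdot\eta$ has components $F(\eta(a))$. A cylinder in $\mathcal A$ is a functor $\mathsf{Cyl}:\mathcal A\to\mathcal A$ with natural transformations $i_0,i_1:\mathrm{id}_{\mathcal A}\to\mathsf{Cyl}$. Structures on it (all natural transformations): - Contraction: $p:\mathsf{Cyl}\to\mathrm{id}_{\mathcal A}$ with $p i_0=p i_1=\mathrm{id}$. - Involution: $v:\mathsf{Cyl}\to\mathsf{Cyl}$ with $v i_0=i_1$, $v i_1=i_0$; compatible with $p$ if $pv=p$. - Subdivision: a functor $\mathsf S:\mathcal A\to\mathcal A$ and $r_0,r_1:\mathsf{Cyl}\to\mathsf S$ with $r_0i_0=r_1i_1$ such that this commutative square is a pushout (of $i_0$ and $i_1$) in the category of endofunctors of $\mathcal A$, and $s:\mathsf{Cyl}\to\mathsf S$ with $s i_0=r_1i_0$, $s i_1=r_0i_1$. It is compatible with $p$ if $\overline p s=p$, where $\overline p:\mathsf S\to\mathrm{id}_{\mathcal A}$ is the unique map with $\overline p r_0=\overline p r_1=p$. - Upper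 left connection: $\Gamma_{ul}:\mathsf{Cyl}^2\to\mathsf{Cyl}$ with $\Gamma_{ul}(i_0\cdot\mathsf{Cyl})=\Gamma_{ul}(\mathsf{Cyl}\cdot i_0)=\mathrm{id}$ and $\Gamma_{ul}(i_1\cdot\mathsf{Cyl})=\Gamma_{ul}(\mathsf{Cyl}\cdot i_1)=i_1p$. - Lower right connection: $\Gamma_{lr}:\mathsf{Cyl}^2\to\mathsf{Cyl}$ with $\Gamma_{lr}(i_1\cdot\mathsf{Cyl})=\Gamma_{lr}(\mathsf{Cyl}\cdot i_1)=\mathrm{id}$ and $\Gamma_{lr}(i_0\cdot\mathsf{Cyl})=\Gamma_{lr}(\mathsf{Cyl}\cdot i_0)=i_0p$; compatible with $p$ if $p\Gamma_{lr}=p(p\cdot\mathsf{Cyl})$. - Upper right connection: $\Gamma_{ur}:\mathsf{Cyl}^2\to\mathsf{Cyl}$ with $\Gamma_{ur}(i_0\cdot\mathsf{Cyl})=\mathrm{id}$, $\Gamma_{ur}(\mathsf{Cyl}\cdot i_1)=v$, $\Gamma_{ur}(\mathsf{Cyl}\cdot i_0)=\Gamma_{ur}(i_1\cdot\mathsf{Cyl})=i_0p$. - $\Gamma_{lr},\Gamma_{ur}$ are compatible with $(\mathsf S,r_0,r_1,s)$ if $x(s\cdot\mathsf{Cyl})=p\cdot\mathsf{Cyl}$, where $x:\mathsf S\circ\mathsf{Cyl}\to\mathsf{Cyl}$ is the unique map with $x(r_0\cdot\mathsf{Cyl})=\Gamma_{lr}$ and $x(r_1\cdot\mathsf{Cyl})=\Gamma_{ur}$.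 - Strictness of identities: $q_ls=\mathrm{id}$ and $q_rs=\mathrm{id}$, where $q_l,q_r:\mathsf S\to\mathsf{Cyl}$ are the unique maps with $q_lr_0=\mathrm{id}$, $q_lr_1=i_0p$ and $q_rr_0=i_1p$, $q_rr_1=\mathrm{id}$. A co-cylinder in $\mathcal A$ is a functor $\mathsf{coCyl}:\mathcal A\to\mathcal A$ with natural transformations $e_0,e_1:\mathsf{coCyl}\to\mathrm{id}_{\mathcal A}$; equivalently $(\mathsf{coCyl},e_0^{op},e_1^{op})$ is a cylinder in $\mathcal A^{op}$. Every structure or property of a co-cylinder is by definition the structure or property of the same name for this cylinder in $\mathcal A^{op}$ (so e.g. $c:\mathrm{id}_{\mathcal A}\to\mathsf{coCyl}$ with $e_0c=e_1c=\mathrm{id}$). Mapping cylinder of $f:a_0\to a_1$: an object $a_f$ with $d^0:\mathsf{Cyl}(a_0)\to a_f$, $d^1:a_1\to a_f$ such that $d^0\circ i_0(a_0)=d^1\circ f$ is a pushout square. $\mathsf{Cyl}$ preserves mapping cylinders if $\mathsf{Cyl}$ carries each such square to a pushout square (the square with maps $\mathsf{Cyl}(i_0(a_0)),\mathsf{Cyl}(d^0),\mathsf{Cyl}(f),\mathsf{Cyl}(d^1)$). $\mathsf{coCyl}$ preserves mapping co-cylinders: the dual (the pullback squares of $f$ and $e_0(a_1)$ are carried by $\mathsf{coCyl}$ to pullback squares). $\underline{\mathsf{Cyl}}$ is left adjoint to $\underline{\mathsf{coCyl}}$ if $\mathsf{Cyl}\dashv\mathsf{coCyl}$, with natural bijection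 $\mathsf{adj}:\mathrm{Hom}(\mathsf{Cyl}(a_0),a_1)\to\mathrm{Hom}(a_0,\mathsf{coCyl}(a_1))$, and $e_\epsilon(a_1)\circ\mathsf{adj}(h)=h\circ i_\epsilon(a_0)$ for $\epsilon=0,1$ and all $h$. The adjunction is compatible with $p$ and $c$ if $\mathsf{adj}(f\circ p(a_0))=c(a_1)\circ f$ for all $f:a_0\to a_1$. A homotopy from $f_0$ to $f_1$ ($f_0,f_1:a_0\to a_1$) with respect to $\underline{\mathsf{Cyl}}$ is $h:\mathsf{Cyl}(a_0)\to a_1$ with $h\circ i_0(a_0)=f_0$, $h\circ i_1(a_0)=f_1$; with respect to $\underline{\mathsf{coCyl}}$ it is $h:a_0\to\mathsf{coCyl}(a_1)$ with $e_0(a_1)\circ h=f_0$, $e_1(a_1)\circ h=f_1$. An arrow $f:a_0\to a_1$ is a homotopy equivalence if there are $f^{-1}:a_1\to a_0$ and homotopies from $f^{-1}f$ to $\mathrm{id}(a_0)$ and from $ff^{-1}$ to $\mathrm{id}(a_1)$. Fibration with respect to $\underline{\mathsf{coCyl}}$: $f:a_1\to a_2$ such that for all $g:a_0\to a_1$, $h:a_0\to\mathsf{coCyl}(a_2)$ with $e_0(a_2)\circ h=f\circ g$ there is $k:a_0\to\mathsf{coCyl}(a_1)$ with $\mathsf{coCyl}(f)\circ k=h$ and $e_0(a_1)\circ k=g$. Normally cloven cofibration with respect to $\underline{\mathsf{Cyl}}$ and $p$: $j:a_0\to a_1$ for which one can choose, for every object $a_2$ and all $g:a_1\to a_2$, $h:\mathsf{Cyl}(a_0)\to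 a_2$ with $h\circ i_0(a_0)=g\circ j$, an arrow $k_{a_2}(g,h):\mathsf{Cyl}(a_1)\to a_2$ with $k_{a_2}(g,h)\circ\mathsf{Cyl}(j)=h$ and $k_{a_2}(g,h)\circ i_0(a_1)=g$, such that (i) $k_{a_2}(g,g\circ j\circ p(a_0))=g\circ p(a_1)$, and (ii) $g'\circ k_{a_2}(g,h)=k_{a_3}(g'\circ g,g'\circ h)$ for all $g':a_2\to a_3$. A model structure means a (closed) model structure in the sense of Quillen: weak equivalences satisfy two-out-of-three; (trivial) fibrations are exactly the arrows with the right lifting property with respect to trivial cofibrations (resp. cofibrations); (trivial) cofibrations are exactly the arrows with the left lifting property with respect to trivial fibrations (resp. fibrations); every arrow factors as a cofibration followed by a trivial fibration and as a trivial cofibration followed by a fibration (factorisations not required functorial). *)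

theory Defs
  imports Main
begin

section \<open>Categories, functors, natural transformations\<close>

record ('o, 'a) cat =
  Obj :: "'o set"
  Arr :: "'a set"
  Dom :: "'a \<Rightarrow> 'o"
  Cod :: "'a \<Rightarrow> 'o"
  Idt :: "'o \<Rightarrow> 'a" ("\<one>\<index>")
  Cmp :: "'a \<Rightarrow> 'a \<Rightarrow> 'a" (infixl "\<cdot>\<index>" 70)

definition hom :: "('o, 'a) cat \<Rightarrow> 'o \<Rightarrow> 'o \<Rightarrow> 'a set" where
  "hom C a b = {f \<in> Arr C. Dom C f = a \<and> Cod C f = b}"

locale category =
  fixes C :: "('o, 'a) cat" (structure)
  assumes Dom_in_Obj: "f \<in> Arr C \<Longrightarrow> Dom C f \<in> Obj C"
    and Cod_in_Obj: "f \<in> Arr C \<Longrightarrow> Cod C f \<in> Obj C"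
    and Idt_in_hom: "a \<in> Obj C \<Longrightarrow> \<one> a \<in> hom C a a"
    and Cmp_in_hom: "\<lbrakk>f \<in> hom C a b; g \<in> hom C b c\<rbrakk> \<Longrightarrow> g \<cdot> f \<in> hom C a c"
    and Cmp_Idt: "f \<in> hom C a b \<Longrightarrow> f \<cdot> \<one> a = f"
    and Idt_Cmp: "f \<in> hom C a b \<Longrightarrow> \<one> b \<cdot> f = f"
    and Cmp_assoc: "\<lbrakk>f \<in> hom C a b; g \<in> hom C b c; h \<in> hom C c d\<rbrakk>
                     \<Longrightarrow> (h \<cdot> g) \<cdot> f = h \<cdot> (g \<cdot> f)"

definition op_cat :: "('o, 'a) cat \<Rightarrow> ('o, 'a) cat" where
  "op_cat C = \<lparr>Obj = Obj C, Arr = Arr C, Dom = Cod C, Cod = Dom C,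
               Idt = Idt C, Cmp = (\<lambda>g f. f \<cdot>\<^bsub>C\<^esub> g)\<rparr>"

lemma hom_op_cat [simp]: "hom (op_cat C) a b = hom C b a"
  by (auto simp: hom_def op_cat_def)

lemma op_cat_op_cat [simp]: "op_cat (op_cat C) = C"
  by (simp add: op_cat_def)

lemma category_op_cat: "category C \<Longrightarrow> category (op_cat C)"
  by (rule category.intro)
    (auto simp: op_cat_def hom_op_cat[unfolded op_cat_def] intro: category.Dom_in_Obj
      category.Cod_in_Obj category.Idt_in_hom category.Cmp_in_hom category.Cmp_Idt
      category.Idt_Cmp category.Cmp_assoc[symmetric])

text \<open>Functors and natural transformations are given by total functions of which only the values
  on the objects and arrows of the source category matter. Equality of natural transformations
  is therefore always stated componentwise on \<^term>\<open>Obj C\<close>. The data of an endofunctor of a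
  category is also the data of an endofunctor of the opposite category.\<close>

record ('o, 'a, 'p, 'b) func =
  omap :: "'o \<Rightarrow> 'p"
  amap :: "'a \<Rightarrow> 'b"

type_synonym ('o, 'a) endo = "('o, 'a, 'o, 'a) func"

definition is_functor ::
  "('o, 'a) cat \<Rightarrow> ('p, 'b) cat \<Rightarrow> ('o, 'a, 'p, 'b) func \<Rightarrow> bool" where
  "is_functor C D F \<longleftrightarrow> category C \<and> category D \<and>
     (\<forall>a\<in>Obj C. omap F a \<in> Obj D) \<and>
     (\<forall>a b. \<forall>f\<in>hom C a b. amap F f \<in> hom D (omap F a) (omap F b)) \<and>
     (\<forall>a\<in>Obj C. amap F (\<one>\<^bsub>C\<^esub> a) = \<one>\<^bsub>D\<^esub> (omap F a)) \<and>
     (\<forall>a b c. \<forall>f\<in>hom C a b. \<forall>g\<in>hom C b c.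
        amap F (g \<cdot>\<^bsub>C\<^esub> f) = amap F g \<cdot>\<^bsub>D\<^esub> amap F f)"

definition id_func :: "('o, 'a) endo" where
  "id_func = \<lparr>omap = (\<lambda>a. a), amap = (\<lambda>f. f)\<rparr>"

definition comp_func ::
  "('p, 'b, 'q, 'c) func \<Rightarrow> ('o, 'a, 'p, 'b) func \<Rightarrow> ('o, 'a, 'q, 'c) func" where
  "comp_func G F = \<lparr>omap = (\<lambda>a. omap G (omap F a)), amap = (\<lambda>f. amap G (amap F f))\<rparr>"

definition const_func :: "('p, 'b) cat \<Rightarrow> 'p \<Rightarrow> ('o, 'a, 'p, 'b) func" where
  "const_func D x = \<lparr>omap = (\<lambda>_. x), amap = (\<lambda>_. \<one>\<^bsub>D\<^esub> x)\<rparr>"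

definition nat_trans ::
  "('o, 'a) cat \<Rightarrow> ('p, 'b) cat \<Rightarrow> ('o, 'a, 'p, 'b) func \<Rightarrow> ('o, 'a, 'p, 'b) func
     \<Rightarrow> ('o \<Rightarrow> 'b) \<Rightarrow> bool" where
  "nat_trans C D F G \<eta> \<longleftrightarrow> is_functor C D F \<and> is_functor C D G \<and>
     (\<forall>a\<in>Obj C. \<eta> a \<in> hom D (omap F a) (omap G a)) \<and>
     (\<forall>a b. \<forall>f\<in>hom C a b. \<eta> b \<cdot>\<^bsub>D\<^esub> amap F f = amap G f \<cdot>\<^bsub>D\<^esub> \<eta> a)"


section \<open>Limits and pushouts\<close>

definition is_limit ::
  "('j, 'k) cat \<Rightarrow> ('o, 'a) cat \<Rightarrow> ('j, 'k, 'o, 'a) func \<Rightarrow> 'o \<Rightarrow> ('j \<Rightarrow> 'a) \<Rightarrow> bool" where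
  "is_limit J C D l \<pi> \<longleftrightarrow> l \<in> Obj C \<and> nat_trans J C (const_func C l) D \<pi> \<and>
     (\<forall>x\<in>Obj C. \<forall>\<xi>. nat_trans J C (const_func C x) D \<xi> \<longrightarrow>
        (\<exists>!u. u \<in> hom C x l \<and> (\<forall>j\<in>Obj J. \<pi> j \<cdot>\<^bsub>C\<^esub> u = \<xi> j)))"

text \<open>Every finite category is isomorphic to one whose objects and arrows are natural numbers,
  so it suffices to let the diagram shapes range over those.\<close>

definition has_finite_limits :: "('o, 'a) cat \<Rightarrow> bool" where
  "has_finite_limits C \<longleftrightarrow>
     (\<forall>(J :: (nat, nat) cat) D. finite (Obj J) \<and> finite (Arr J) \<and> is_functor J C D \<longrightarrow>
        (\<exists>l \<pi>. is_limit J C D l \<pi>))"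

definition has_finite_colimits :: "('o, 'a) cat \<Rightarrow> bool" where
  "has_finite_colimits C \<longleftrightarrow> has_finite_limits (op_cat C)"

definition is_pushout :: "('o, 'a) cat \<Rightarrow> 'a \<Rightarrow> 'a \<Rightarrow> 'a \<Rightarrow> 'a \<Rightarrow> bool" where
  "is_pushout C f g u v \<longleftrightarrow>
     (\<exists>x y z w. f \<in> hom C x y \<and> g \<in> hom C x z \<and> u \<in> hom C y w \<and> v \<in> hom C z w \<and>
        u \<cdot>\<^bsub>C\<^esub> f = v \<cdot>\<^bsub>C\<^esub> g \<and>
        (\<forall>t. \<forall>m\<in>hom C y t. \<forall>n\<in>hom C z t. m \<cdot>\<^bsub>C\<^esub> f = n \<cdot>\<^bsub>C\<^esub> g \<longrightarrow>
           (\<exists>!k. k \<in> hom C w t \<and> k \<cdot>\<^bsub>C\<^esub> u = m \<and> k \<cdot>\<^bsub>C\<^esub> v = n)))"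

text \<open>Pushouts in the category of endofunctors of \<open>C\<close>: the square formed by
  \<open>f : X \<rightarrow> Y\<close>, \<open>g : X \<rightarrow> Z\<close>, \<open>u : Y \<rightarrow> W\<close>, \<open>v : Z \<rightarrow> W\<close>.\<close>

definition is_endo_pushout ::
  "('o, 'a) cat \<Rightarrow> ('o, 'a) endo \<Rightarrow> ('o, 'a) endo \<Rightarrow> ('o, 'a) endo \<Rightarrow> ('o, 'a) endo
     \<Rightarrow> ('o \<Rightarrow> 'a) \<Rightarrow> ('o \<Rightarrow> 'a) \<Rightarrow> ('o \<Rightarrow> 'a) \<Rightarrow> ('o \<Rightarrow> 'a) \<Rightarrow> bool" where
  "is_endo_pushout C X Y Z W f g u v \<longleftrightarrow>
     nat_trans C C X Y f \<and> nat_trans C C X Z g \<and> nat_trans C C Y W u \<and> nat_trans C C Z W v \<and>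
     (\<forall>a\<in>Obj C. u a \<cdot>\<^bsub>C\<^esub> f a = v a \<cdot>\<^bsub>C\<^esub> g a) \<and>
     (\<forall>T m n. nat_trans C C Y T m \<and> nat_trans C C Z T n \<and>
        (\<forall>a\<in>Obj C. m a \<cdot>\<^bsub>C\<^esub> f a = n a \<cdot>\<^bsub>C\<^esub> g a) \<longrightarrow>
        (\<exists>k. nat_trans C C W T k \<and>
           (\<forall>a\<in>Obj C. k a \<cdot>\<^bsub>C\<^esub> u a = m a \<and> k a \<cdot>\<^bsub>C\<^esub> v a = n a) \<and>
           (\<forall>k'. nat_trans C C W T k' \<and>
              (\<forall>a\<in>Obj C. k' a \<cdot>\<^bsub>C\<^esub> u a = m a \<and> k' a \<cdot>\<^bsub>C\<^esub> v a = n a) \<longrightarrow>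
              (\<forall>a\<in>Obj C. k' a = k a))))"


section \<open>Structures on a cylinder\<close>

definition cylinder ::
  "('o, 'a) cat \<Rightarrow> ('o, 'a) endo \<Rightarrow> ('o \<Rightarrow> 'a) \<Rightarrow> ('o \<Rightarrow> 'a) \<Rightarrow> bool" where
  "cylinder C Cyl i0 i1 \<longleftrightarrow>
     is_functor C C Cyl \<and> nat_trans C C id_func Cyl i0 \<and> nat_trans C C id_func Cyl i1"

definition contraction ::
  "('o, 'a) cat \<Rightarrow> ('o, 'a) endo \<Rightarrow> ('o \<Rightarrow> 'a) \<Rightarrow> ('o \<Rightarrow> 'a) \<Rightarrow> ('o \<Rightarrow> 'a) \<Rightarrow> bool" where
  "contraction C Cyl i0 i1 p \<longleftrightarrow> nat_trans C C Cyl id_func p \<and>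
     (\<forall>a\<in>Obj C. p a \<cdot>\<^bsub>C\<^esub> i0 a = \<one>\<^bsub>C\<^esub> a \<and> p a \<cdot>\<^bsub>C\<^esub> i1 a = \<one>\<^bsub>C\<^esub> a)"

definition involution ::
  "('o, 'a) cat \<Rightarrow> ('o, 'a) endo \<Rightarrow> ('o \<Rightarrow> 'a) \<Rightarrow> ('o \<Rightarrow> 'a) \<Rightarrow> ('o \<Rightarrow> 'a) \<Rightarrow> bool" where
  "involution C Cyl i0 i1 v \<longleftrightarrow> nat_trans C C Cyl Cyl v \<and>
     (\<forall>a\<in>Obj C. v a \<cdot>\<^bsub>C\<^esub> i0 a = i1 a \<and> v a \<cdot>\<^bsub>C\<^esub> i1 a = i0 a)"

definition involution_compatible ::
  "('o, 'a) cat \<Rightarrow> ('o \<Rightarrow> 'a) \<Rightarrow> ('o \<Rightarrow> 'a) \<Rightarrow> bool" where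
  "involution_compatible C p v \<longleftrightarrow> (\<forall>a\<in>Obj C. p a \<cdot>\<^bsub>C\<^esub> v a = p a)"

definition subdivision ::
  "('o, 'a) cat \<Rightarrow> ('o, 'a) endo \<Rightarrow> ('o \<Rightarrow> 'a) \<Rightarrow> ('o \<Rightarrow> 'a)
     \<Rightarrow> ('o, 'a) endo \<Rightarrow> ('o \<Rightarrow> 'a) \<Rightarrow> ('o \<Rightarrow> 'a) \<Rightarrow> ('o \<Rightarrow> 'a) \<Rightarrow> bool" where
  "subdivision C Cyl i0 i1 S r0 r1 s \<longleftrightarrow>
     is_endo_pushout C id_func Cyl Cyl S i0 i1 r0 r1 \<and>
     nat_trans C C Cyl S s \<and>
     (\<forall>a\<in>Obj C. s a \<cdot>\<^bsub>C\<^esub> i0 a = r1 a \<cdot>\<^bsub>C\<^esub> i0 a \<and> s a \<cdot>\<^bsub>C\<^esub> i1 a = r0 a \<cdot>\<^bsub>C\<^esub> i1 a)"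

text \<open>The conditions below concern maps out of \<open>S\<close> or \<open>S \<circ> Cyl\<close> determined by their composites
  with \<open>r0\<close> and \<open>r1\<close> (or \<open>r0 \<cdot> Cyl\<close> and \<open>r1 \<cdot> Cyl\<close>). For \<open>S\<close>, such a map exists uniquely since
  \<open>S\<close> is a pushout of endofunctors; for \<open>S \<circ> Cyl\<close>, because in a category with pushouts that
  pushout is computed objectwise. An existential quantifier thus picks out the unique map.\<close>

definition subdivision_compatible ::
  "('o, 'a) cat \<Rightarrow> ('o \<Rightarrow> 'a) \<Rightarrow> ('o, 'a) endo
     \<Rightarrow> ('o \<Rightarrow> 'a) \<Rightarrow> ('o \<Rightarrow> 'a) \<Rightarrow> ('o \<Rightarrow> 'a) \<Rightarrow> bool" where
  "subdivision_compatible C p S r0 r1 s \<longleftrightarrow>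
     (\<exists>pbar. nat_trans C C S id_func pbar \<and>
        (\<forall>a\<in>Obj C. pbar a \<cdot>\<^bsub>C\<^esub> r0 a = p a \<and> pbar a \<cdot>\<^bsub>C\<^esub> r1 a = p a) \<and>
        (\<forall>a\<in>Obj C. pbar a \<cdot>\<^bsub>C\<^esub> s a = p a))"

definition upper_left_connection ::
  "('o, 'a) cat \<Rightarrow> ('o, 'a) endo \<Rightarrow> ('o \<Rightarrow> 'a) \<Rightarrow> ('o \<Rightarrow> 'a) \<Rightarrow> ('o \<Rightarrow> 'a)
     \<Rightarrow> ('o \<Rightarrow> 'a) \<Rightarrow> bool" where
  "upper_left_connection C Cyl i0 i1 p \<Gamma> \<longleftrightarrow>
     nat_trans C C (comp_func Cyl Cyl) Cyl \<Gamma> \<and>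
     (\<forall>a\<in>Obj C.
        \<Gamma> a \<cdot>\<^bsub>C\<^esub> i0 (omap Cyl a) = \<one>\<^bsub>C\<^esub> (omap Cyl a) \<and>
        \<Gamma> a \<cdot>\<^bsub>C\<^esub> amap Cyl (i0 a) = \<one>\<^bsub>C\<^esub> (omap Cyl a) \<and>
        \<Gamma> a \<cdot>\<^bsub>C\<^esub> i1 (omap Cyl a) = i1 a \<cdot>\<^bsub>C\<^esub> p a \<and>
        \<Gamma> a \<cdot>\<^bsub>C\<^esub> amap Cyl (i1 a) = i1 a \<cdot>\<^bsub>C\<^esub> p a)"

definition lower_right_connection ::
  "('o, 'a) cat \<Rightarrow> ('o, 'a) endo \<Rightarrow> ('o \<Rightarrow> 'a) \<Rightarrow> ('o \<Rightarrow> 'a) \<Rightarrow> ('o \<Rightarrow> 'a)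
     \<Rightarrow> ('o \<Rightarrow> 'a) \<Rightarrow> bool" where
  "lower_right_connection C Cyl i0 i1 p \<Gamma> \<longleftrightarrow>
     nat_trans C C (comp_func Cyl Cyl) Cyl \<Gamma> \<and>
     (\<forall>a\<in>Obj C.
        \<Gamma> a \<cdot>\<^bsub>C\<^esub> i1 (omap Cyl a) = \<one>\<^bsub>C\<^esub> (omap Cyl a) \<and>
        \<Gamma> a \<cdot>\<^bsub>C\<^esub> amap Cyl (i1 a) = \<one>\<^bsub>C\<^esub> (omap Cyl a) \<and>
        \<Gamma> a \<cdot>\<^bsub>C\<^esub> i0 (omap Cyl a) = i0 a \<cdot>\<^bsub>C\<^esub> p a \<and>
        \<Gamma> a \<cdot>\<^bsub>C\<^esub> amap Cyl (i0 a) = i0 a \<cdot>\<^bsub>C\<^esub> p a)"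

definition lower_right_compatible ::
  "('o, 'a) cat \<Rightarrow> ('o, 'a) endo \<Rightarrow> ('o \<Rightarrow> 'a) \<Rightarrow> ('o \<Rightarrow> 'a) \<Rightarrow> bool" where
  "lower_right_compatible C Cyl p \<Gamma> \<longleftrightarrow>
     (\<forall>a\<in>Obj C. p a \<cdot>\<^bsub>C\<^esub> \<Gamma> a = p a \<cdot>\<^bsub>C\<^esub> p (omap Cyl a))"

definition upper_right_connection ::
  "('o, 'a) cat \<Rightarrow> ('o, 'a) endo \<Rightarrow> ('o \<Rightarrow> 'a) \<Rightarrow> ('o \<Rightarrow> 'a) \<Rightarrow> ('o \<Rightarrow> 'a)
     \<Rightarrow> ('o \<Rightarrow> 'a) \<Rightarrow> ('o \<Rightarrow> 'a) \<Rightarrow> bool" where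
  "upper_right_connection C Cyl i0 i1 p v \<Gamma> \<longleftrightarrow>
     nat_trans C C (comp_func Cyl Cyl) Cyl \<Gamma> \<and>
     (\<forall>a\<in>Obj C.
        \<Gamma> a \<cdot>\<^bsub>C\<^esub> i0 (omap Cyl a) = \<one>\<^bsub>C\<^esub> (omap Cyl a) \<and>
        \<Gamma> a \<cdot>\<^bsub>C\<^esub> amap Cyl (i1 a) = v a \<and>
        \<Gamma> a \<cdot>\<^bsub>C\<^esub> amap Cyl (i0 a) = i0 a \<cdot>\<^bsub>C\<^esub> p a \<and>
        \<Gamma> a \<cdot>\<^bsub>C\<^esub> i1 (omap Cyl a) = i0 a \<cdot>\<^bsub>C\<^esub> p a)"

definition connections_subdivision_compatible ::
  "('o, 'a) cat \<Rightarrow> ('o, 'a) endo \<Rightarrow> ('o \<Rightarrow> 'a) \<Rightarrow> ('o, 'a) endo \<Rightarrow> ('o \<Rightarrow> 'a) \<Rightarrow> ('o \<Rightarrow> 'a)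
     \<Rightarrow> ('o \<Rightarrow> 'a) \<Rightarrow> ('o \<Rightarrow> 'a) \<Rightarrow> ('o \<Rightarrow> 'a) \<Rightarrow> bool" where
  "connections_subdivision_compatible C Cyl p S r0 r1 s \<Gamma>lr \<Gamma>ur \<longleftrightarrow>
     (\<exists>x. nat_trans C C (comp_func S Cyl) Cyl x \<and>
        (\<forall>a\<in>Obj C. x a \<cdot>\<^bsub>C\<^esub> r0 (omap Cyl a) = \<Gamma>lr a \<and> x a \<cdot>\<^bsub>C\<^esub> r1 (omap Cyl a) = \<Gamma>ur a) \<and>
        (\<forall>a\<in>Obj C. x a \<cdot>\<^bsub>C\<^esub> s (omap Cyl a) = p (omap Cyl a)))"

definition strictness_of_identities ::
  "('o, 'a) cat \<Rightarrow> ('o, 'a) endo \<Rightarrow> ('o \<Rightarrow> 'a) \<Rightarrow> ('o \<Rightarrow> 'a) \<Rightarrow> ('o \<Rightarrow> 'a)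
     \<Rightarrow> ('o, 'a) endo \<Rightarrow> ('o \<Rightarrow> 'a) \<Rightarrow> ('o \<Rightarrow> 'a) \<Rightarrow> ('o \<Rightarrow> 'a) \<Rightarrow> bool" where
  "strictness_of_identities C Cyl i0 i1 p S r0 r1 s \<longleftrightarrow>
     (\<exists>ql. nat_trans C C S Cyl ql \<and>
        (\<forall>a\<in>Obj C. ql a \<cdot>\<^bsub>C\<^esub> r0 a = \<one>\<^bsub>C\<^esub> (omap Cyl a) \<and> ql a \<cdot>\<^bsub>C\<^esub> r1 a = i0 a \<cdot>\<^bsub>C\<^esub> p a) \<and>
        (\<forall>a\<in>Obj C. ql a \<cdot>\<^bsub>C\<^esub> s a = \<one>\<^bsub>C\<^esub> (omap Cyl a))) \<and>
     (\<exists>qr. nat_trans C C S Cyl qr \<and>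
        (\<forall>a\<in>Obj C. qr a \<cdot>\<^bsub>C\<^esub> r0 a = i1 a \<cdot>\<^bsub>C\<^esub> p a \<and> qr a \<cdot>\<^bsub>C\<^esub> r1 a = \<one>\<^bsub>C\<^esub> (omap Cyl a)) \<and>
        (\<forall>a\<in>Obj C. qr a \<cdot>\<^bsub>C\<^esub> s a = \<one>\<^bsub>C\<^esub> (omap Cyl a)))"

text \<open>A mapping cylinder of \<open>f : a0 \<rightarrow> a1\<close> is a pushout square \<open>d0 \<circ> i0(a0) = d1 \<circ> f\<close>.\<close>

definition preserves_mapping_cylinders ::
  "('o, 'a) cat \<Rightarrow> ('o, 'a) endo \<Rightarrow> ('o \<Rightarrow> 'a) \<Rightarrow> bool" where
  "preserves_mapping_cylinders C Cyl i0 \<longleftrightarrow>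
     (\<forall>a0 a1 d0 d1. \<forall>f\<in>hom C a0 a1. is_pushout C (i0 a0) f d0 d1 \<longrightarrow>
        is_pushout C (amap Cyl (i0 a0)) (amap Cyl f) (amap Cyl d0) (amap Cyl d1))"


section \<open>Co-cylinders\<close>

text \<open>A co-cylinder \<open>(coCyl, e0, e1)\<close> in \<open>C\<close> is a cylinder in \<open>op_cat C\<close>, and a structure on it
  is the structure of the same name on that cylinder; so co-cylinders need no separate
  definitions. The adjunction relates a cylinder and a co-cylinder in the same category.\<close>

definition adjunction ::
  "('o, 'a) cat \<Rightarrow> ('o, 'a) endo \<Rightarrow> ('o, 'a) endo \<Rightarrow> ('o \<Rightarrow> 'o \<Rightarrow> 'a \<Rightarrow> 'a) \<Rightarrow> bool" where
  "adjunction C L R adj \<longleftrightarrow> is_functor C C L \<and> is_functor C C R \<and>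
     (\<forall>a0\<in>Obj C. \<forall>a1\<in>Obj C.
        bij_betw (adj a0 a1) (hom C (omap L a0) a1) (hom C a0 (omap R a1))) \<and>
     (\<forall>a0 a1 b0 b1. \<forall>u\<in>hom C b0 a0. \<forall>w\<in>hom C a1 b1. \<forall>h\<in>hom C (omap L a0) a1.
        adj b0 b1 (w \<cdot>\<^bsub>C\<^esub> h \<cdot>\<^bsub>C\<^esub> amap L u) = amap R w \<cdot>\<^bsub>C\<^esub> adj a0 a1 h \<cdot>\<^bsub>C\<^esub> u)"

definition cylinder_left_adjoint ::
  "('o, 'a) cat \<Rightarrow> ('o, 'a) endo \<Rightarrow> ('o \<Rightarrow> 'a) \<Rightarrow> ('o \<Rightarrow> 'a)
     \<Rightarrow> ('o, 'a) endo \<Rightarrow> ('o \<Rightarrow> 'a) \<Rightarrow> ('o \<Rightarrow> 'a) \<Rightarrow> ('o \<Rightarrow> 'o \<Rightarrow> 'a \<Rightarrow> 'a) \<Rightarrow> bool" where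
  "cylinder_left_adjoint C Cyl i0 i1 coCyl e0 e1 adj \<longleftrightarrow> adjunction C Cyl coCyl adj \<and>
     (\<forall>a0\<in>Obj C. \<forall>a1\<in>Obj C. \<forall>h\<in>hom C (omap Cyl a0) a1.
        e0 a1 \<cdot>\<^bsub>C\<^esub> adj a0 a1 h = h \<cdot>\<^bsub>C\<^esub> i0 a0 \<and>
        e1 a1 \<cdot>\<^bsub>C\<^esub> adj a0 a1 h = h \<cdot>\<^bsub>C\<^esub> i1 a0)"

definition adjunction_compatible ::
  "('o, 'a) cat \<Rightarrow> ('o \<Rightarrow> 'a) \<Rightarrow> ('o \<Rightarrow> 'a) \<Rightarrow> ('o \<Rightarrow> 'o \<Rightarrow> 'a \<Rightarrow> 'a) \<Rightarrow> bool" where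
  "adjunction_compatible C p c adj \<longleftrightarrow>
     (\<forall>a0 a1. \<forall>f\<in>hom C a0 a1. adj a0 a1 (f \<cdot>\<^bsub>C\<^esub> p a0) = c a1 \<cdot>\<^bsub>C\<^esub> f)"


section \<open>Homotopy equivalences, fibrations, cofibrations\<close>

definition cyl_homotopy ::
  "('o, 'a) cat \<Rightarrow> ('o, 'a) endo \<Rightarrow> ('o \<Rightarrow> 'a) \<Rightarrow> ('o \<Rightarrow> 'a)
     \<Rightarrow> 'o \<Rightarrow> 'o \<Rightarrow> 'a \<Rightarrow> 'a \<Rightarrow> 'a \<Rightarrow> bool" where
  "cyl_homotopy C Cyl i0 i1 a0 a1 f0 f1 h \<longleftrightarrow>
     f0 \<in> hom C a0 a1 \<and> f1 \<in> hom C a0 a1 \<and> h \<in> hom C (omap Cyl a0) a1 \<and>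
     h \<cdot>\<^bsub>C\<^esub> i0 a0 = f0 \<and> h \<cdot>\<^bsub>C\<^esub> i1 a0 = f1"

definition cocyl_homotopy ::
  "('o, 'a) cat \<Rightarrow> ('o, 'a) endo \<Rightarrow> ('o \<Rightarrow> 'a) \<Rightarrow> ('o \<Rightarrow> 'a)
     \<Rightarrow> 'o \<Rightarrow> 'o \<Rightarrow> 'a \<Rightarrow> 'a \<Rightarrow> 'a \<Rightarrow> bool" where
  "cocyl_homotopy C coCyl e0 e1 a0 a1 f0 f1 h \<longleftrightarrow>
     f0 \<in> hom C a0 a1 \<and> f1 \<in> hom C a0 a1 \<and> h \<in> hom C a0 (omap coCyl a1) \<and>
     e0 a1 \<cdot>\<^bsub>C\<^esub> h = f0 \<and> e1 a1 \<cdot>\<^bsub>C\<^esub> h = f1"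

definition cyl_homotopy_equivalences ::
  "('o, 'a) cat \<Rightarrow> ('o, 'a) endo \<Rightarrow> ('o \<Rightarrow> 'a) \<Rightarrow> ('o \<Rightarrow> 'a) \<Rightarrow> 'a set" where
  "cyl_homotopy_equivalences C Cyl i0 i1 =
     {f. \<exists>a0 a1. f \<in> hom C a0 a1 \<and>
        (\<exists>g\<in>hom C a1 a0.
           (\<exists>h. cyl_homotopy C Cyl i0 i1 a0 a0 (g \<cdot>\<^bsub>C\<^esub> f) (\<one>\<^bsub>C\<^esub> a0) h) \<and>
           (\<exists>h. cyl_homotopy C Cyl i0 i1 a1 a1 (f \<cdot>\<^bsub>C\<^esub> g) (\<one>\<^bsub>C\<^esub> a1) h))}"

definition cocyl_homotopy_equivalences ::
  "('o, 'a) cat \<Rightarrow> ('o, 'a) endo \<Rightarrow> ('o \<Rightarrow> 'a) \<Rightarrow> ('o \<Rightarrow> 'a) \<Rightarrow> 'a set" where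
  "cocyl_homotopy_equivalences C coCyl e0 e1 =
     {f. \<exists>a0 a1. f \<in> hom C a0 a1 \<and>
        (\<exists>g\<in>hom C a1 a0.
           (\<exists>h. cocyl_homotopy C coCyl e0 e1 a0 a0 (g \<cdot>\<^bsub>C\<^esub> f) (\<one>\<^bsub>C\<^esub> a0) h) \<and>
           (\<exists>h. cocyl_homotopy C coCyl e0 e1 a1 a1 (f \<cdot>\<^bsub>C\<^esub> g) (\<one>\<^bsub>C\<^esub> a1) h))}"

definition cocyl_fibrations ::
  "('o, 'a) cat \<Rightarrow> ('o, 'a) endo \<Rightarrow> ('o \<Rightarrow> 'a) \<Rightarrow> 'a set" where
  "cocyl_fibrations C coCyl e0 =
     {f. \<exists>a1 a2. f \<in> hom C a1 a2 \<and>
        (\<forall>a0. \<forall>g\<in>hom C a0 a1. \<forall>h\<in>hom C a0 (omap coCyl a2).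
           e0 a2 \<cdot>\<^bsub>C\<^esub> h = f \<cdot>\<^bsub>C\<^esub> g \<longrightarrow>
           (\<exists>k\<in>hom C a0 (omap coCyl a1).
              amap coCyl f \<cdot>\<^bsub>C\<^esub> k = h \<and> e0 a1 \<cdot>\<^bsub>C\<^esub> k = g))}"

definition normally_cloven_cofibrations ::
  "('o, 'a) cat \<Rightarrow> ('o, 'a) endo \<Rightarrow> ('o \<Rightarrow> 'a) \<Rightarrow> ('o \<Rightarrow> 'a) \<Rightarrow> 'a set" where
  "normally_cloven_cofibrations C Cyl i0 p =
     {j. \<exists>a0 a1. j \<in> hom C a0 a1 \<and>
        (\<exists>k :: 'o \<Rightarrow> 'a \<Rightarrow> 'a \<Rightarrow> 'a.
           (\<forall>a2. \<forall>g\<in>hom C a1 a2. \<forall>h\<in>hom C (omap Cyl a0) a2.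
              h \<cdot>\<^bsub>C\<^esub> i0 a0 = g \<cdot>\<^bsub>C\<^esub> j \<longrightarrow>
              k a2 g h \<in> hom C (omap Cyl a1) a2 \<and>
              k a2 g h \<cdot>\<^bsub>C\<^esub> amap Cyl j = h \<and>
              k a2 g h \<cdot>\<^bsub>C\<^esub> i0 a1 = g) \<and>
           (\<forall>a2. \<forall>g\<in>hom C a1 a2.
              k a2 g (g \<cdot>\<^bsub>C\<^esub> j \<cdot>\<^bsub>C\<^esub> p a0) = g \<cdot>\<^bsub>C\<^esub> p a1) \<and>
           (\<forall>a2 a3. \<forall>g\<in>hom C a1 a2. \<forall>h\<in>hom C (omap Cyl a0) a2. \<forall>g'\<in>hom C a2 a3.
              h \<cdot>\<^bsub>C\<^esub> i0 a0 = g \<cdot>\<^bsub>C\<^esub> j \<longrightarrow>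
              g' \<cdot>\<^bsub>C\<^esub> k a2 g h = k a3 (g' \<cdot>\<^bsub>C\<^esub> g) (g' \<cdot>\<^bsub>C\<^esub> h)))}"


section \<open>Model structures\<close>

definition lifts_against :: "('o, 'a) cat \<Rightarrow> 'a \<Rightarrow> 'a \<Rightarrow> bool" where
  "lifts_against C j f \<longleftrightarrow>
     (\<forall>u\<in>hom C (Dom C j) (Dom C f). \<forall>v\<in>hom C (Cod C j) (Cod C f).
        f \<cdot>\<^bsub>C\<^esub> u = v \<cdot>\<^bsub>C\<^esub> j \<longrightarrow>
        (\<exists>l\<in>hom C (Cod C j) (Dom C f). l \<cdot>\<^bsub>C\<^esub> j = u \<and> f \<cdot>\<^bsub>C\<^esub> l = v))"

definition rlp :: "('o, 'a) cat \<Rightarrow> 'a set \<Rightarrow> 'a set" where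
  "rlp C X = {f \<in> Arr C. \<forall>j\<in>X. lifts_against C j f}"

definition llp :: "('o, 'a) cat \<Rightarrow> 'a set \<Rightarrow> 'a set" where
  "llp C X = {j \<in> Arr C. \<forall>f\<in>X. lifts_against C j f}"

definition model_structure ::
  "('o, 'a) cat \<Rightarrow> 'a set \<Rightarrow> 'a set \<Rightarrow> 'a set \<Rightarrow> bool" where
  "model_structure C W Fib Cof \<longleftrightarrow>
     W \<subseteq> Arr C \<and> Fib \<subseteq> Arr C \<and> Cof \<subseteq> Arr C \<and>
     (\<forall>a b c. \<forall>f\<in>hom C a b. \<forall>g\<in>hom C b c.
        (f \<in> W \<and> g \<in> W \<longrightarrow> g \<cdot>\<^bsub>C\<^esub> f \<in> W) \<and>
        (f \<in> W \<and> g \<cdot>\<^bsub>C\<^esub> f \<in> W \<longrightarrow> g \<in> W) \<and>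
        (g \<in> W \<and> g \<cdot>\<^bsub>C\<^esub> f \<in> W \<longrightarrow> f \<in> W)) \<and>
     Fib = rlp C (Cof \<inter> W) \<and>
     Fib \<inter> W = rlp C Cof \<and>
     Cof = llp C (Fib \<inter> W) \<and>
     Cof \<inter> W = llp C Fib \<and>
     (\<forall>a c. \<forall>f\<in>hom C a c.
        (\<exists>b. \<exists>j\<in>hom C a b. \<exists>q\<in>hom C b c. j \<in> Cof \<and> q \<in> Fib \<inter> W \<and> f = q \<cdot>\<^bsub>C\<^esub> j) \<and>
        (\<exists>b. \<exists>j\<in>hom C a b. \<exists>q\<in>hom C b c. j \<in> Cof \<inter> W \<and> q \<in> Fib \<and> f = q \<cdot>\<^bsub>C\<^esub> j))"

end

theory Submission
  imports Defs
begin

text \<open>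
  An arrow into \<open>coCyl b\<close> is regarded as a path in \<open>b\<close>. Call \<open>f : e \<rightarrow> b\<close> shrinkable if it has
  a section \<open>t\<close> and a homotopy from \<open>t f\<close> to the identity which stays in the fibres of \<open>f\<close>. The
  proof rests on the fact that trivial fibrations and shrinkable arrows are the same.

  A shrinkable arrow is a fibration: to lift a path from a given point, move inside the fibre to
  the image of \<open>t\<close> and then apply \<open>t\<close> to the path. The result lies over the path preceded by a
  constant one, which is the path itself, by strictness of identities (\<open>shrinking_Fib\<close>).
  Conversely, for a fibration which is a homotopy equivalence one finds a section \<open>t\<close> and a
  homotopy \<open>H\<close> from \<open>t f\<close> to the identity. The connections \<open>\<Gamma>lr'\<close> and \<open>\<Gamma>ur'\<close>, being compatible
  with subdivision, make the reverse of a path strictly inverse to it on one side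
  (\<open>concat_inverse\<close>), so \<open>H\<close> preceded by the reverse of \<open>t f H\<close> stays in the fibres
  (\<open>Fib_W_shrinking\<close>).

  A normal cleavage extends homotopies inside the fibres of an arbitrary arrow
  (\<open>Cof_iff\<close>). Hence normally cloven cofibrations lift against shrinkable arrows
  (\<open>Cof_lifts_shrinking\<close>).

  The first factorisation of \<open>f\<close> is through its mapping cylinder: the collapse of a mapping
  cylinder is shrinkable, and the inclusion of the other end is normally cloven, again by strictness
  of identities (\<open>mapping_cylinder_Cof\<close>). For the second one, attach to the domain \<open>x\<close> of \<open>f\<close> a
  cylinder on the mapping co-cylinder of \<open>f\<close>. The inclusion of \<open>x\<close> is then a pushout of some \<open>i0\<close>,
  so it lifts against all fibrations, and evaluation of paths is a fibration by strictness of
  identities and inverses (\<open>factor_llp_Fib\<close>).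

  The remaining axioms follow from these lifting properties and factorisations by retract
  arguments and two-out-of-three.
\<close>

section \<open>Categories, pushouts and the opposite category\<close>

lemma op_cat_sel [simp]:
  "Obj (op_cat C) = Obj C" "Arr (op_cat C) = Arr C" "Dom (op_cat C) = Cod C"
  "Cod (op_cat C) = Dom C" "Idt (op_cat C) = Idt C" "Cmp (op_cat C) g f = f \<cdot>\<^bsub>C\<^esub> g"
  by (simp_all add: op_cat_def)

lemma in_hom: "f \<in> hom C a b \<longleftrightarrow> f \<in> Arr C \<and> Dom C f = a \<and> Cod C f = b"
  by (simp add: hom_def)

lemma homD:
  assumes "f \<in> hom C a b"
  shows "f \<in> Arr C" "Dom C f = a" "Cod C f = b"
  using assms by (auto simp: in_hom)

lemma nat_trans_natural:
  "nat_trans C D F G \<eta> \<Longrightarrow> f \<in> hom C a b \<Longrightarrow>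
     \<eta> b \<cdot>\<^bsub>D\<^esub> amap F f = amap G f \<cdot>\<^bsub>D\<^esub> \<eta> a"
  unfolding nat_trans_def by metis

context category
begin

lemma Obj_hom: "f \<in> hom C a b \<Longrightarrow> a \<in> Obj C" "f \<in> hom C a b \<Longrightarrow> b \<in> Obj C"
  using Dom_in_Obj Cod_in_Obj by (auto simp: in_hom)

lemma arr_Obj [simp]: "f \<in> Arr C \<Longrightarrow> Dom C f \<in> Obj C" "f \<in> Arr C \<Longrightarrow> Cod C f \<in> Obj C"
  by (auto intro: Dom_in_Obj Cod_in_Obj)

lemma comp_arr [simp]:
  assumes "f \<in> Arr C" "g \<in> Arr C" "Cod C f = Dom C g"
  shows "g \<cdot> f \<in> Arr C" "Dom C (g \<cdot> f) = Dom C f" "Cod C (g \<cdot> f) = Cod C g"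
  using assms Cmp_in_hom[of f "Dom C f" "Cod C f" g "Cod C g"] by (auto simp: in_hom)

lemma comp_assoc [simp]:
  assumes "f \<in> Arr C" "g \<in> Arr C" "h \<in> Arr C" "Cod C f = Dom C g" "Cod C g = Dom C h"
  shows "(h \<cdot> g) \<cdot> f = h \<cdot> (g \<cdot> f)"
  using assms Cmp_assoc[of f "Dom C f" "Cod C f" g "Cod C g" h "Cod C h"] by (auto simp: in_hom)

lemma id_arr [simp]:
  assumes "a \<in> Obj C"
  shows "\<one> a \<in> Arr C" "Dom C (\<one> a) = a" "Cod C (\<one> a) = a"
  using Idt_in_hom[OF assms] by (auto simp: in_hom)

lemma comp_id [simp]:
  assumes "f \<in> Arr C"
  shows "Dom C f = a \<Longrightarrow> f \<cdot> \<one> a = f" "Cod C f = b \<Longrightarrow> \<one> b \<cdot> f = f"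
  using assms Cmp_Idt Idt_Cmp by (auto simp: in_hom)

text \<open>Composition being associated to the right, an equation between composites of two
  arrows must also be available in front of a further arrow in order to serve as a rewrite rule.\<close>

lemma reassoc:
  assumes "g \<cdot> f = k" "f \<in> Arr C" "g \<in> Arr C" "Cod C f = Dom C g" "z \<in> Arr C" "Cod C z = Dom C f"
  shows "g \<cdot> (f \<cdot> z) = k \<cdot> z"
  using assms comp_assoc[of z f g] by auto

end

lemma pushout_factor:
  assumes "is_pushout C f g u v" "m \<in> hom C (Cod C f) t" "n \<in> hom C (Cod C g) t"
    "m \<cdot>\<^bsub>C\<^esub> f = n \<cdot>\<^bsub>C\<^esub> g"
  obtains k where "k \<in> hom C (Cod C u) t" "k \<cdot>\<^bsub>C\<^esub> u = m" "k \<cdot>\<^bsub>C\<^esub> v = n"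
  using assms unfolding is_pushout_def by (metis homD(3))

lemma pushout_arr:
  assumes "is_pushout C f g u v"
  shows "f \<in> Arr C" "g \<in> Arr C" "u \<in> Arr C" "v \<in> Arr C" "Dom C g = Dom C f"
    "Dom C u = Cod C f" "Dom C v = Cod C g" "Cod C v = Cod C u"
    "u \<cdot>\<^bsub>C\<^esub> f = v \<cdot>\<^bsub>C\<^esub> g"
  using assms unfolding is_pushout_def by (auto simp: in_hom)

lemma (in category) pushout_eq:
  assumes po: "is_pushout C f g u v" and k: "k \<in> hom C (Cod C u) t" "k' \<in> hom C (Cod C u) t"
    and eq: "k \<cdot> u = k' \<cdot> u" "k \<cdot> v = k' \<cdot> v"
  shows "k = k'"
proof -
  note [simp] = pushout_arr(1-8)[OF po] homD[OF k(1)] homD[OF k(2)]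
  have "(k \<cdot> u) \<cdot> f = (k \<cdot> v) \<cdot> g"
    using pushout_arr(9)[OF po] by simp
  moreover have "k \<cdot> u \<in> hom C (Cod C f) t" "k \<cdot> v \<in> hom C (Cod C g) t"
    by (auto simp: in_hom)
  ultimately have "\<exists>!l. l \<in> hom C (Cod C u) t \<and> l \<cdot> u = k \<cdot> u \<and> l \<cdot> v = k \<cdot> v"
    using po unfolding is_pushout_def by (metis homD(3))
  then show ?thesis
    using k eq by metis
qed

lemma (in category) pushoutI:
  assumes "f \<in> hom C x y" "g \<in> hom C x z" "u \<in> hom C y w" "v \<in> hom C z w" "u \<cdot> f = v \<cdot> g"
    and "\<And>t m n. m \<in> hom C y t \<Longrightarrow> n \<in> hom C z t \<Longrightarrow> m \<cdot> f = n \<cdot> g \<Longrightarrow>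
      \<exists>k. k \<in> hom C w t \<and> k \<cdot> u = m \<and> k \<cdot> v = n"
    and "\<And>t k k'. k \<in> hom C w t \<Longrightarrow> k' \<in> hom C w t \<Longrightarrow> k \<cdot> u = k' \<cdot> u \<Longrightarrow> k \<cdot> v = k' \<cdot> v \<Longrightarrow> k = k'"
  shows "is_pushout C f g u v"
  unfolding is_pushout_def
  apply (intro exI conjI allI ballI impI)
       apply (rule assms(1-5))+
  using assms(6,7) by metis

definition has_pushouts :: "('o, 'a) cat \<Rightarrow> bool" where
  "has_pushouts C \<longleftrightarrow>
     (\<forall>x y z. \<forall>f\<in>hom C x y. \<forall>g\<in>hom C x z. \<exists>u v. is_pushout C f g u v)"

definition cospan_shape :: "(nat, nat) cat" where
  "cospan_shape = \<lparr>Obj = {0, 1, 2}, Arr = {0, 1, 2, 3, 4},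
     Dom = (\<lambda>f. if f = 3 then 1 else if f = 4 then 2 else f),
     Cod = (\<lambda>f. if f = 3 \<or> f = 4 then 0 else f),
     Idt = (\<lambda>a. a), Cmp = (\<lambda>g f. if f \<le> 2 then g else f)\<rparr>"

lemma category_cospan_shape: "category cospan_shape"
  by unfold_locales (auto simp: cospan_shape_def in_hom split: if_splits)

lemma (in category) has_pushouts_finite_colimits:
  assumes "has_finite_colimits C"
  shows "has_pushouts C"
  unfolding has_pushouts_def
proof (intro allI ballI)
  interpret op: category "op_cat C" by (rule category_op_cat) (rule category_axioms)
  fix x y z f g assume f: "f \<in> hom C x y" and g: "g \<in> hom C x z"
  note [simp] = homD[OF f] homD[OF g] Obj_hom[OF f] Obj_hom[OF g]
  define D :: "(nat, nat, 'o, 'a) func" where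
    "D = \<lparr>omap = (\<lambda>j. if j = 0 then x else if j = 1 then y else z),
          amap = (\<lambda>j. if j = 3 then f else if j = 4 then g
            else \<one> (if j = 0 then x else if j = 1 then y else z))\<rparr>"
  have D: "is_functor cospan_shape (op_cat C) D"
    unfolding is_functor_def
    by (intro conjI category_cospan_shape op.category_axioms)
      (auto simp: D_def in_hom cospan_shape_def split: if_splits)
  obtain w \<pi> where lim: "is_limit cospan_shape (op_cat C) D w \<pi>"
    using assms D unfolding has_finite_colimits_def has_finite_limits_def
    by (fastforce simp: cospan_shape_def)
  have shape: "Obj cospan_shape = {0, 1, 2}" by (simp add: cospan_shape_def)
  have cone: "nat_trans cospan_shape (op_cat C) (const_func (op_cat C) t) D \<xi>"
    if "m \<in> hom C y t" "n \<in> hom C z t" "m \<cdot> f = n \<cdot> g"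
      "\<xi> = (\<lambda>j. if j = 0 then m \<cdot> f else if j = 1 then m else n)" for t m n \<xi>
  proof -
    note [simp] = homD[OF that(1)] homD[OF that(2)] Obj_hom[OF that(1)]
    have "is_functor cospan_shape (op_cat C) (const_func (op_cat C) t)"
      unfolding is_functor_def
      by (auto simp: category_cospan_shape op.category_axioms const_func_def in_hom)
    then show ?thesis
      unfolding nat_trans_def using D that(3)
      by (auto simp: that(4) D_def const_func_def in_hom cospan_shape_def split: if_splits)
  qed
  have w: "w \<in> Obj C" and nat: "nat_trans cospan_shape (op_cat C) (const_func (op_cat C) w) D \<pi>"
    using lim unfolding is_limit_def by auto
  have \<pi>: "\<pi> 0 \<in> hom C x w" "\<pi> 1 \<in> hom C y w" "\<pi> 2 \<in> hom C z w"
    using nat unfolding nat_trans_def shape by (auto simp: const_func_def D_def)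
  have arr: "3 \<in> hom cospan_shape 1 0" "4 \<in> hom cospan_shape 2 0"
    by (auto simp: cospan_shape_def in_hom)
  note [simp] = homD[OF \<pi>(1)] homD[OF \<pi>(2), simplified One_nat_def] homD[OF \<pi>(3)] w
  have eq: "\<pi> 0 = \<pi> 1 \<cdot> f" "\<pi> 0 = \<pi> 2 \<cdot> g"
  proof -
    from nat_trans_natural[OF nat arr(1)] nat_trans_natural[OF nat arr(2)] show "\<pi> 0 = \<pi> 1 \<cdot> f" "\<pi> 0 = \<pi> 2 \<cdot> g"
      by (simp_all add: const_func_def D_def)
  qed
  have "is_pushout C f g (\<pi> 1) (\<pi> 2)"
  proof (rule pushoutI[OF f g \<pi>(2,3)])
    show "\<pi> 1 \<cdot> f = \<pi> 2 \<cdot> g" using eq by simp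
  next
    fix t m n assume m: "m \<in> hom C y t" and n: "n \<in> hom C z t" and mn: "m \<cdot> f = n \<cdot> g"
    have "\<exists>!u. u \<in> hom (op_cat C) t w \<and> (\<forall>j\<in>Obj cospan_shape. \<pi> j \<cdot>\<^bsub>op_cat C\<^esub> u =
        (\<lambda>j. if j = 0 then m \<cdot> f else if j = 1 then m else n) j)"
      using lim cone[OF m n mn refl] Obj_hom(2)[OF m] unfolding is_limit_def by simp
    then show "\<exists>k. k \<in> hom C w t \<and> k \<cdot> \<pi> 1 = m \<and> k \<cdot> \<pi> 2 = n"
      unfolding shape by auto
  next
    fix t k k' assume k: "k \<in> hom C w t" "k' \<in> hom C w t" and
      eqk: "k \<cdot> \<pi> 1 = k' \<cdot> \<pi> 1" "k \<cdot> \<pi> 2 = k' \<cdot> \<pi> 2"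
    note [simp] = homD[OF k(1)] homD[OF k(2)]
    have 1: "k \<cdot> \<pi> 1 \<in> hom C y t" "k \<cdot> \<pi> 2 \<in> hom C z t" by (auto simp: in_hom)
    have 2: "(k \<cdot> \<pi> 1) \<cdot> f = (k \<cdot> \<pi> 2) \<cdot> g" using eq by simp
    have 3: "k' \<cdot> (\<pi> 1 \<cdot> f) = k \<cdot> (\<pi> 1 \<cdot> f)"
      using arg_cong[OF eqk(1), of "\<lambda>l. l \<cdot> f"] by simp
    have "\<exists>!u. u \<in> hom (op_cat C) t w \<and> (\<forall>j\<in>Obj cospan_shape. \<pi> j \<cdot>\<^bsub>op_cat C\<^esub> u =
        (\<lambda>j. if j = 0 then (k \<cdot> \<pi> 1) \<cdot> f else if j = 1 then k \<cdot> \<pi> 1 else k \<cdot> \<pi> 2) j)"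
      using lim cone[OF 1 2 refl] Obj_hom(2)[OF k(1)] unfolding is_limit_def by simp
    moreover have "\<forall>j\<in>Obj cospan_shape. \<pi> j \<cdot>\<^bsub>op_cat C\<^esub> k =
        (\<lambda>j. if j = 0 then (k \<cdot> \<pi> 1) \<cdot> f else if j = 1 then k \<cdot> \<pi> 1 else k \<cdot> \<pi> 2) j"
      unfolding shape by (simp add: eq(1))
    moreover have "\<forall>j\<in>Obj cospan_shape. \<pi> j \<cdot>\<^bsub>op_cat C\<^esub> k' =
        (\<lambda>j. if j = 0 then (k \<cdot> \<pi> 1) \<cdot> f else if j = 1 then k \<cdot> \<pi> 1 else k \<cdot> \<pi> 2) j"
      unfolding shape using eqk 3 by (simp add: eq(1))
    ultimately show "k = k'" using k unfolding hom_op_cat by blast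
  qed
  then show "\<exists>u v. is_pushout C f g u v" by blast
qed

section \<open>Pushouts of endofunctors\<close>

lemma is_functor_op_cat [simp]:
  "category C \<Longrightarrow> is_functor (op_cat C) (op_cat C) F \<longleftrightarrow> is_functor C C F"
  by (auto simp: is_functor_def category_op_cat)

lemma nat_trans_op_cat [simp]:
  "category C \<Longrightarrow> nat_trans (op_cat C) (op_cat C) F G \<eta> \<longleftrightarrow> nat_trans C C G F \<eta>"
  by (auto simp: nat_trans_def)

context category
begin

lemma endo_arr:
  assumes "is_functor C C F"
  shows "a \<in> Obj C \<Longrightarrow> omap F a \<in> Obj C"
    and "f \<in> Arr C \<Longrightarrow> amap F f \<in> Arr C"
    and "f \<in> Arr C \<Longrightarrow> Dom C (amap F f) = omap F (Dom C f)"
    and "f \<in> Arr C \<Longrightarrow> Cod C (amap F f) = omap F (Cod C f)"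
    and "a \<in> Obj C \<Longrightarrow> amap F (\<one> a) = \<one> (omap F a)"
    and "f \<in> Arr C \<Longrightarrow> g \<in> Arr C \<Longrightarrow> Cod C f = Dom C g \<Longrightarrow> amap F (g \<cdot> f) = amap F g \<cdot> amap F f"
proof -
  have hom: "g \<in> hom C a b \<Longrightarrow> amap F g \<in> hom C (omap F a) (omap F b)" for g a b
    using assms unfolding is_functor_def by blast
  show "a \<in> Obj C \<Longrightarrow> omap F a \<in> Obj C" "a \<in> Obj C \<Longrightarrow> amap F (\<one> a) = \<one> (omap F a)"
    using assms unfolding is_functor_def by blast+
  show "f \<in> Arr C \<Longrightarrow> amap F f \<in> Arr C" "f \<in> Arr C \<Longrightarrow> Dom C (amap F f) = omap F (Dom C f)"
    "f \<in> Arr C \<Longrightarrow> Cod C (amap F f) = omap F (Cod C f)"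
    using hom[of f "Dom C f" "Cod C f"] by (auto simp: in_hom)
  show "amap F (g \<cdot> f) = amap F g \<cdot> amap F f"
    if "f \<in> Arr C" "g \<in> Arr C" "Cod C f = Dom C g"
  proof -
    have "f \<in> hom C (Dom C f) (Dom C g)" "g \<in> hom C (Dom C g) (Cod C g)"
      using that by (auto simp: in_hom)
    then show ?thesis using assms unfolding is_functor_def by blast
  qed
qed

lemma nat_arr:
  assumes "nat_trans C C F G \<eta>"
  shows "a \<in> Obj C \<Longrightarrow> \<eta> a \<in> Arr C"
    and "a \<in> Obj C \<Longrightarrow> Dom C (\<eta> a) = omap F a"
    and "a \<in> Obj C \<Longrightarrow> Cod C (\<eta> a) = omap G a"
  using assms unfolding nat_trans_def in_hom by auto

lemma nat_natural:
  assumes "nat_trans C C F G \<eta>" "f \<in> Arr C"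
  shows "Dom C f = a \<Longrightarrow> amap G f \<cdot> \<eta> a = \<eta> (Cod C f) \<cdot> amap F f"
    and "Dom C f = a \<Longrightarrow> z \<in> Arr C \<Longrightarrow> Cod C z = omap F a \<Longrightarrow>
      amap G f \<cdot> (\<eta> a \<cdot> z) = \<eta> (Cod C f) \<cdot> (amap F f \<cdot> z)"
proof -
  have F: "is_functor C C F" and G: "is_functor C C G" using assms by (auto simp: nat_trans_def)
  note [simp] = endo_arr[OF F] endo_arr[OF G] nat_arr[OF assms(1)]
  show eq: "amap G f \<cdot> \<eta> a = \<eta> (Cod C f) \<cdot> amap F f" if "Dom C f = a" for a
    using nat_trans_natural[OF assms(1), of f a "Cod C f"] assms(2) that by (simp add: in_hom)
  show "amap G f \<cdot> (\<eta> a \<cdot> z) = \<eta> (Cod C f) \<cdot> (amap F f \<cdot> z)"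
    if "Dom C f = a" "z \<in> Arr C" "Cod C z = omap F a"
    using reassoc[OF eq[OF that(1)], of z] that assms(2) by auto
qed

lemma endo_id_func [simp]: "is_functor C C id_func"
  by (auto simp: is_functor_def id_func_def category_axioms)

lemma id_func_sel [simp]: "omap id_func a = a" "amap id_func f = f"
  by (simp_all add: id_func_def)

text \<open>Pushouts chosen in each object form an endofunctor \<open>T\<close>. The universal property of \<open>W\<close>
  among endofunctors gives \<open>\<kappa> : W \<rightarrow> T\<close>, that of \<open>T\<close> in each object gives \<open>\<mu> : T \<rightarrow> W\<close>, and
  \<open>\<mu> \<circ> \<kappa>\<close> is the identity, so the universal property of \<open>T\<close> passes to \<open>W\<close>.\<close>

lemma endo_pushout_objectwise:
  assumes pushouts: "has_pushouts C" and po: "is_endo_pushout C X Y Z W f g u v" and a: "a \<in> Obj C"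
  shows "is_pushout C (f a) (g a) (u a) (v a)"
proof -
  have nat: "nat_trans C C X Y f" "nat_trans C C X Z g" "nat_trans C C Y W u" "nat_trans C C Z W v"
    and comm: "\<And>a. a \<in> Obj C \<Longrightarrow> u a \<cdot> f a = v a \<cdot> g a"
    and univ: "\<And>T m n. nat_trans C C Y T m \<Longrightarrow> nat_trans C C Z T n \<Longrightarrow>
        (\<And>a. a\<in>Obj C \<Longrightarrow> m a \<cdot> f a = n a \<cdot> g a) \<Longrightarrow>
        (\<exists>k. nat_trans C C W T k \<and>
           (\<forall>a\<in>Obj C. k a \<cdot> u a = m a \<and> k a \<cdot> v a = n a) \<and>
           (\<forall>k'. nat_trans C C W T k' \<and>
              (\<forall>a\<in>Obj C. k' a \<cdot> u a = m a \<and> k' a \<cdot> v a = n a) \<longrightarrow>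
              (\<forall>a\<in>Obj C. k' a = k a)))"
    using po unfolding is_endo_pushout_def by blast+
  have fn: "is_functor C C X" "is_functor C C Y" "is_functor C C Z" "is_functor C C W"
    using nat by (auto simp: nat_trans_def)
  note [simp] = endo_arr[OF fn(1)] endo_arr[OF fn(2)] endo_arr[OF fn(3)] endo_arr[OF fn(4)]
    nat_arr[OF nat(1)] nat_arr[OF nat(2)] nat_arr[OF nat(3)] nat_arr[OF nat(4)]
  have "\<exists>u' v'. is_pushout C (f a) (g a) u' v'" if "a \<in> Obj C" for a
    using pushouts that unfolding has_pushouts_def by (simp add: in_hom)
  then obtain u' v' where po': "\<And>a. a \<in> Obj C \<Longrightarrow> is_pushout C (f a) (g a) (u' a) (v' a)"
    by metis
  have arr' [simp]: "u' a \<in> Arr C" "v' a \<in> Arr C" "Dom C (u' a) = omap Y a" "Dom C (v' a) = omap Z a"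
    "Cod C (v' a) = Cod C (u' a)" if "a \<in> Obj C" for a
    using pushout_arr[OF po'[OF that]] that by auto
  have comm': "u' a \<cdot> f a = v' a \<cdot> g a" if "a \<in> Obj C" for a
    using pushout_arr(9)[OF po'[OF that]] .
  define To where "To a = Cod C (u' a)" for a
  have [simp]: "a \<in> Obj C \<Longrightarrow> Cod C (u' a) = To a" for a by (simp add: To_def)
  have [simp]: "a \<in> Obj C \<Longrightarrow> To a \<in> Obj C" for a
    unfolding To_def by (rule arr_Obj(2)) simp
  have factor: "\<exists>k. k \<in> hom C (To a) t \<and> k \<cdot> u' a = m \<and> k \<cdot> v' a = n"
    if "a \<in> Obj C" "m \<in> hom C (omap Y a) t" "n \<in> hom C (omap Z a) t" "m \<cdot> f a = n \<cdot> g a" for a m n t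
    using pushout_factor[OF po'[OF that(1)], of m t n] that by (metis To_def nat_arr(3) nat(1,2))
  have eq: "k = k'" if "a \<in> Obj C" "k \<in> hom C (To a) t" "k' \<in> hom C (To a) t"
    "k \<cdot> u' a = k' \<cdot> u' a" "k \<cdot> v' a = k' \<cdot> v' a" for a k k' t
    using pushout_eq[OF po'[OF that(1)], of k t k'] that unfolding To_def by blast
  have "\<exists>k. k \<in> hom C (To (Dom C h)) (To (Cod C h)) \<and>
      k \<cdot> u' (Dom C h) = u' (Cod C h) \<cdot> amap Y h \<and> k \<cdot> v' (Dom C h) = v' (Cod C h) \<cdot> amap Z h"
    if [simp]: "h \<in> Arr C" for h
    apply (rule factor)
    using reassoc[OF comm', of "Cod C h" "amap X h"]
    by (auto simp: in_hom nat_natural[OF nat(1), symmetric] nat_natural[OF nat(2), symmetric])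
  then obtain Ta where Ta: "\<And>h. h \<in> Arr C \<Longrightarrow> Ta h \<in> hom C (To (Dom C h)) (To (Cod C h))"
    and Tu: "\<And>h. h \<in> Arr C \<Longrightarrow> Ta h \<cdot> u' (Dom C h) = u' (Cod C h) \<cdot> amap Y h"
    and Tv: "\<And>h. h \<in> Arr C \<Longrightarrow> Ta h \<cdot> v' (Dom C h) = v' (Cod C h) \<cdot> amap Z h"
    by metis
  note [simp] = homD[OF Ta]
  define T where "T = \<lparr>omap = To, amap = Ta\<rparr>"
  have [simp]: "omap T = To" "amap T = Ta" by (simp_all add: T_def)
  have T: "is_functor C C T"
    unfolding is_functor_def
  proof (intro conjI ballI allI category_axioms)
    fix a assume [simp]: "a \<in> Obj C"
    show "amap T (\<one> a) = \<one> (omap T a)"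
      by (rule eq[of a _ "To a"]) (use Tu[of "\<one> a"] Tv[of "\<one> a"] in \<open>auto simp: in_hom\<close>)
  next
    fix a b c h k assume hk: "h \<in> hom C a b" "k \<in> hom C b c"
    note [simp] = homD[OF hk(1)] homD[OF hk(2)] Obj_hom[OF hk(1)] Obj_hom[OF hk(2)]
    have Tu': "Ta h \<cdot> u' a = u' b \<cdot> amap Y h" "Ta k \<cdot> u' b = u' c \<cdot> amap Y k"
      "Ta h \<cdot> v' a = v' b \<cdot> amap Z h" "Ta k \<cdot> v' b = v' c \<cdot> amap Z k"
      using Tu[of h] Tu[of k] Tv[of h] Tv[of k] by simp_all
    show "amap T (k \<cdot> h) = amap T k \<cdot> amap T h"
      by (rule eq[of a _ "To c"])
        (use Tu[of "k \<cdot> h"] Tv[of "k \<cdot> h"] Tu'(2)[THEN reassoc] Tu'(4)[THEN reassoc]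
         in \<open>auto simp: in_hom Tu'\<close>)
  qed (auto simp: in_hom)
  have nat': "nat_trans C C Y T u'" "nat_trans C C Z T v'"
    using T fn Tu Tv by (auto simp: nat_trans_def in_hom)
  obtain \<kappa> where \<kappa>: "nat_trans C C W T \<kappa>"
    and \<kappa>u: "\<And>a. a \<in> Obj C \<Longrightarrow> \<kappa> a \<cdot> u a = u' a" and \<kappa>v: "\<And>a. a \<in> Obj C \<Longrightarrow> \<kappa> a \<cdot> v a = v' a"
    using univ[OF nat' comm'] by blast
  note [simp] = nat_arr[OF \<kappa>, simplified]
  have "\<exists>k. k \<in> hom C (To a) (omap W a) \<and> k \<cdot> u' a = u a \<and> k \<cdot> v' a = v a" if "a \<in> Obj C" for a
    by (rule factor) (use that comm in \<open>auto simp: in_hom\<close>)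
  then obtain \<mu> where \<mu>: "\<And>a. a \<in> Obj C \<Longrightarrow> \<mu> a \<in> hom C (To a) (omap W a)"
    and \<mu>u: "\<And>a. a \<in> Obj C \<Longrightarrow> \<mu> a \<cdot> u' a = u a" and \<mu>v: "\<And>a. a \<in> Obj C \<Longrightarrow> \<mu> a \<cdot> v' a = v a"
    by metis
  note [simp] = homD[OF \<mu>]
  have \<mu>nat: "\<mu> b \<cdot> Ta h = amap W h \<cdot> \<mu> a" if h: "h \<in> hom C a b" for h a b
  proof -
    note [simp] = homD[OF h] Obj_hom[OF h]
    have Tu': "Ta h \<cdot> u' a = u' b \<cdot> amap Y h" "Ta h \<cdot> v' a = v' b \<cdot> amap Z h"
      using Tu[of h] Tv[of h] by simp_all
    show ?thesis
      by (rule eq[of a _ "omap W b"])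
        (auto simp: in_hom Tu' \<mu>u \<mu>v \<mu>u[THEN reassoc] \<mu>v[THEN reassoc]
          nat_natural[OF nat(3)] nat_natural[OF nat(4)])
  qed
  have \<mu>\<kappa>: "nat_trans C C W W (\<lambda>a. \<mu> a \<cdot> \<kappa> a)"
    unfolding nat_trans_def
  proof (intro conjI ballI allI fn(4))
    fix a b h assume h: "h \<in> hom C a b"
    note [simp] = homD[OF h] Obj_hom[OF h]
    show "(\<mu> b \<cdot> \<kappa> b) \<cdot> amap W h = amap W h \<cdot> (\<mu> a \<cdot> \<kappa> a)"
      using nat_natural(1)[OF \<kappa>, of h a, symmetric] reassoc[OF \<mu>nat[OF h], of "\<kappa> a"] by simp
  qed (auto simp: in_hom)
  have id: "nat_trans C C W W (\<lambda>a. \<one> (omap W a))"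
    using fn(4) by (auto simp: nat_trans_def in_hom)
  have \<mu>\<kappa>_id: "\<mu> a \<cdot> \<kappa> a = \<one> (omap W a)" if "a \<in> Obj C" for a
  proof -
    have eqs: "\<forall>a\<in>Obj C. (\<mu> a \<cdot> \<kappa> a) \<cdot> u a = u a \<and> (\<mu> a \<cdot> \<kappa> a) \<cdot> v a = v a"
      "\<forall>a\<in>Obj C. \<one> (omap W a) \<cdot> u a = u a \<and> \<one> (omap W a) \<cdot> v a = v a"
      by (simp_all add: \<kappa>u \<kappa>v \<mu>u \<mu>v)
    obtain k where k: "\<And>k'. nat_trans C C W W k' \<Longrightarrow>
         (\<forall>a\<in>Obj C. k' a \<cdot> u a = u a \<and> k' a \<cdot> v a = v a) \<Longrightarrow> (\<forall>a\<in>Obj C. k' a = k a)"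
      using univ[OF nat(3,4) comm] by blast
    show ?thesis
      using k[OF \<mu>\<kappa> eqs(1)] k[OF id eqs(2)] that by simp
  qed
  show ?thesis
  proof (rule pushoutI)
    show "f a \<in> hom C (omap X a) (omap Y a)" "g a \<in> hom C (omap X a) (omap Z a)"
      "u a \<in> hom C (omap Y a) (omap W a)" "v a \<in> hom C (omap Z a) (omap W a)" "u a \<cdot> f a = v a \<cdot> g a"
      using a comm by (auto simp: in_hom)
  next
    fix t m n assume "m \<in> hom C (omap Y a) t" "n \<in> hom C (omap Z a) t" "m \<cdot> f a = n \<cdot> g a"
    with a obtain k where k: "k \<in> hom C (To a) t" and "k \<cdot> u' a = m" "k \<cdot> v' a = n"
      using factor by blast
    then show "\<exists>k. k \<in> hom C (omap W a) t \<and> k \<cdot> u a = m \<and> k \<cdot> v a = n"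
      using a homD[OF k] by (intro exI[of _ "k \<cdot> \<kappa> a"]) (auto simp: in_hom \<kappa>u \<kappa>v)
  next
    fix t k k' assume k: "k \<in> hom C (omap W a) t" "k' \<in> hom C (omap W a) t"
      and eqs: "k \<cdot> u a = k' \<cdot> u a" "k \<cdot> v a = k' \<cdot> v a"
    note [simp] = homD[OF k(1)] homD[OF k(2)] a
    have "k \<cdot> \<mu> a = k' \<cdot> \<mu> a"
      by (rule eq[of a _ t]) (simp_all add: in_hom \<mu>u \<mu>v eqs)
    then have "(k \<cdot> \<mu> a) \<cdot> \<kappa> a = (k' \<cdot> \<mu> a) \<cdot> \<kappa> a" by simp
    then show "k = k'" by (simp add: \<mu>\<kappa>_id)
  qed
qed

end

section \<open>Concatenation of homotopies\<close>

locale subdivided_cylinder = category C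
  for C :: "('o, 'a) cat" (structure) +
  fixes Cyl S :: "('o, 'a) endo" and i0 i1 p r0 r1 s :: "'o \<Rightarrow> 'a"
  assumes pushouts: "has_pushouts C"
    and cylinder: "cylinder C Cyl i0 i1"
    and contraction: "contraction C Cyl i0 i1 p"
    and subdivision: "subdivision C Cyl i0 i1 S r0 r1 s"
    and strictness: "strictness_of_identities C Cyl i0 i1 p S r0 r1 s"
begin

lemma nat_cyl:
  "nat_trans C C id_func Cyl i0" "nat_trans C C id_func Cyl i1" "nat_trans C C Cyl id_func p"
  "nat_trans C C Cyl S r0" "nat_trans C C Cyl S r1" "nat_trans C C Cyl S s"
  using cylinder contraction subdivision
  unfolding cylinder_def contraction_def subdivision_def is_endo_pushout_def by auto

lemma endo_cyl: "is_functor C C Cyl" "is_functor C C S"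
  using nat_cyl(1,4) by (auto simp: nat_trans_def)

lemmas cyl_simps [simp] =
  endo_arr[OF endo_cyl(1)] endo_arr[OF endo_cyl(2)]
  nat_arr[OF nat_cyl(1), simplified] nat_arr[OF nat_cyl(2), simplified]
  nat_arr[OF nat_cyl(3), simplified] nat_arr[OF nat_cyl(4)] nat_arr[OF nat_cyl(5)]
  nat_arr[OF nat_cyl(6)]

lemma p_i [simp]: "a \<in> Obj C \<Longrightarrow> p a \<cdot> i0 a = \<one> a" "a \<in> Obj C \<Longrightarrow> p a \<cdot> i1 a = \<one> a"
  using contraction by (auto simp: contraction_def)

lemma p_i_comp [simp]:
  "z \<in> Arr C \<Longrightarrow> Cod C z = a \<Longrightarrow> p a \<cdot> (i0 a \<cdot> z) = z"
  "z \<in> Arr C \<Longrightarrow> Cod C z = a \<Longrightarrow> p a \<cdot> (i1 a \<cdot> z) = z"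
  using reassoc[OF p_i(1), of a z] reassoc[OF p_i(2), of a z] by auto

lemma s_i: "a \<in> Obj C \<Longrightarrow> s a \<cdot> i0 a = r1 a \<cdot> i0 a" "a \<in> Obj C \<Longrightarrow> s a \<cdot> i1 a = r0 a \<cdot> i1 a"
  using subdivision by (auto simp: subdivision_def)

lemma subdivision_pushout: "a \<in> Obj C \<Longrightarrow> is_pushout C (i0 a) (i1 a) (r0 a) (r1 a)"
  using subdivision by (auto simp: subdivision_def intro: endo_pushout_objectwise pushouts)

text \<open>The first homotopy is put on \<open>r1\<close> and the second on \<open>r0\<close>, since \<open>s\<close> starts at
  \<open>r1 \<circ> i0\<close>.\<close>

definition concat :: "'o \<Rightarrow> 'a \<Rightarrow> 'a \<Rightarrow> 'a" where
  "concat a h k =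
     (THE m. m \<in> hom C (omap S a) (Cod C h) \<and> m \<cdot> r1 a = h \<and> m \<cdot> r0 a = k) \<cdot> s a"

lemma concat_eqI:
  assumes "a \<in> Obj C" "m \<in> hom C (omap S a) b" "m \<cdot> r1 a = h" "m \<cdot> r0 a = k"
  shows "concat a h k = m \<cdot> s a"
proof -
  note [simp] = assms(1) homD[OF assms(2)]
  have "(THE m. m \<in> hom C (omap S a) (Cod C h) \<and> m \<cdot> r1 a = h \<and> m \<cdot> r0 a = k) = m"
    using assms pushout_eq[OF subdivision_pushout[OF assms(1)], of _ b m]
    by (intro the_equality) (auto simp: in_hom)
  then show ?thesis by (simp add: concat_def)
qed

lemma concat_factor:
  assumes "a \<in> Obj C" "h \<in> hom C (omap Cyl a) b" "k \<in> hom C (omap Cyl a) b" "h \<cdot> i1 a = k \<cdot> i0 a"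
  obtains m where "m \<in> hom C (omap S a) b" "m \<cdot> r1 a = h" "m \<cdot> r0 a = k" "concat a h k = m \<cdot> s a"
  using pushout_factor[OF subdivision_pushout[OF assms(1)], of k b h] assms concat_eqI
  by (metis cyl_simps(15,18,24))

lemma concat_hom:
  assumes "a \<in> Obj C" "h \<in> hom C (omap Cyl a) b" "k \<in> hom C (omap Cyl a) b" "h \<cdot> i1 a = k \<cdot> i0 a"
  shows "concat a h k \<in> hom C (omap Cyl a) b"
    and "concat a h k \<cdot> i0 a = h \<cdot> i0 a" and "concat a h k \<cdot> i1 a = k \<cdot> i1 a"
proof -
  obtain m where m: "m \<in> hom C (omap S a) b" "m \<cdot> r1 a = h" "m \<cdot> r0 a = k" "concat a h k = m \<cdot> s a"
    using concat_factor assms .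
  note [simp] = assms(1) homD[OF m(1)]
  show "concat a h k \<in> hom C (omap Cyl a) b"
    by (simp add: m in_hom)
  show "concat a h k \<cdot> i0 a = h \<cdot> i0 a" "concat a h k \<cdot> i1 a = k \<cdot> i1 a"
    using reassoc[OF m(2), of "i0 a"] reassoc[OF m(3), of "i1 a"] by (simp_all add: m(4) s_i)
qed

lemma comp_concat:
  assumes "a \<in> Obj C" "h \<in> hom C (omap Cyl a) b" "k \<in> hom C (omap Cyl a) b" "h \<cdot> i1 a = k \<cdot> i0 a"
    and w: "w \<in> hom C b b'"
  shows "w \<cdot> concat a h k = concat a (w \<cdot> h) (w \<cdot> k)"
proof -
  obtain m where m: "m \<in> hom C (omap S a) b" "m \<cdot> r1 a = h" "m \<cdot> r0 a = k" "concat a h k = m \<cdot> s a"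
    using concat_factor assms(1-4) .
  note [simp] = assms(1) homD[OF m(1)] homD[OF w]
  show ?thesis
    using concat_eqI[of a "w \<cdot> m" b' "w \<cdot> h" "w \<cdot> k"] m by (auto simp: in_hom)
qed

lemma concat_comp:
  assumes "a \<in> Obj C" "h \<in> hom C (omap Cyl a) b" "k \<in> hom C (omap Cyl a) b" "h \<cdot> i1 a = k \<cdot> i0 a"
    and u: "u \<in> hom C a' a"
  shows "concat a h k \<cdot> amap Cyl u = concat a' (h \<cdot> amap Cyl u) (k \<cdot> amap Cyl u)"
proof -
  obtain m where m: "m \<in> hom C (omap S a) b" "m \<cdot> r1 a = h" "m \<cdot> r0 a = k" "concat a h k = m \<cdot> s a"
    using concat_factor assms(1-4) .
  note [simp] = assms(1) homD[OF m(1)] homD[OF u] Obj_hom[OF u]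
  have "concat a' (h \<cdot> amap Cyl u) (k \<cdot> amap Cyl u) = (m \<cdot> amap S u) \<cdot> s a'"
    using m(2,3) by (intro concat_eqI[of _ _ b])
      (auto simp: in_hom nat_natural[OF nat_cyl(4)] nat_natural[OF nat_cyl(5)])
  then show ?thesis
    by (simp add: m(4) nat_natural[OF nat_cyl(6)])
qed

lemma concat_id:
  assumes h: "h \<in> hom C (omap Cyl a) b" and a: "a \<in> Obj C"
  shows "concat a (h \<cdot> (i0 a \<cdot> p a)) h = h" and "concat a h (h \<cdot> (i1 a \<cdot> p a)) = h"
proof -
  note [simp] = homD[OF h] a
  obtain ql where ql: "nat_trans C C S Cyl ql"
    and eql: "ql a \<cdot> r0 a = \<one> (omap Cyl a)" "ql a \<cdot> r1 a = i0 a \<cdot> p a" "ql a \<cdot> s a = \<one> (omap Cyl a)"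
    using strictness a unfolding strictness_of_identities_def by blast
  note [simp] = nat_arr[OF ql]
  show "concat a (h \<cdot> (i0 a \<cdot> p a)) h = h"
    using concat_eqI[of a "h \<cdot> ql a" b] eql by (auto simp: in_hom)
next
  note [simp] = homD[OF h] a
  obtain qr where qr: "nat_trans C C S Cyl qr"
    and eqr: "qr a \<cdot> r0 a = i1 a \<cdot> p a" "qr a \<cdot> r1 a = \<one> (omap Cyl a)" "qr a \<cdot> s a = \<one> (omap Cyl a)"
    using strictness a unfolding strictness_of_identities_def by blast
  note [simp] = nat_arr[OF qr]
  show "concat a h (h \<cdot> (i1 a \<cdot> p a)) = h"
    using concat_eqI[of a "h \<cdot> qr a" b] eqr by (auto simp: in_hom)
qed

text \<open>The square \<open>x\<close> has the connections as its two halves, and its edge at \<open>Cyl \<cdot> i1\<close> is the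
  reverse of a homotopy followed by the homotopy; that \<open>x \<circ> (s \<cdot> Cyl)\<close> is constant
  therefore says that a reverse is strictly inverse on the left.\<close>

lemma concat_inverse:
  assumes lr: "lower_right_connection C Cyl i0 i1 p \<Gamma>lr"
    and ur: "upper_right_connection C Cyl i0 i1 p v \<Gamma>ur"
    and compat: "connections_subdivision_compatible C Cyl p S r0 r1 s \<Gamma>lr \<Gamma>ur"
    and h: "h \<in> hom C (omap Cyl a) b" and a: "a \<in> Obj C"
  shows "concat a (h \<cdot> v a) h = h \<cdot> (i1 a \<cdot> p a)"
proof -
  obtain x where x: "nat_trans C C (comp_func S Cyl) Cyl x"
    and eqx: "x a \<cdot> r0 (omap Cyl a) = \<Gamma>lr a" "x a \<cdot> r1 (omap Cyl a) = \<Gamma>ur a"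
      "x a \<cdot> s (omap Cyl a) = p (omap Cyl a)"
    using compat a unfolding connections_subdivision_compatible_def by blast
  have edge: "\<Gamma>lr a \<cdot> amap Cyl (i1 a) = \<one> (omap Cyl a)" "\<Gamma>ur a \<cdot> amap Cyl (i1 a) = v a"
    using lr ur a unfolding lower_right_connection_def upper_right_connection_def by auto
  have [simp]: "x a \<in> Arr C" "Dom C (x a) = omap S (omap Cyl a)" "Cod C (x a) = omap Cyl a"
    using nat_arr[OF x] a by (auto simp: comp_func_def)
  note [simp] = homD[OF h] a
  have "concat a (h \<cdot> v a) h = (h \<cdot> (x a \<cdot> amap S (i1 a))) \<cdot> s a"
    using reassoc[OF eqx(1), of "amap Cyl (i1 a)"] reassoc[OF eqx(2), of "amap Cyl (i1 a)"]
    by (intro concat_eqI[of _ _ b])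
      (auto simp: in_hom edge nat_natural[OF nat_cyl(4)] nat_natural[OF nat_cyl(5)])
  also have "\<dots> = h \<cdot> (i1 a \<cdot> p a)"
    using reassoc[OF eqx(3), of "amap Cyl (i1 a)"] nat_natural(1)[OF nat_cyl(3), of "i1 a" a]
    by (simp add: nat_natural[OF nat_cyl(6)])
  finally show ?thesis .
qed

end

section \<open>A cylinder left adjoint to a co-cylinder\<close>

text \<open>The co-cylinder functor is called \<open>P\<close>, for paths.\<close>

locale cylinder_adjunction =
  cyl: subdivided_cylinder A Cyl S i0 i1 p r0 r1 s +
  cocyl: subdivided_cylinder "op_cat A" P S' e0 e1 c r0' r1' s'
  for A :: "('o, 'a) cat" (structure)
    and Cyl S P S' :: "('o, 'a) endo"
    and i0 i1 p r0 r1 s e0 e1 c r0' r1' s' :: "'o \<Rightarrow> 'a" +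
  fixes \<Gamma>lr v' \<Gamma>lr' \<Gamma>ur' :: "'o \<Rightarrow> 'a" and adj :: "'o \<Rightarrow> 'o \<Rightarrow> 'a \<Rightarrow> 'a"
  assumes lr: "lower_right_connection A Cyl i0 i1 p \<Gamma>lr"
    and lr_compatible: "lower_right_compatible A Cyl p \<Gamma>lr"
    and inv': "involution (op_cat A) P e0 e1 v'"
    and inv_compatible': "involution_compatible (op_cat A) c v'"
    and lr': "lower_right_connection (op_cat A) P e0 e1 c \<Gamma>lr'"
    and ur': "upper_right_connection (op_cat A) P e0 e1 c v' \<Gamma>ur'"
    and connections': "connections_subdivision_compatible (op_cat A) P c S' r0' r1' s' \<Gamma>lr' \<Gamma>ur'"
    and adjoint: "cylinder_left_adjoint A Cyl i0 i1 P e0 e1 adj"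
    and adj_compatible: "adjunction_compatible A p c adj"
begin

lemmas category_A = cyl.category_axioms

lemma nat_cocyl:
  "nat_trans A A P id_func e0" "nat_trans A A P id_func e1" "nat_trans A A id_func P c"
  "nat_trans A A P P v'"
  using cocyl.nat_cyl inv' category_A by (auto simp: involution_def)

lemma endo_P: "is_functor A A P"
  using nat_cocyl(1) by (auto simp: nat_trans_def)

lemma nat_\<Gamma>: "nat_trans A A (comp_func Cyl Cyl) Cyl \<Gamma>lr"
  using lr by (simp add: lower_right_connection_def)

lemmas cocyl_simps [simp] =
  cyl.endo_arr[OF endo_P]
  cyl.nat_arr[OF nat_cocyl(1), simplified] cyl.nat_arr[OF nat_cocyl(2), simplified]
  cyl.nat_arr[OF nat_cocyl(3), simplified] cyl.nat_arr[OF nat_cocyl(4)]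
  cyl.nat_arr[OF nat_\<Gamma>, unfolded comp_func_def, simplified]

lemma e_c [simp]:
  "b \<in> Obj A \<Longrightarrow> e0 b \<cdot> c b = \<one> b" "b \<in> Obj A \<Longrightarrow> e1 b \<cdot> c b = \<one> b"
  "z \<in> Arr A \<Longrightarrow> Cod A z = b \<Longrightarrow> e0 b \<cdot> (c b \<cdot> z) = z"
  "z \<in> Arr A \<Longrightarrow> Cod A z = b \<Longrightarrow> e1 b \<cdot> (c b \<cdot> z) = z"
proof -
  show ec: "b \<in> Obj A \<Longrightarrow> e0 b \<cdot> c b = \<one> b" "b \<in> Obj A \<Longrightarrow> e1 b \<cdot> c b = \<one> b" for b
    using cocyl.p_i by auto
  show "z \<in> Arr A \<Longrightarrow> Cod A z = b \<Longrightarrow> e0 b \<cdot> (c b \<cdot> z) = z"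
    "z \<in> Arr A \<Longrightarrow> Cod A z = b \<Longrightarrow> e1 b \<cdot> (c b \<cdot> z) = z"
    using cyl.reassoc[OF ec(1), of b z] cyl.reassoc[OF ec(2), of b z] by auto
qed

lemma e_v [simp]:
  "b \<in> Obj A \<Longrightarrow> e0 b \<cdot> v' b = e1 b" "b \<in> Obj A \<Longrightarrow> e1 b \<cdot> v' b = e0 b" "b \<in> Obj A \<Longrightarrow> v' b \<cdot> c b = c b"
  "b \<in> Obj A \<Longrightarrow> z \<in> Arr A \<Longrightarrow> Cod A z = omap P b \<Longrightarrow> e0 b \<cdot> (v' b \<cdot> z) = e1 b \<cdot> z"
  "b \<in> Obj A \<Longrightarrow> z \<in> Arr A \<Longrightarrow> Cod A z = omap P b \<Longrightarrow> e1 b \<cdot> (v' b \<cdot> z) = e0 b \<cdot> z"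
  "b \<in> Obj A \<Longrightarrow> z \<in> Arr A \<Longrightarrow> Cod A z = b \<Longrightarrow> v' b \<cdot> (c b \<cdot> z) = c b \<cdot> z"
proof -
  show ev: "b \<in> Obj A \<Longrightarrow> e0 b \<cdot> v' b = e1 b" "b \<in> Obj A \<Longrightarrow> e1 b \<cdot> v' b = e0 b"
    "b \<in> Obj A \<Longrightarrow> v' b \<cdot> c b = c b" for b
    using inv' inv_compatible' by (auto simp: involution_def involution_compatible_def)
  show "b \<in> Obj A \<Longrightarrow> z \<in> Arr A \<Longrightarrow> Cod A z = omap P b \<Longrightarrow> e0 b \<cdot> (v' b \<cdot> z) = e1 b \<cdot> z"
    "b \<in> Obj A \<Longrightarrow> z \<in> Arr A \<Longrightarrow> Cod A z = omap P b \<Longrightarrow> e1 b \<cdot> (v' b \<cdot> z) = e0 b \<cdot> z"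
    "b \<in> Obj A \<Longrightarrow> z \<in> Arr A \<Longrightarrow> Cod A z = b \<Longrightarrow> v' b \<cdot> (c b \<cdot> z) = c b \<cdot> z"
    using cyl.reassoc[OF ev(1), of b z] cyl.reassoc[OF ev(2), of b z] cyl.reassoc[OF ev(3), of b z]
    by auto
qed

lemma connection [simp]:
  assumes "a \<in> Obj A"
  shows "\<Gamma>lr a \<cdot> i0 (omap Cyl a) = i0 a \<cdot> p a" "\<Gamma>lr a \<cdot> i1 (omap Cyl a) = \<one> (omap Cyl a)"
    "\<Gamma>lr a \<cdot> amap Cyl (i0 a) = i0 a \<cdot> p a" "\<Gamma>lr a \<cdot> amap Cyl (i1 a) = \<one> (omap Cyl a)"
    "p a \<cdot> \<Gamma>lr a = p a \<cdot> p (omap Cyl a)"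
  using assms lr lr_compatible unfolding lower_right_connection_def lower_right_compatible_def by auto

text \<open>Naturality, oriented so that \<open>i0\<close>, \<open>i1\<close>, \<open>c\<close> move to the left of a composite and
  \<open>p\<close>, \<open>e0\<close>, \<open>e1\<close> to the right.\<close>

lemma natural [simp]:
  assumes "f \<in> Arr A"
  shows "Dom A f = a \<Longrightarrow> amap Cyl f \<cdot> i0 a = i0 (Cod A f) \<cdot> f"
    "Dom A f = a \<Longrightarrow> amap Cyl f \<cdot> i1 a = i1 (Cod A f) \<cdot> f"
    "Cod A f = b \<Longrightarrow> p b \<cdot> amap Cyl f = f \<cdot> p (Dom A f)"
    "Dom A f = a \<Longrightarrow> amap P f \<cdot> c a = c (Cod A f) \<cdot> f"
    "Dom A f = a \<Longrightarrow> amap P f \<cdot> v' a = v' (Cod A f) \<cdot> amap P f"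
    "Cod A f = b \<Longrightarrow> e0 b \<cdot> amap P f = f \<cdot> e0 (Dom A f)"
    "Cod A f = b \<Longrightarrow> e1 b \<cdot> amap P f = f \<cdot> e1 (Dom A f)"
  using assms cyl.nat_natural(1)[OF cyl.nat_cyl(1) assms] cyl.nat_natural(1)[OF cyl.nat_cyl(2) assms]
    cyl.nat_natural(1)[OF cyl.nat_cyl(3) assms] cyl.nat_natural(1)[OF nat_cocyl(1) assms]
    cyl.nat_natural(1)[OF nat_cocyl(2) assms] cyl.nat_natural(1)[OF nat_cocyl(3) assms]
    cyl.nat_natural(1)[OF nat_cocyl(4) assms]
  by auto

lemma natural_comp [simp]:
  assumes "f \<in> Arr A" "z \<in> Arr A"
  shows "Dom A f = a \<Longrightarrow> Cod A z = a \<Longrightarrow> amap Cyl f \<cdot> (i0 a \<cdot> z) = i0 (Cod A f) \<cdot> (f \<cdot> z)"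
    "Dom A f = a \<Longrightarrow> Cod A z = a \<Longrightarrow> amap Cyl f \<cdot> (i1 a \<cdot> z) = i1 (Cod A f) \<cdot> (f \<cdot> z)"
    "Cod A f = b \<Longrightarrow> Cod A z = omap Cyl (Dom A f) \<Longrightarrow> p b \<cdot> (amap Cyl f \<cdot> z) = f \<cdot> (p (Dom A f) \<cdot> z)"
    "Dom A f = a \<Longrightarrow> Cod A z = a \<Longrightarrow> amap P f \<cdot> (c a \<cdot> z) = c (Cod A f) \<cdot> (f \<cdot> z)"
    "Dom A f = a \<Longrightarrow> Cod A z = omap P a \<Longrightarrow> amap P f \<cdot> (v' a \<cdot> z) = v' (Cod A f) \<cdot> (amap P f \<cdot> z)"
    "Cod A f = b \<Longrightarrow> Cod A z = omap P (Dom A f) \<Longrightarrow> e0 b \<cdot> (amap P f \<cdot> z) = f \<cdot> (e0 (Dom A f) \<cdot> z)"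
    "Cod A f = b \<Longrightarrow> Cod A z = omap P (Dom A f) \<Longrightarrow> e1 b \<cdot> (amap P f \<cdot> z) = f \<cdot> (e1 (Dom A f) \<cdot> z)"
  subgoal using cyl.reassoc[OF natural(1)[OF assms(1)], of a z] assms by auto
  subgoal using cyl.reassoc[OF natural(2)[OF assms(1)], of a z] assms by auto
  subgoal using cyl.reassoc[OF natural(3)[OF assms(1)], of b z] assms by auto
  subgoal using cyl.reassoc[OF natural(4)[OF assms(1)], of a z] assms by auto
  subgoal using cyl.nat_natural(2)[OF nat_cocyl(4) assms(1)] assms(2) by blast
  subgoal using cyl.reassoc[OF natural(6)[OF assms(1)], of b z] assms by auto
  subgoal using cyl.reassoc[OF natural(7)[OF assms(1)], of b z] assms by auto
  done

lemma adj_arr [simp]: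
  assumes "h \<in> Arr A" "Dom A h = omap Cyl a" "Cod A h = b" "a \<in> Obj A"
  shows "adj a b h \<in> Arr A" "Dom A (adj a b h) = a" "Cod A (adj a b h) = omap P b"
proof -
  have "h \<in> hom A (omap Cyl a) b" "b \<in> Obj A" using assms by (auto simp: in_hom)
  then have "adj a b h \<in> hom A a (omap P b)"
    using adjoint assms(4) unfolding cylinder_left_adjoint_def adjunction_def
    by (meson bij_betw_apply)
  then show "adj a b h \<in> Arr A" "Dom A (adj a b h) = a" "Cod A (adj a b h) = omap P b"
    by (auto simp: in_hom)
qed

lemma adj_surj:
  assumes "h \<in> hom A a (omap P b)" "b \<in> Obj A"
  obtains k where "k \<in> hom A (omap Cyl a) b" "adj a b k = h"
proof -
  have "bij_betw (adj a b) (hom A (omap Cyl a) b) (hom A a (omap P b))"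
    using adjoint assms cyl.Obj_hom[OF assms(1)]
    unfolding cylinder_left_adjoint_def adjunction_def by blast
  then have "h \<in> adj a b ` hom A (omap Cyl a) b"
    using assms(1) by (simp add: bij_betw_def)
  then show thesis using that by auto
qed

lemma adj_inj:
  assumes "adj a b h = adj a b k" "h \<in> hom A (omap Cyl a) b" "k \<in> hom A (omap Cyl a) b" "a \<in> Obj A"
  shows "h = k"
proof -
  have "bij_betw (adj a b) (hom A (omap Cyl a) b) (hom A a (omap P b))"
    using adjoint assms cyl.Obj_hom[OF assms(2)]
    unfolding cylinder_left_adjoint_def adjunction_def by blast
  then show ?thesis
    using assms by (auto simp: bij_betw_def inj_on_def)
qed

lemma e_adj [simp]:
  assumes "h \<in> Arr A" "Dom A h = omap Cyl a" "Cod A h = b" "a \<in> Obj A"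
  shows "e0 b \<cdot> adj a b h = h \<cdot> i0 a" "e1 b \<cdot> adj a b h = h \<cdot> i1 a"
    "z \<in> Arr A \<Longrightarrow> Cod A z = a \<Longrightarrow> e0 b \<cdot> (adj a b h \<cdot> z) = h \<cdot> (i0 a \<cdot> z)"
    "z \<in> Arr A \<Longrightarrow> Cod A z = a \<Longrightarrow> e1 b \<cdot> (adj a b h \<cdot> z) = h \<cdot> (i1 a \<cdot> z)"
proof -
  have *: "h \<in> hom A (omap Cyl a) b" and [simp]: "b \<in> Obj A" using assms by (auto simp: in_hom)
  show eq: "e0 b \<cdot> adj a b h = h \<cdot> i0 a" "e1 b \<cdot> adj a b h = h \<cdot> i1 a"
    using adjoint assms * unfolding cylinder_left_adjoint_def by auto
  show "z \<in> Arr A \<Longrightarrow> Cod A z = a \<Longrightarrow> e0 b \<cdot> (adj a b h \<cdot> z) = h \<cdot> (i0 a \<cdot> z)"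
    "z \<in> Arr A \<Longrightarrow> Cod A z = a \<Longrightarrow> e1 b \<cdot> (adj a b h \<cdot> z) = h \<cdot> (i1 a \<cdot> z)"
    using cyl.reassoc[OF eq(1), of z] cyl.reassoc[OF eq(2), of z] assms by auto
qed

lemma adj_natural:
  assumes "u \<in> hom A a' a" "w \<in> hom A b b'" "h \<in> hom A (omap Cyl a) b"
  shows "adj a' b' (w \<cdot> h \<cdot> amap Cyl u) = amap P w \<cdot> adj a b h \<cdot> u"
  using adjoint assms unfolding cylinder_left_adjoint_def adjunction_def by blast

lemma P_adj [simp]:
  assumes [simp]: "h \<in> Arr A" "Dom A h = omap Cyl a" "Cod A h = b" "a \<in> Obj A" "w \<in> Arr A" "Dom A w = b"
  shows "amap P w \<cdot> adj a b h = adj a (Cod A w) (w \<cdot> h)"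
    "z \<in> Arr A \<Longrightarrow> Cod A z = a \<Longrightarrow> amap P w \<cdot> (adj a b h \<cdot> z) = adj a (Cod A w) (w \<cdot> h) \<cdot> z"
proof -
  have [simp]: "b \<in> Obj A" using assms cyl.arr_Obj by metis
  show eq: "amap P w \<cdot> adj a b h = adj a (Cod A w) (w \<cdot> h)"
    using adj_natural[of "\<one> a" a a w b "Cod A w" h] by (simp add: in_hom)
  show "z \<in> Arr A \<Longrightarrow> Cod A z = a \<Longrightarrow> amap P w \<cdot> (adj a b h \<cdot> z) = adj a (Cod A w) (w \<cdot> h) \<cdot> z"
    using cyl.reassoc[OF eq, of z] by simp
qed

lemma adj_comp:
  assumes [simp]: "h \<in> Arr A" "Dom A h = omap Cyl a" "Cod A h = b" "a \<in> Obj A" "u \<in> Arr A" "Cod A u = a"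
  shows "adj a b h \<cdot> u = adj (Dom A u) b (h \<cdot> amap Cyl u)"
proof -
  have [simp]: "b \<in> Obj A" using assms cyl.arr_Obj by metis
  show ?thesis
    using adj_natural[of u "Dom A u" a "\<one> b" b b h] by (simp add: in_hom)
qed

lemma adj_p:
  assumes "f \<in> Arr A" "Dom A f = a" "Cod A f = b"
  shows "adj a b (f \<cdot> p a) = c b \<cdot> f"
  using adj_compatible assms unfolding adjunction_compatible_def by (simp add: in_hom)

text \<open>An arrow into \<open>P b\<close> is a path in \<open>b\<close>; it is a homotopy of the cylinder \<open>P\<close> in the
  opposite category, so paths are concatenated there.\<close>

definition pcat :: "'o \<Rightarrow> 'a \<Rightarrow> 'a \<Rightarrow> 'a" where
  "pcat = cocyl.concat"

lemma pcat_arr [simp]: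
  assumes "b \<in> Obj A" "h \<in> Arr A" "k \<in> Arr A" "Cod A h = omap P b" "Cod A k = omap P b"
    "Dom A k = Dom A h" "e1 b \<cdot> h = e0 b \<cdot> k"
  shows "pcat b h k \<in> Arr A" "Dom A (pcat b h k) = Dom A h" "Cod A (pcat b h k) = omap P b"
    "e0 b \<cdot> pcat b h k = e0 b \<cdot> h" "e1 b \<cdot> pcat b h k = e1 b \<cdot> k"
  using cocyl.concat_hom[of b h "Dom A h" k] assms by (auto simp: in_hom pcat_def)

lemma pcat_comp [simp]:
  assumes "b \<in> Obj A" "h \<in> Arr A" "k \<in> Arr A" "Cod A h = omap P b" "Cod A k = omap P b"
    "Dom A k = Dom A h" "e1 b \<cdot> h = e0 b \<cdot> k" "u \<in> Arr A" "Cod A u = Dom A h"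
  shows "pcat b h k \<cdot> u = pcat b (h \<cdot> u) (k \<cdot> u)"
  using cocyl.comp_concat[of b h "Dom A h" k u "Dom A u"] assms by (auto simp: in_hom pcat_def)

lemma P_pcat [simp]:
  assumes "b \<in> Obj A" "h \<in> Arr A" "k \<in> Arr A" "Cod A h = omap P b" "Cod A k = omap P b"
    "Dom A k = Dom A h" "e1 b \<cdot> h = e0 b \<cdot> k" "w \<in> Arr A" "Dom A w = b"
  shows "amap P w \<cdot> pcat b h k = pcat (Cod A w) (amap P w \<cdot> h) (amap P w \<cdot> k)"
  using cocyl.concat_comp[of b h "Dom A h" k w "Cod A w"] assms by (auto simp: in_hom pcat_def)

lemma pcat_const:
  assumes "b \<in> Obj A" "h \<in> Arr A" "Cod A h = omap P b"
  shows "g = e0 b \<cdot> h \<Longrightarrow> pcat b (c b \<cdot> g) h = h"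
    and "g = e1 b \<cdot> h \<Longrightarrow> pcat b h (c b \<cdot> g) = h"
    and "g = e1 b \<cdot> h \<Longrightarrow> pcat b (v' b \<cdot> h) h = c b \<cdot> g"
  using cocyl.concat_id[of h b "Dom A h"] assms
    cocyl.concat_inverse[OF lr' ur' connections', of h b "Dom A h"]
  by (auto simp: in_hom pcat_def)

end

section \<open>Homotopies, fibrations and cofibrations by means of paths\<close>

context cylinder_adjunction
begin

abbreviation "Fib \<equiv> cocyl_fibrations A P e0"
abbreviation "Cof \<equiv> normally_cloven_cofibrations A Cyl i0 p"
abbreviation "W \<equiv> cyl_homotopy_equivalences A Cyl i0 i1"

definition homotopic :: "'o \<Rightarrow> 'o \<Rightarrow> 'a \<Rightarrow> 'a \<Rightarrow> bool" where
  "homotopic a b f g \<longleftrightarrow> (\<exists>h. cocyl_homotopy A P e0 e1 a b f g h)"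

lemma homotopicI:
  assumes "h \<in> hom A a (omap P b)" "b \<in> Obj A" "e0 b \<cdot> h = f" "e1 b \<cdot> h = g"
  shows "homotopic a b f g"
  using assms unfolding homotopic_def cocyl_homotopy_def by (auto simp: in_hom)

lemma homotopicE:
  assumes "homotopic a b f g"
  obtains h where "h \<in> hom A a (omap P b)" "e0 b \<cdot> h = f" "e1 b \<cdot> h = g" "f \<in> hom A a b" "g \<in> hom A a b"
  using assms unfolding homotopic_def cocyl_homotopy_def by auto

lemma homotopic_refl:
  assumes "f \<in> hom A a b"
  shows "homotopic a b f f"
proof -
  note [simp] = homD[OF assms] cyl.Obj_hom[OF assms]
  show ?thesis by (rule homotopicI[of "c b \<cdot> f"]) (auto simp: in_hom)
qed

lemma homotopic_sym:
  assumes "homotopic a b f g"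
  shows "homotopic a b g f"
proof -
  obtain h where h: "h \<in> hom A a (omap P b)" "e0 b \<cdot> h = f" "e1 b \<cdot> h = g" and f: "f \<in> hom A a b"
    using assms by (rule homotopicE)
  note [simp] = homD[OF h(1)] cyl.Obj_hom[OF f]
  show ?thesis by (rule homotopicI[of "v' b \<cdot> h"]) (auto simp: in_hom h(2,3))
qed

lemma homotopic_trans [trans]:
  assumes "homotopic a b f g" "homotopic a b g l"
  shows "homotopic a b f l"
proof -
  obtain h where h: "h \<in> hom A a (omap P b)" "e0 b \<cdot> h = f" "e1 b \<cdot> h = g" and f: "f \<in> hom A a b"
    using assms(1) by (rule homotopicE)
  obtain k where k: "k \<in> hom A a (omap P b)" "e0 b \<cdot> k = g" "e1 b \<cdot> k = l"
    using assms(2) by (rule homotopicE)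
  note [simp] = homD[OF h(1)] homD[OF k(1)] cyl.Obj_hom[OF f]
  show ?thesis by (rule homotopicI[of "pcat b h k"]) (auto simp: in_hom h(2,3) k(2,3))
qed

lemma homotopic_comp:
  assumes "homotopic a b f g"
  shows "u \<in> hom A a' a \<Longrightarrow> homotopic a' b (f \<cdot> u) (g \<cdot> u)"
    and "w \<in> hom A b b' \<Longrightarrow> homotopic a b' (w \<cdot> f) (w \<cdot> g)"
proof -
  obtain h where h: "h \<in> hom A a (omap P b)" "e0 b \<cdot> h = f" "e1 b \<cdot> h = g" and f: "f \<in> hom A a b"
    using assms(1) by (rule homotopicE)
  note [simp] = homD[OF h(1)] cyl.Obj_hom[OF f]
  show "homotopic a' b (f \<cdot> u) (g \<cdot> u)" if u: "u \<in> hom A a' a"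
    using homD[OF u] by (intro homotopicI[of "h \<cdot> u"]) (auto simp: in_hom simp flip: h(2,3))
  show "homotopic a b' (w \<cdot> f) (w \<cdot> g)" if w: "w \<in> hom A b b'"
    using homD[OF w] cyl.Obj_hom[OF w]
    by (intro homotopicI[of "amap P w \<cdot> h"]) (auto simp: in_hom h(2,3))
qed

lemma cyl_homotopic: "(\<exists>h. cyl_homotopy A Cyl i0 i1 a b f g h) \<longleftrightarrow> homotopic a b f g"
proof
  assume "\<exists>h. cyl_homotopy A Cyl i0 i1 a b f g h"
  then obtain h where h: "h \<in> hom A (omap Cyl a) b" "h \<cdot> i0 a = f" "h \<cdot> i1 a = g"
    and f: "f \<in> hom A a b"
    unfolding cyl_homotopy_def by blast
  note [simp] = homD[OF h(1)] cyl.Obj_hom[OF f]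
  show "homotopic a b f g" by (rule homotopicI[of "adj a b h"]) (auto simp: in_hom h(2,3))
next
  assume "homotopic a b f g"
  then obtain h where h: "h \<in> hom A a (omap P b)" "e0 b \<cdot> h = f" "e1 b \<cdot> h = g"
    and fg: "f \<in> hom A a b" "g \<in> hom A a b"
    by (rule homotopicE)
  note [simp] = cyl.Obj_hom[OF fg(1)]
  obtain k where k: "k \<in> hom A (omap Cyl a) b" "adj a b k = h"
    using adj_surj[OF h(1)] by auto
  note [simp] = homD[OF k(1)]
  have "cyl_homotopy A Cyl i0 i1 a b f g k"
    unfolding cyl_homotopy_def using fg k h(2,3) by (auto simp flip: k(2))
  then show "\<exists>h. cyl_homotopy A Cyl i0 i1 a b f g h" by blast
qed

lemma W_iff:
  "f \<in> W \<longleftrightarrow> (\<exists>a b. f \<in> hom A a b \<and> (\<exists>g\<in>hom A b a.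
     homotopic a a (g \<cdot> f) (\<one> a) \<and> homotopic b b (f \<cdot> g) (\<one> b)))"
  unfolding cyl_homotopy_equivalences_def cyl_homotopic by blast

lemma W_eq: "W = cocyl_homotopy_equivalences A P e0 e1"
  unfolding cyl_homotopy_equivalences_def cocyl_homotopy_equivalences_def cyl_homotopic homotopic_def ..

lemma WE:
  assumes "f \<in> W" "f \<in> hom A a b"
  obtains g where "g \<in> hom A b a" "homotopic a a (g \<cdot> f) (\<one> a)" "homotopic b b (f \<cdot> g) (\<one> b)"
  using assms unfolding W_iff by (auto simp: in_hom)

lemma WI:
  assumes "f \<in> hom A a b" "g \<in> hom A b a" "homotopic a a (g \<cdot> f) (\<one> a)" "homotopic b b (f \<cdot> g) (\<one> b)"
  shows "f \<in> W"
  using assms unfolding W_iff by blast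

lemma W_two_of_three:
  assumes f: "f \<in> hom A a b" and g: "g \<in> hom A b d"
  shows "f \<in> W \<Longrightarrow> g \<in> W \<Longrightarrow> g \<cdot> f \<in> W"
    and "f \<in> W \<Longrightarrow> g \<cdot> f \<in> W \<Longrightarrow> g \<in> W"
    and "g \<in> W \<Longrightarrow> g \<cdot> f \<in> W \<Longrightarrow> f \<in> W"
proof -
  note [simp] = homD[OF f] homD[OF g] cyl.Obj_hom[OF f] cyl.Obj_hom[OF g]
  have gf: "g \<cdot> f \<in> hom A a d" by (simp add: in_hom)
  {
    assume "f \<in> W" "g \<in> W"
    obtain f' where f': "f' \<in> hom A b a" and 1: "homotopic a a (f' \<cdot> f) (\<one> a)" "homotopic b b (f \<cdot> f') (\<one> b)"
      using WE[OF \<open>f \<in> W\<close> f] .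
    obtain g' where g': "g' \<in> hom A d b" and 2: "homotopic b b (g' \<cdot> g) (\<one> b)" "homotopic d d (g \<cdot> g') (\<one> d)"
      using WE[OF \<open>g \<in> W\<close> g] .
    note [simp] = homD[OF f'] homD[OF g']
    show "g \<cdot> f \<in> W"
    proof (rule WI[OF gf])
      show "f' \<cdot> g' \<in> hom A d a" by (simp add: in_hom)
      show "homotopic a a ((f' \<cdot> g') \<cdot> (g \<cdot> f)) (\<one> a)"
        using homotopic_comp(1)[OF homotopic_comp(2)[OF 2(1) f'] f] 1(1)
        by (auto intro: homotopic_trans)
      show "homotopic d d ((g \<cdot> f) \<cdot> (f' \<cdot> g')) (\<one> d)"
        using homotopic_comp(1)[OF homotopic_comp(2)[OF 1(2) g] g'] 2(2)
        by (auto intro: homotopic_trans)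
    qed
  next
    assume "f \<in> W" "g \<cdot> f \<in> W"
    obtain f' where f': "f' \<in> hom A b a" and 1: "homotopic a a (f' \<cdot> f) (\<one> a)" "homotopic b b (f \<cdot> f') (\<one> b)"
      using WE[OF \<open>f \<in> W\<close> f] .
    obtain l where l: "l \<in> hom A d a" and 2: "homotopic a a (l \<cdot> (g \<cdot> f)) (\<one> a)" "homotopic d d ((g \<cdot> f) \<cdot> l) (\<one> d)"
      using WE[OF \<open>g \<cdot> f \<in> W\<close> gf] .
    note [simp] = homD[OF f'] homD[OF l]
    have fl: "f \<cdot> l \<in> hom A d b" and lg: "l \<cdot> g \<in> hom A b a" by (simp_all add: in_hom)
    show "g \<in> W"
    proof (rule WI[OF g fl])
      \<comment> \<open>\<open>f l g \<simeq> f l g f f' \<simeq> f f' \<simeq> 1\<close>, where \<open>l\<close> inverts \<open>g f\<close>\<close>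
      have "homotopic b b (f \<cdot> (l \<cdot> g)) (f \<cdot> (l \<cdot> (g \<cdot> (f \<cdot> f'))))"
        using homotopic_sym[OF homotopic_comp(2)[OF homotopic_comp(2)[OF 1(2) lg] f]] by simp
      moreover have "homotopic b b (f \<cdot> (l \<cdot> (g \<cdot> (f \<cdot> f')))) (f \<cdot> f')"
        using homotopic_comp(1)[OF homotopic_comp(2)[OF 2(1) f] f'] by simp
      ultimately show "homotopic b b ((f \<cdot> l) \<cdot> g) (\<one> b)"
        using 1(2) by (auto intro: homotopic_trans)
      show "homotopic d d (g \<cdot> (f \<cdot> l)) (\<one> d)" using 2(2) by simp
    qed
  next
    assume "g \<in> W" "g \<cdot> f \<in> W"
    obtain g' where g': "g' \<in> hom A d b" and 1: "homotopic b b (g' \<cdot> g) (\<one> b)" "homotopic d d (g \<cdot> g') (\<one> d)"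
      using WE[OF \<open>g \<in> W\<close> g] .
    obtain l where l: "l \<in> hom A d a" and 2: "homotopic a a (l \<cdot> (g \<cdot> f)) (\<one> a)" "homotopic d d ((g \<cdot> f) \<cdot> l) (\<one> d)"
      using WE[OF \<open>g \<cdot> f \<in> W\<close> gf] .
    note [simp] = homD[OF g'] homD[OF l]
    have fl: "f \<cdot> (l \<cdot> g) \<in> hom A b b" and lg: "l \<cdot> g \<in> hom A b a" by (simp_all add: in_hom)
    show "f \<in> W"
    proof (rule WI[OF f lg])
      have "homotopic b b (f \<cdot> (l \<cdot> g)) (g' \<cdot> (g \<cdot> (f \<cdot> (l \<cdot> g))))"
        using homotopic_sym[OF homotopic_comp(1)[OF 1(1) fl]] by simp
      moreover have "homotopic b b (g' \<cdot> (g \<cdot> (f \<cdot> (l \<cdot> g)))) (g' \<cdot> g)"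
        using homotopic_comp(1)[OF homotopic_comp(2)[OF 2(2) g'] g] by simp
      ultimately show "homotopic b b (f \<cdot> (l \<cdot> g)) (\<one> b)"
        using 1(1) by (auto intro: homotopic_trans)
      show "homotopic a a ((l \<cdot> g) \<cdot> f) (\<one> a)" using 2(1) by simp
    qed
  }
qed

lemma Fib_paths:
  assumes "f \<in> hom A e b"
  shows "f \<in> Fib \<longleftrightarrow> (\<forall>a. \<forall>g\<in>hom A a e. \<forall>h\<in>hom A a (omap P b). e0 b \<cdot> h = f \<cdot> g \<longrightarrow>
     (\<exists>k\<in>hom A a (omap P e). amap P f \<cdot> k = h \<and> e0 e \<cdot> k = g))"
  using assms unfolding cocyl_fibrations_def by (auto simp: in_hom)

text \<open>The adjunction turns the lifting of paths into lifting against the arrows \<open>i0 a\<close>.\<close>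

lemma Fib_cylinders:
  assumes f: "f \<in> hom A e b"
  shows "f \<in> Fib \<longleftrightarrow> (\<forall>a. \<forall>g\<in>hom A a e. \<forall>h\<in>hom A (omap Cyl a) b. h \<cdot> i0 a = f \<cdot> g \<longrightarrow>
     (\<exists>k\<in>hom A (omap Cyl a) e. f \<cdot> k = h \<and> k \<cdot> i0 a = g))" (is "_ = ?R")
  unfolding Fib_paths[OF f]
proof (intro iffI allI ballI impI)
  note [simp] = homD[OF f] cyl.Obj_hom[OF f]
  fix a g h assume g: "g \<in> hom A a e"
  note [simp] = homD[OF g] cyl.Obj_hom[OF g]
  {
    assume *: "\<forall>a. \<forall>g\<in>hom A a e. \<forall>h\<in>hom A a (omap P b). e0 b \<cdot> h = f \<cdot> g \<longrightarrow>
       (\<exists>k\<in>hom A a (omap P e). amap P f \<cdot> k = h \<and> e0 e \<cdot> k = g)"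
      and h: "h \<in> hom A (omap Cyl a) b" and eq: "h \<cdot> i0 a = f \<cdot> g"
    note [simp] = homD[OF h]
    have "adj a b h \<in> hom A a (omap P b)" "e0 b \<cdot> adj a b h = f \<cdot> g" by (auto simp: in_hom eq)
    with * g obtain k' where k': "k' \<in> hom A a (omap P e)" "amap P f \<cdot> k' = adj a b h" "e0 e \<cdot> k' = g"
      by blast
    obtain k where k: "k \<in> hom A (omap Cyl a) e" "adj a e k = k'"
      using adj_surj[OF k'(1)] by auto
    note [simp] = homD[OF k(1)]
    have "adj a b (f \<cdot> k) = adj a b h" using k'(2) k(2) by auto
    then have "f \<cdot> k = h" by (rule adj_inj) (auto simp: in_hom)
    moreover have "k \<cdot> i0 a = g" using k'(3) k(2) by auto
    ultimately show "\<exists>k\<in>hom A (omap Cyl a) e. f \<cdot> k = h \<and> k \<cdot> i0 a = g" using k(1) by blast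
  next
    assume *: "\<forall>a. \<forall>g\<in>hom A a e. \<forall>h\<in>hom A (omap Cyl a) b. h \<cdot> i0 a = f \<cdot> g \<longrightarrow>
       (\<exists>k\<in>hom A (omap Cyl a) e. f \<cdot> k = h \<and> k \<cdot> i0 a = g)"
      and h: "h \<in> hom A a (omap P b)" and eq: "e0 b \<cdot> h = f \<cdot> g"
    obtain h' where h': "h' \<in> hom A (omap Cyl a) b" "adj a b h' = h"
      using adj_surj[OF h] by auto
    note [simp] = homD[OF h'(1)]
    have "h' \<cdot> i0 a = f \<cdot> g" using eq h'(2) by auto
    with * g h'(1) obtain k where k: "k \<in> hom A (omap Cyl a) e" "f \<cdot> k = h'" "k \<cdot> i0 a = g"
      by blast
    note [simp] = homD[OF k(1)]
    show "\<exists>k\<in>hom A a (omap P e). amap P f \<cdot> k = h \<and> e0 e \<cdot> k = g"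
      using k(2,3) h'(2) by (intro bexI[of _ "adj a e k"]) (auto simp: in_hom)
  }
qed

definition normal_cleavage :: "'o \<Rightarrow> 'o \<Rightarrow> 'a \<Rightarrow> ('o \<Rightarrow> 'a \<Rightarrow> 'a \<Rightarrow> 'a) \<Rightarrow> bool" where
  "normal_cleavage a0 a1 j k \<longleftrightarrow>
     (\<forall>a2. \<forall>g\<in>hom A a1 a2. \<forall>h\<in>hom A (omap Cyl a0) a2. h \<cdot> i0 a0 = g \<cdot> j \<longrightarrow>
        k a2 g h \<in> hom A (omap Cyl a1) a2 \<and> k a2 g h \<cdot> amap Cyl j = h \<and> k a2 g h \<cdot> i0 a1 = g) \<and>
     (\<forall>a2. \<forall>g\<in>hom A a1 a2. k a2 g (g \<cdot> j \<cdot> p a0) = g \<cdot> p a1) \<and>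
     (\<forall>a2 a3. \<forall>g\<in>hom A a1 a2. \<forall>h\<in>hom A (omap Cyl a0) a2. \<forall>g'\<in>hom A a2 a3.
        h \<cdot> i0 a0 = g \<cdot> j \<longrightarrow> g' \<cdot> k a2 g h = k a3 (g' \<cdot> g) (g' \<cdot> h))"

lemma Cof_cleavage:
  assumes "j \<in> hom A a0 a1"
  shows "j \<in> Cof \<longleftrightarrow> (\<exists>k. normal_cleavage a0 a1 j k)"
proof -
  have "j \<in> Cof \<longleftrightarrow> (\<exists>a0 a1. j \<in> hom A a0 a1 \<and> (\<exists>k. normal_cleavage a0 a1 j k))"
    unfolding normally_cloven_cofibrations_def normal_cleavage_def by (rule mem_Collect_eq)
  then show ?thesis using assms by (auto simp: in_hom)
qed

definition mapping_cylinder :: "'o \<Rightarrow> 'o \<Rightarrow> 'a \<Rightarrow> 'o \<Rightarrow> 'a \<Rightarrow> 'a \<Rightarrow> bool" where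
  "mapping_cylinder x y f m d0 d1 \<longleftrightarrow>
     f \<in> hom A x y \<and> d0 \<in> hom A (omap Cyl x) m \<and> d1 \<in> hom A y m \<and> is_pushout A (i0 x) f d0 d1"

lemma mapping_cylinder_exists:
  assumes f: "f \<in> hom A x y"
  obtains m d0 d1 where "mapping_cylinder x y f m d0 d1"
proof -
  note [simp] = homD[OF f] cyl.Obj_hom[OF f]
  have "i0 x \<in> hom A x (omap Cyl x)" by (simp add: in_hom)
  then obtain d0 d1 where po: "is_pushout A (i0 x) f d0 d1"
    using cyl.pushouts f unfolding has_pushouts_def by blast
  then have "mapping_cylinder x y f (Cod A d0) d0 d1"
    using pushout_arr[OF po] f by (auto simp: mapping_cylinder_def in_hom)
  then show thesis using that by blast
qed

lemma mapping_cylinder_arr: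
  assumes "mapping_cylinder x y f m d0 d1"
  shows "f \<in> hom A x y" "d0 \<in> hom A (omap Cyl x) m" "d1 \<in> hom A y m" "d0 \<cdot> i0 x = d1 \<cdot> f"
  using assms pushout_arr(9) by (auto simp: mapping_cylinder_def)

lemma mapping_cylinder_factor:
  assumes mc: "mapping_cylinder x y f m d0 d1"
    and hg: "h \<in> hom A (omap Cyl x) t" "g \<in> hom A y t" "h \<cdot> i0 x = g \<cdot> f"
  obtains k where "k \<in> hom A m t" "k \<cdot> d0 = h" "k \<cdot> d1 = g"
proof -
  note [simp] = homD[OF mapping_cylinder_arr(1)[OF mc]] cyl.Obj_hom[OF mapping_cylinder_arr(1)[OF mc]]
    homD[OF mapping_cylinder_arr(2)[OF mc]]
  have "is_pushout A (i0 x) f d0 d1" using mc by (simp add: mapping_cylinder_def)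
  from pushout_factor[OF this, of h t g] show thesis using hg that by auto
qed

lemma mapping_cylinder_unique:
  assumes mc: "mapping_cylinder x y f m d0 d1"
    and k: "k \<in> hom A m t" "k' \<in> hom A m t" "k \<cdot> d0 = k' \<cdot> d0" "k \<cdot> d1 = k' \<cdot> d1"
  shows "k = k'"
proof -
  note [simp] = homD[OF mapping_cylinder_arr(2)[OF mc]]
  have "is_pushout A (i0 x) f d0 d1" using mc by (simp add: mapping_cylinder_def)
  from cyl.pushout_eq[OF this, of k t k'] show ?thesis using k by simp
qed

text \<open>A natural cleavage is determined by its value \<open>r\<close> on the mapping cylinder \<open>m\<close> of \<open>j\<close>,
  and it is normal if and only if \<open>r\<close> lies over \<open>p a1\<close> when \<open>m\<close> is collapsed to \<open>a1\<close>. Therefore a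
  normal cleavage amounts to an extension property for homotopies \<open>h\<close> which stay in the fibres
  of some arrow \<open>f\<close>, the case of that collapse being universal. In this form neither a choice nor
  its naturality needs to be carried along.\<close>

lemma Cof_iff:
  assumes j: "j \<in> hom A a0 a1"
  shows "j \<in> Cof \<longleftrightarrow> (\<forall>e b f g h. f \<in> hom A e b \<and> g \<in> hom A a1 e \<and> h \<in> hom A a0 (omap P e) \<and>
      e0 e \<cdot> h = g \<cdot> j \<and> amap P f \<cdot> h = c b \<cdot> (f \<cdot> (g \<cdot> j)) \<longrightarrow>
      (\<exists>k\<in>hom A a1 (omap P e). e0 e \<cdot> k = g \<and> k \<cdot> j = h \<and> amap P f \<cdot> k = c b \<cdot> (f \<cdot> g)))"
proof
  note [simp] = homD[OF j] cyl.Obj_hom[OF j]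
  assume "j \<in> Cof"
  then obtain \<kappa> where cleavage: "normal_cleavage a0 a1 j \<kappa>"
    using Cof_cleavage[OF j] by blast
  have \<kappa>: "\<kappa> a2 g h \<in> hom A (omap Cyl a1) a2" "\<kappa> a2 g h \<cdot> amap Cyl j = h" "\<kappa> a2 g h \<cdot> i0 a1 = g"
    if "g \<in> hom A a1 a2" "h \<in> hom A (omap Cyl a0) a2" "h \<cdot> i0 a0 = g \<cdot> j" for a2 g h
    using cleavage that unfolding normal_cleavage_def by blast+
  have \<kappa>_const: "\<kappa> a2 g (g \<cdot> j \<cdot> p a0) = g \<cdot> p a1" if "g \<in> hom A a1 a2" for a2 g
    using cleavage that unfolding normal_cleavage_def by blast
  have \<kappa>_nat: "g' \<cdot> \<kappa> a2 g h = \<kappa> a3 (g' \<cdot> g) (g' \<cdot> h)"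
    if "g \<in> hom A a1 a2" "h \<in> hom A (omap Cyl a0) a2" "g' \<in> hom A a2 a3" "h \<cdot> i0 a0 = g \<cdot> j"
    for a2 a3 g h g'
    using cleavage that unfolding normal_cleavage_def by blast
  show "\<forall>e b f g h. f \<in> hom A e b \<and> g \<in> hom A a1 e \<and> h \<in> hom A a0 (omap P e) \<and>
      e0 e \<cdot> h = g \<cdot> j \<and> amap P f \<cdot> h = c b \<cdot> (f \<cdot> (g \<cdot> j)) \<longrightarrow>
      (\<exists>k\<in>hom A a1 (omap P e). e0 e \<cdot> k = g \<and> k \<cdot> j = h \<and> amap P f \<cdot> k = c b \<cdot> (f \<cdot> g))"
  proof (intro allI impI, elim conjE)
    fix e b f g h assume f: "f \<in> hom A e b" and g: "g \<in> hom A a1 e" and h: "h \<in> hom A a0 (omap P e)"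
      and eq: "e0 e \<cdot> h = g \<cdot> j" "amap P f \<cdot> h = c b \<cdot> (f \<cdot> (g \<cdot> j))"
    note [simp] = homD[OF f] cyl.Obj_hom[OF f] homD[OF g]
    obtain h1 where h1: "h1 \<in> hom A (omap Cyl a0) e" "adj a0 e h1 = h"
      using adj_surj[OF h] by auto
    note [simp] = homD[OF h1(1)]
    have "adj a0 b (f \<cdot> h1) = adj a0 b ((f \<cdot> (g \<cdot> j)) \<cdot> p a0)"
      using eq(2) by (subst adj_p) (auto simp flip: h1(2))
    then have fh: "f \<cdot> h1 = (f \<cdot> g) \<cdot> j \<cdot> p a0"
      by (subst adj_inj[of a0 b "f \<cdot> h1"]) (auto simp: in_hom)
    have start: "h1 \<cdot> i0 a0 = g \<cdot> j" using eq(1) by (auto simp flip: h1(2))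
    define k where "k = \<kappa> e g h1"
    have k: "k \<in> hom A (omap Cyl a1) e" "k \<cdot> amap Cyl j = h1" "k \<cdot> i0 a1 = g"
      using \<kappa>[OF g h1(1) start] by (auto simp: k_def)
    have fg: "f \<cdot> g \<in> hom A a1 b" by (simp add: in_hom)
    have fk: "f \<cdot> k = (f \<cdot> g) \<cdot> p a1"
      using \<kappa>_nat[OF g h1(1) f start] \<kappa>_const[OF fg] unfolding k_def fh by metis
    note [simp] = homD[OF k(1)]
    show "\<exists>k\<in>hom A a1 (omap P e). e0 e \<cdot> k = g \<and> k \<cdot> j = h \<and> amap P f \<cdot> k = c b \<cdot> (f \<cdot> g)"
    proof (intro bexI[of _ "adj a1 e k"] conjI)
      show "adj a1 e k \<cdot> j = h" using adj_comp[of k a1 e j] k(2) h1(2) by simp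
      show "amap P f \<cdot> adj a1 e k = c b \<cdot> (f \<cdot> g)"
        using adj_p[of "f \<cdot> g" a1 b] fk by simp
    qed (auto simp: in_hom k(3))
  qed
next
  note [simp] = homD[OF j] cyl.Obj_hom[OF j]
  assume *: "\<forall>e b f g h. f \<in> hom A e b \<and> g \<in> hom A a1 e \<and> h \<in> hom A a0 (omap P e) \<and>
      e0 e \<cdot> h = g \<cdot> j \<and> amap P f \<cdot> h = c b \<cdot> (f \<cdot> (g \<cdot> j)) \<longrightarrow>
      (\<exists>k\<in>hom A a1 (omap P e). e0 e \<cdot> k = g \<and> k \<cdot> j = h \<and> amap P f \<cdot> k = c b \<cdot> (f \<cdot> g))"
  obtain m d0 d1 where mc: "mapping_cylinder a0 a1 j m d0 d1"
    using mapping_cylinder_exists[OF j] .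
  note d = mapping_cylinder_arr(2,3)[OF mc] and comm = mapping_cylinder_arr(4)[OF mc]
  note [simp] = homD[OF d(1)] homD[OF d(2)] cyl.Obj_hom[OF d(1)]
  obtain q where q: "q \<in> hom A m a1" "q \<cdot> d0 = j \<cdot> p a0" "q \<cdot> d1 = \<one> a1"
    using mapping_cylinder_factor[OF mc, of "j \<cdot> p a0" a1 "\<one> a1"] by (auto simp: in_hom)
  note [simp] = homD[OF q(1)]
  have "adj a0 m d0 \<in> hom A a0 (omap P m)" "e0 m \<cdot> adj a0 m d0 = d1 \<cdot> j"
    "amap P q \<cdot> adj a0 m d0 = c a1 \<cdot> (q \<cdot> (d1 \<cdot> j))"
    using comm q(2) adj_p[of j a0 a1] cyl.reassoc[OF q(3), of j] by (auto simp: in_hom)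
  then obtain k where k: "k \<in> hom A a1 (omap P m)" "e0 m \<cdot> k = d1" "k \<cdot> j = adj a0 m d0"
    "amap P q \<cdot> k = c a1 \<cdot> (q \<cdot> d1)"
    using * q(1) d(2) by blast
  obtain r where r: "r \<in> hom A (omap Cyl a1) m" "adj a1 m r = k"
    using adj_surj[OF k(1)] by auto
  note [simp] = homD[OF r(1)]
  have r0: "r \<cdot> i0 a1 = d1" using k(2) by (auto simp flip: r(2))
  have "adj a0 m (r \<cdot> amap Cyl j) = adj a0 m d0"
    using adj_comp[of r a1 m j] by (simp add: k(3) r(2))
  then have rj: "r \<cdot> amap Cyl j = d0"
    by (rule adj_inj) (auto simp: in_hom)
  have "amap P q \<cdot> adj a1 m r = adj a1 a1 (\<one> a1 \<cdot> p a1)"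
    unfolding r(2) k(4) by (subst adj_p) (simp_all add: q(3))
  then have "adj a1 a1 (q \<cdot> r) = adj a1 a1 (p a1)"
    by simp
  then have qr: "q \<cdot> r = p a1"
    by (rule adj_inj) (auto simp: in_hom)
  define \<delta> where "\<delta> t g h = (THE k. k \<in> hom A m t \<and> k \<cdot> d0 = h \<and> k \<cdot> d1 = g)" for t g h
  have \<delta>: "\<delta> t g h = k" if "k \<in> hom A m t" "k \<cdot> d0 = h" "k \<cdot> d1 = g" for t g h k
    unfolding \<delta>_def
  proof (rule the_equality)
    show "k \<in> hom A m t \<and> k \<cdot> d0 = h \<and> k \<cdot> d1 = g" using that by blast
    show "l = k" if "l \<in> hom A m t \<and> l \<cdot> d0 = h \<and> l \<cdot> d1 = g" for l
      using that \<open>k \<in> hom A m t\<close>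
        by (intro mapping_cylinder_unique[OF mc, of l t k]) (simp_all add: \<open>k \<cdot> d0 = h\<close> \<open>k \<cdot> d1 = g\<close>)
  qed
  show "j \<in> Cof"
    unfolding Cof_cleavage[OF j] normal_cleavage_def
  proof (intro exI[of _ "\<lambda>t g h. \<delta> t g h \<cdot> r"] conjI allI ballI impI)
    fix t g h assume g: "g \<in> hom A a1 t" and h: "h \<in> hom A (omap Cyl a0) t" and eq: "h \<cdot> i0 a0 = g \<cdot> j"
    obtain k where k: "k \<in> hom A m t" "k \<cdot> d0 = h" "k \<cdot> d1 = g"
      using mapping_cylinder_factor[OF mc h g eq] .
    note [simp] = \<delta>[OF k] homD[OF k(1)]
    show "\<delta> t g h \<cdot> r \<in> hom A (omap Cyl a1) t" by (simp add: in_hom)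
    show "\<delta> t g h \<cdot> r \<cdot> amap Cyl j = h" "\<delta> t g h \<cdot> r \<cdot> i0 a1 = g"
      by (simp_all add: rj r0 k(2,3))
  next
    fix t g assume g: "g \<in> hom A a1 t"
    note [simp] = homD[OF g]
    have "\<delta> t g (g \<cdot> j \<cdot> p a0) = g \<cdot> q" by (rule \<delta>) (simp_all add: in_hom q(2,3))
    then show "\<delta> t g (g \<cdot> j \<cdot> p a0) \<cdot> r = g \<cdot> p a1" by (simp add: qr)
  next
    fix t t' g h g' assume g: "g \<in> hom A a1 t" and h: "h \<in> hom A (omap Cyl a0) t"
      and g': "g' \<in> hom A t t'" and eq: "h \<cdot> i0 a0 = g \<cdot> j"
    obtain k where k: "k \<in> hom A m t" "k \<cdot> d0 = h" "k \<cdot> d1 = g"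
      using mapping_cylinder_factor[OF mc h g eq] .
    note [simp] = homD[OF k(1)] homD[OF g']
    have "\<delta> t' (g' \<cdot> g) (g' \<cdot> h) = g' \<cdot> k"
      by (rule \<delta>) (auto simp: in_hom k(2,3))
    then show "g' \<cdot> (\<delta> t g h \<cdot> r) = \<delta> t' (g' \<cdot> g) (g' \<cdot> h) \<cdot> r"
      by (simp add: \<delta>[OF k])
  qed
qed

end

section \<open>Shrinkable arrows\<close>

context cylinder_adjunction
begin

text \<open>These are the maps that Dold calls shrinkable: \<open>K\<close> deforms \<open>e\<close> inside the fibres of
  \<open>f\<close> onto the image of the section \<open>t\<close>.\<close>

definition shrinking :: "'o \<Rightarrow> 'o \<Rightarrow> 'a \<Rightarrow> 'a \<Rightarrow> 'a \<Rightarrow> bool" where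
  "shrinking e b f t K \<longleftrightarrow> f \<in> hom A e b \<and> t \<in> hom A b e \<and> K \<in> hom A e (omap P e) \<and>
     f \<cdot> t = \<one> b \<and> e0 e \<cdot> K = t \<cdot> f \<and> e1 e \<cdot> K = \<one> e \<and> amap P f \<cdot> K = c b \<cdot> f"

lemma shrinking_simps:
  assumes "shrinking e b f t K"
  shows "f \<in> Arr A" "Dom A f = e" "Cod A f = b" "t \<in> Arr A" "Dom A t = b" "Cod A t = e"
    "K \<in> Arr A" "Dom A K = e" "Cod A K = omap P e" "e \<in> Obj A" "b \<in> Obj A"
    "f \<cdot> t = \<one> b" "e0 e \<cdot> K = t \<cdot> f" "e1 e \<cdot> K = \<one> e" "amap P f \<cdot> K = c b \<cdot> f"
    "z \<in> Arr A \<Longrightarrow> Cod A z = b \<Longrightarrow> f \<cdot> (t \<cdot> z) = z"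
    "z \<in> Arr A \<Longrightarrow> Cod A z = e \<Longrightarrow> e0 e \<cdot> (K \<cdot> z) = t \<cdot> (f \<cdot> z)"
    "z \<in> Arr A \<Longrightarrow> Cod A z = e \<Longrightarrow> e1 e \<cdot> (K \<cdot> z) = z"
    "z \<in> Arr A \<Longrightarrow> Cod A z = e \<Longrightarrow> amap P f \<cdot> (K \<cdot> z) = c b \<cdot> (f \<cdot> z)"
    "z \<in> Arr A \<Longrightarrow> Cod A z = omap P b \<Longrightarrow> amap P f \<cdot> (amap P t \<cdot> z) = z"
proof -
  have sh: "f \<in> hom A e b" "t \<in> hom A b e" "K \<in> hom A e (omap P e)"
     and eq: "f \<cdot> t = \<one> b" "e0 e \<cdot> K = t \<cdot> f" "e1 e \<cdot> K = \<one> e" "amap P f \<cdot> K = c b \<cdot> f"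
    using assms unfolding shrinking_def by blast+
  note [simp] = homD[OF sh(1)] homD[OF sh(2)] homD[OF sh(3)] cyl.Obj_hom[OF sh(1)]
  show "f \<in> Arr A" "Dom A f = e" "Cod A f = b" "t \<in> Arr A" "Dom A t = b" "Cod A t = e"
    "K \<in> Arr A" "Dom A K = e" "Cod A K = omap P e" "e \<in> Obj A" "b \<in> Obj A"
    by simp_all
  show "f \<cdot> t = \<one> b" "e0 e \<cdot> K = t \<cdot> f" "e1 e \<cdot> K = \<one> e" "amap P f \<cdot> K = c b \<cdot> f"
    by (fact eq)+
  show "z \<in> Arr A \<Longrightarrow> Cod A z = b \<Longrightarrow> f \<cdot> (t \<cdot> z) = z"
    using cyl.reassoc[OF eq(1), of z] by simp
  show "z \<in> Arr A \<Longrightarrow> Cod A z = e \<Longrightarrow> e0 e \<cdot> (K \<cdot> z) = t \<cdot> (f \<cdot> z)"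
    using cyl.reassoc[OF eq(2), of z] by simp
  show "z \<in> Arr A \<Longrightarrow> Cod A z = e \<Longrightarrow> e1 e \<cdot> (K \<cdot> z) = z"
    using cyl.reassoc[OF eq(3), of z] by simp
  show "z \<in> Arr A \<Longrightarrow> Cod A z = e \<Longrightarrow> amap P f \<cdot> (K \<cdot> z) = c b \<cdot> (f \<cdot> z)"
    using cyl.reassoc[OF eq(4), of z] by simp
  have "amap P f \<cdot> amap P t = \<one> (omap P b)"
    using arg_cong[OF eq(1), of "amap P"] by simp
  from cyl.reassoc[OF this, of z]
  show "z \<in> Arr A \<Longrightarrow> Cod A z = omap P b \<Longrightarrow> amap P f \<cdot> (amap P t \<cdot> z) = z"
    by simp
qed

text \<open>A path \<open>h\<close> in the base starting at \<open>f g\<close> lifts to the path which runs inside the fibre from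
  \<open>g\<close> to \<open>t f g\<close> and then along \<open>t h\<close>; strictness of identities removes the constant
  beginning of its image.\<close>

lemma shrinking_Fib:
  assumes sh: "shrinking e b f t K"
  shows "f \<in> Fib"
proof -
  note [simp] = shrinking_simps[OF sh]
  have f: "f \<in> hom A e b" by (simp add: in_hom)
  show ?thesis
    unfolding Fib_paths[OF f]
  proof (intro allI ballI impI)
    fix a g h assume g: "g \<in> hom A a e" and h: "h \<in> hom A a (omap P b)" and eq: "e0 b \<cdot> h = f \<cdot> g"
    note [simp] = homD[OF g] homD[OF h] eq
    have "amap P f \<cdot> pcat e (v' e \<cdot> (K \<cdot> g)) (amap P t \<cdot> h) = pcat b (c b \<cdot> (f \<cdot> g)) h"
      by simp
    also have "\<dots> = h" by (rule pcat_const) auto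
    finally show "\<exists>k\<in>hom A a (omap P e). amap P f \<cdot> k = h \<and> e0 e \<cdot> k = g"
      by (intro bexI[of _ "pcat e (v' e \<cdot> (K \<cdot> g)) (amap P t \<cdot> h)"]) (auto simp: in_hom)
  qed
qed

lemma shrinking_W:
  assumes sh: "shrinking e b f t K"
  shows "f \<in> W" "t \<in> W"
proof -
  note [simp] = shrinking_simps[OF sh]
  have fs: "f \<in> hom A e b" "t \<in> hom A b e" by (simp_all add: in_hom)
  have "homotopic e e (t \<cdot> f) (\<one> e)"
    by (rule homotopicI[of K]) (auto simp: in_hom)
  moreover have "homotopic b b (f \<cdot> t) (\<one> b)"
    using homotopic_refl[of "\<one> b" b b] by (auto simp: in_hom)
  ultimately show "f \<in> W" "t \<in> W" using fs by (auto intro: WI)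
qed

text \<open>Dold's theorem. Lifting a homotopy makes a homotopy inverse of \<open>f\<close> into a section \<open>t\<close>; if
  \<open>H\<close> is a homotopy from \<open>t f\<close> to the identity then the path \<open>H\<close> preceded by the reverse of
  \<open>t f H\<close> lies over the reverse of \<open>f H\<close> followed by \<open>f H\<close>, which is constant since
  inverses are strict.\<close>

lemma Fib_W_shrinking:
  assumes Fib: "f \<in> Fib" and W: "f \<in> W" and f: "f \<in> hom A e b"
  obtains t K where "shrinking e b f t K"
proof -
  note [simp] = homD[OF f] cyl.Obj_hom[OF f]
  obtain g where g: "g \<in> hom A b e" and gf: "homotopic e e (g \<cdot> f) (\<one> e)"
    and fg: "homotopic b b (f \<cdot> g) (\<one> b)"
    using WE[OF W f] .
  note [simp] = homD[OF g]
  obtain G where G: "G \<in> hom A b (omap P b)" "e0 b \<cdot> G = f \<cdot> g" "e1 b \<cdot> G = \<one> b"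
    using fg by (rule homotopicE)
  obtain k where k: "k \<in> hom A b (omap P e)" "amap P f \<cdot> k = G" "e0 e \<cdot> k = g"
    using Fib g G(1,2) unfolding Fib_paths[OF f] by blast
  note [simp] = homD[OF k(1)] homD[OF G(1)]
  define t where "t = e1 e \<cdot> k"
  have t: "t \<in> hom A b e" by (auto simp: t_def in_hom)
  note [simp] = homD[OF t]
  have fs: "f \<cdot> t = \<one> b"
  proof -
    have "f \<cdot> t = e1 b \<cdot> (amap P f \<cdot> k)" by (simp add: t_def)
    then show ?thesis by (simp only: k(2) G(3))
  qed
  have fs_comp: "f \<cdot> (t \<cdot> z) = z" if "z \<in> Arr A" "Cod A z = b" for z
    using cyl.reassoc[OF fs, of z] that by simp
  have "homotopic b e g t" by (rule homotopicI[OF k(1)]) (auto simp: k(3) t_def)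
  then have "homotopic e e (t \<cdot> f) (\<one> e)"
    using gf by (meson f homotopic_comp(1) homotopic_sym homotopic_trans)
  then obtain H where H: "H \<in> hom A e (omap P e)" "e0 e \<cdot> H = t \<cdot> f" "e1 e \<cdot> H = \<one> e"
    by (rule homotopicE)
  note [simp] = homD[OF H(1)] H(2,3)
  define K where "K = pcat e (v' e \<cdot> (amap P t \<cdot> (amap P f \<cdot> H))) H"
  have Pfs: "amap P f \<cdot> (amap P t \<cdot> z) = z" if "z \<in> Arr A" "Cod A z = omap P b" for z
  proof -
    have "amap P f \<cdot> amap P t = \<one> (omap P b)"
      using arg_cong[OF fs, of "amap P"] by simp
    from cyl.reassoc[OF this, of z] show ?thesis using that by simp
  qed
  have "amap P f \<cdot> K = pcat b (v' b \<cdot> (amap P f \<cdot> H)) (amap P f \<cdot> H)"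
    by (simp add: K_def fs_comp Pfs)
  also have "\<dots> = c b \<cdot> f"
    by (rule pcat_const) auto
  finally have "shrinking e b f t K"
    unfolding shrinking_def using f t fs by (auto simp: K_def in_hom fs_comp)
  then show thesis using that by blast
qed

text \<open>The lift is the end of an extension of the contraction \<open>K u\<close>, which starts at \<open>t w\<close>
  and stays over \<open>w\<close> because the cleavage is normal.\<close>

lemma Cof_lifts_shrinking:
  assumes Cof: "j \<in> Cof" and sh: "shrinking e b f t K"
  shows "lifts_against A j f"
proof -
  note [simp] = shrinking_simps[OF sh]
  obtain a0 a1 where j: "j \<in> hom A a0 a1" using Cof unfolding normally_cloven_cofibrations_def by blast
  note [simp] = homD[OF j] cyl.Obj_hom[OF j]
  show ?thesis
    unfolding lifts_against_def
  proof (intro ballI impI)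
    fix u w assume "u \<in> hom A (Dom A j) (Dom A f)" "w \<in> hom A (Cod A j) (Cod A f)" and eq: "f \<cdot> u = w \<cdot> j"
    then have u: "u \<in> hom A a0 e" and w: "w \<in> hom A a1 b" by simp_all
    note [simp] = homD[OF u] homD[OF w] eq
    have "f \<in> hom A e b" "t \<cdot> w \<in> hom A a1 e" "K \<cdot> u \<in> hom A a0 (omap P e)"
      "e0 e \<cdot> (K \<cdot> u) = (t \<cdot> w) \<cdot> j" "amap P f \<cdot> (K \<cdot> u) = c b \<cdot> (f \<cdot> ((t \<cdot> w) \<cdot> j))"
      by (simp_all add: in_hom)
    then obtain k where k: "k \<in> hom A a1 (omap P e)" "k \<cdot> j = K \<cdot> u"
      "amap P f \<cdot> k = c b \<cdot> (f \<cdot> (t \<cdot> w))"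
      using Cof unfolding Cof_iff[OF j] by blast
    note [simp] = homD[OF k(1)]
    have "f \<cdot> (e1 e \<cdot> k) = e1 b \<cdot> (amap P f \<cdot> k)" by simp
    also have "\<dots> = w" by (simp only: k(3)) simp
    finally show "\<exists>l\<in>hom A (Cod A j) (Dom A f). l \<cdot> j = u \<and> f \<cdot> l = w"
      by (intro bexI[of _ "e1 e \<cdot> k"]) (auto simp: k(2) in_hom)
  qed
qed

section \<open>Factorisations\<close>

text \<open>The lower right connection contracts the cylinder onto its \<open>i0\<close> end, and its
  compatibility with \<open>p\<close> keeps the contraction in the fibres of \<open>q\<close>.\<close>

lemma mapping_cylinder_shrinking:
  assumes mc: "mapping_cylinder x y f m d0 d1"
  obtains q K where "shrinking m y q d1 K" "q \<cdot> d0 = f \<cdot> p x"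
proof -
  note arr = mapping_cylinder_arr[OF mc]
  note [simp] = homD[OF arr(1)] cyl.Obj_hom[OF arr(1)] homD[OF arr(2)] homD[OF arr(3)] cyl.Obj_hom[OF arr(3)]
  obtain q where q: "q \<in> hom A m y" "q \<cdot> d0 = f \<cdot> p x" "q \<cdot> d1 = \<one> y"
    using mapping_cylinder_factor[OF mc, of "f \<cdot> p x" y "\<one> y"] by (auto simp: in_hom)
  note [simp] = homD[OF q(1)]
  define D where "D = adj (omap Cyl x) m (d0 \<cdot> \<Gamma>lr x)"
  have D: "D \<in> hom A (omap Cyl x) (omap P m)" by (simp add: D_def in_hom)
  note [simp] = homD[OF D]
  have "D \<cdot> i0 x = adj x m ((d0 \<cdot> i0 x) \<cdot> p x)"
    unfolding D_def by (subst adj_comp) simp_all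
  also have "\<dots> = c m \<cdot> (d1 \<cdot> f)"
    by (subst adj_p) (simp_all add: arr(4))
  finally have "D \<cdot> i0 x = (c m \<cdot> d1) \<cdot> f" by simp
  then obtain K where K: "K \<in> hom A m (omap P m)" "K \<cdot> d0 = D" "K \<cdot> d1 = c m \<cdot> d1"
    using mapping_cylinder_factor[OF mc D, of "c m \<cdot> d1"] by (auto simp: in_hom)
  note [simp] = homD[OF K(1)]
  have "e0 m \<cdot> K = d1 \<cdot> q"
  proof (rule mapping_cylinder_unique[OF mc, of _ m])
    show "(e0 m \<cdot> K) \<cdot> d0 = (d1 \<cdot> q) \<cdot> d0"
      using cyl.reassoc[OF arr(4), of "p x"] by (simp add: K(2) D_def q(2))
  qed (auto simp: in_hom K(3) q(3))
  moreover have "e1 m \<cdot> K = \<one> m"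
    by (rule mapping_cylinder_unique[OF mc, of _ m]) (auto simp: in_hom K(2,3) D_def)
  moreover have "amap P q \<cdot> K = c y \<cdot> q"
  proof (rule mapping_cylinder_unique[OF mc, of _ "omap P y"])
    have "amap P q \<cdot> D = adj (omap Cyl x) y (q \<cdot> (d0 \<cdot> \<Gamma>lr x))"
      by (simp add: D_def)
    also have "q \<cdot> (d0 \<cdot> \<Gamma>lr x) = (f \<cdot> p x) \<cdot> p (omap Cyl x)"
      using cyl.reassoc[OF q(2), of "\<Gamma>lr x"] by simp
    also have "adj (omap Cyl x) y \<dots> = c y \<cdot> (f \<cdot> p x)"
      by (rule adj_p) simp_all
    finally show "(amap P q \<cdot> K) \<cdot> d0 = (c y \<cdot> q) \<cdot> d0"
      by (simp add: K(2) q(2))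
  qed (auto simp: in_hom K(3) q(3))
  ultimately have "shrinking m y q d1 K"
    unfolding shrinking_def using q(1,3) K(1) arr(3) by blast
  then show thesis using that q(2) by blast
qed

text \<open>On the cylinder part of the mapping cylinder the extension is \<open>g\<close> along the cylinder
  followed by the connection of the given homotopy. At the start of the homotopy the connection is
  constant, so strictness of identities makes the extension start at \<open>g\<close>.\<close>

lemma mapping_cylinder_Cof:
  assumes mc: "mapping_cylinder x y f m d0 d1"
  shows "d0 \<cdot> i1 x \<in> Cof"
proof -
  note arr = mapping_cylinder_arr[OF mc]
  note [simp] = homD[OF arr(1)] cyl.Obj_hom[OF arr(1)] homD[OF arr(2)] homD[OF arr(3)] cyl.Obj_hom[OF arr(3)]
  have i: "d0 \<cdot> i1 x \<in> hom A x m" by (simp add: in_hom)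
  show ?thesis
    unfolding Cof_iff[OF i]
  proof (intro allI impI, elim conjE)
    fix e b q g h assume q: "q \<in> hom A e b" and g: "g \<in> hom A m e" and h: "h \<in> hom A x (omap P e)"
      and h0: "e0 e \<cdot> h = g \<cdot> (d0 \<cdot> i1 x)" and qh: "amap P q \<cdot> h = c b \<cdot> (q \<cdot> (g \<cdot> (d0 \<cdot> i1 x)))"
    note [simp] = homD[OF q] homD[OF g] cyl.Obj_hom[OF q]
    obtain h1 where h1: "h1 \<in> hom A (omap Cyl x) e" "adj x e h1 = h"
      using adj_surj[OF h] by auto
    note [simp] = homD[OF h1(1)]
    have h1_0: "h1 \<cdot> i0 x = g \<cdot> (d0 \<cdot> i1 x)" using h0 by (auto simp flip: h1(2))
    have "adj x b (q \<cdot> h1) = adj x b ((q \<cdot> (g \<cdot> (d0 \<cdot> i1 x))) \<cdot> p x)"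
      using qh by (subst adj_p) (auto simp flip: h1(2))
    then have qh1: "q \<cdot> h1 = (q \<cdot> (g \<cdot> (d0 \<cdot> i1 x))) \<cdot> p x"
      by (rule adj_inj) (auto simp: in_hom)
    define D where "D = adj (omap Cyl x) e (h1 \<cdot> \<Gamma>lr x)"
    have D: "D \<in> hom A (omap Cyl x) (omap P e)" by (simp add: D_def in_hom)
    note [simp] = homD[OF D]
    have D0: "D \<cdot> i0 x = c e \<cdot> (g \<cdot> (d0 \<cdot> i1 x))"
    proof -
      have "D \<cdot> i0 x = adj x e ((h1 \<cdot> i0 x) \<cdot> p x)"
        unfolding D_def by (subst adj_comp) simp_all
      also have "\<dots> = c e \<cdot> (h1 \<cdot> i0 x)" by (rule adj_p) simp_all
      finally show ?thesis by (simp only: h1_0)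
    qed
    have D1: "D \<cdot> i1 x = h"
      unfolding D_def by (subst adj_comp) (simp_all add: h1(2))
    have eD: "e0 e \<cdot> D = (g \<cdot> d0) \<cdot> (i1 x \<cdot> p x)"
      using cyl.reassoc[OF h1_0, of "p x"] by (simp add: D_def)
    have qD: "amap P q \<cdot> D = (c b \<cdot> (q \<cdot> (g \<cdot> d0))) \<cdot> (i1 x \<cdot> p x)"
    proof -
      have "amap P q \<cdot> D = adj (omap Cyl x) b (q \<cdot> (h1 \<cdot> \<Gamma>lr x))" by (simp add: D_def)
      also have "q \<cdot> (h1 \<cdot> \<Gamma>lr x) = (q \<cdot> (g \<cdot> (d0 \<cdot> (i1 x \<cdot> p x)))) \<cdot> p (omap Cyl x)"
        using cyl.reassoc[OF qh1, of "\<Gamma>lr x"] by simp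
      also have "adj (omap Cyl x) b \<dots> = c b \<cdot> (q \<cdot> (g \<cdot> (d0 \<cdot> (i1 x \<cdot> p x))))"
        by (rule adj_p) simp_all
      finally show ?thesis by simp
    qed
    define E where "E = cyl.concat x (c e \<cdot> (g \<cdot> d0)) D"
    have concat: "x \<in> Obj A" "c e \<cdot> (g \<cdot> d0) \<in> hom A (omap Cyl x) (omap P e)" "D \<in> hom A (omap Cyl x) (omap P e)"
      "(c e \<cdot> (g \<cdot> d0)) \<cdot> i1 x = D \<cdot> i0 x"
      by (simp_all add: in_hom D0)
    have E: "E \<in> hom A (omap Cyl x) (omap P e)"
      and E0: "E \<cdot> i0 x = (c e \<cdot> (g \<cdot> d1)) \<cdot> f" and E1: "E \<cdot> i1 x = h"
      using cyl.concat_hom[OF concat] by (simp_all add: E_def D1 arr(4))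
    note [simp] = homD[OF E]
    have eE: "e0 e \<cdot> E = g \<cdot> d0"
      using cyl.comp_concat[OF concat, of "e0 e" e] cyl.concat_id(2)[of "g \<cdot> d0" x e]
      by (simp add: E_def in_hom eD)
    have qE: "amap P q \<cdot> E = c b \<cdot> (q \<cdot> (g \<cdot> d0))"
      using cyl.comp_concat[OF concat, of "amap P q" "omap P b"]
        cyl.concat_id(2)[of "c b \<cdot> (q \<cdot> (g \<cdot> d0))" x "omap P b"]
      by (simp add: E_def in_hom qD)
    obtain k where k: "k \<in> hom A m (omap P e)" "k \<cdot> d0 = E" "k \<cdot> d1 = c e \<cdot> (g \<cdot> d1)"
      using mapping_cylinder_factor[OF mc E _ E0] by (auto simp: in_hom)
    note [simp] = homD[OF k(1)]
    have "e0 e \<cdot> k = g"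
      by (rule mapping_cylinder_unique[OF mc, of _ e]) (auto simp: in_hom k(2,3) eE)
    moreover have "k \<cdot> (d0 \<cdot> i1 x) = h"
      using cyl.reassoc[OF k(2), of "i1 x"] E1 by simp
    moreover have "amap P q \<cdot> k = c b \<cdot> (q \<cdot> g)"
      by (rule mapping_cylinder_unique[OF mc, of _ "omap P b"]) (auto simp: in_hom k(2,3) qE)
    ultimately show "\<exists>k\<in>hom A m (omap P e). e0 e \<cdot> k = g \<and> k \<cdot> (d0 \<cdot> i1 x) = h \<and> amap P q \<cdot> k = c b \<cdot> (q \<cdot> g)"
      using k(1) by blast
  qed
qed

lemma factor_Cof_shrinking:
  assumes f: "f \<in> hom A x y"
  obtains m i q t K where "i \<in> hom A x m" "i \<in> Cof" "shrinking m y q t K" "f = q \<cdot> i"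
proof -
  obtain m d0 d1 where mc: "mapping_cylinder x y f m d0 d1"
    using mapping_cylinder_exists[OF f] .
  note [simp] = homD[OF f] cyl.Obj_hom[OF f] homD[OF mapping_cylinder_arr(2)[OF mc]]
  obtain q K where sh: "shrinking m y q d1 K" and q: "q \<cdot> d0 = f \<cdot> p x"
    using mapping_cylinder_shrinking[OF mc] .
  note [simp] = shrinking_simps[OF sh]
  have "f = q \<cdot> (d0 \<cdot> i1 x)" using cyl.reassoc[OF q, of "i1 x"] by simp
  then show thesis using that[OF _ mapping_cylinder_Cof[OF mc] sh] by (simp add: in_hom)
qed

definition mapping_cocylinder :: "'o \<Rightarrow> 'o \<Rightarrow> 'a \<Rightarrow> 'o \<Rightarrow> 'a \<Rightarrow> 'a \<Rightarrow> bool" where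
  "mapping_cocylinder x y f n \<pi>1 \<pi>2 \<longleftrightarrow>
     f \<in> hom A x y \<and> \<pi>1 \<in> hom A n x \<and> \<pi>2 \<in> hom A n (omap P y) \<and> is_pushout (op_cat A) (e0 y) f \<pi>2 \<pi>1"

lemma mapping_cocylinder_exists:
  assumes f: "f \<in> hom A x y"
  obtains n \<pi>1 \<pi>2 where "mapping_cocylinder x y f n \<pi>1 \<pi>2"
proof -
  note [simp] = homD[OF f] cyl.Obj_hom[OF f]
  have "e0 y \<in> hom (op_cat A) y (omap P y)" "f \<in> hom (op_cat A) y x" by (simp_all add: in_hom)
  then obtain \<pi>1 \<pi>2 where po: "is_pushout (op_cat A) (e0 y) f \<pi>2 \<pi>1"
    using cocyl.pushouts unfolding has_pushouts_def by blast
  then have "mapping_cocylinder x y f (Dom A \<pi>2) \<pi>1 \<pi>2"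
    using pushout_arr[OF po] f by (auto simp: mapping_cocylinder_def in_hom)
  then show thesis using that by blast
qed

lemma mapping_cocylinder_arr:
  assumes "mapping_cocylinder x y f n \<pi>1 \<pi>2"
  shows "f \<in> hom A x y" "\<pi>1 \<in> hom A n x" "\<pi>2 \<in> hom A n (omap P y)" "f \<cdot> \<pi>1 = e0 y \<cdot> \<pi>2"
  using assms pushout_arr(9)[of "op_cat A" "e0 y" f \<pi>2 \<pi>1] by (auto simp: mapping_cocylinder_def)

lemma mapping_cocylinder_factor:
  assumes mc: "mapping_cocylinder x y f n \<pi>1 \<pi>2"
    and uw: "u \<in> hom A a x" "w \<in> hom A a (omap P y)" "f \<cdot> u = e0 y \<cdot> w"
  obtains k where "k \<in> hom A a n" "\<pi>1 \<cdot> k = u" "\<pi>2 \<cdot> k = w"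
proof -
  note [simp] = homD[OF mapping_cocylinder_arr(1)[OF mc]] cyl.Obj_hom[OF mapping_cocylinder_arr(1)[OF mc]]
    homD[OF mapping_cocylinder_arr(3)[OF mc]]
  have "is_pushout (op_cat A) (e0 y) f \<pi>2 \<pi>1" using mc by (simp add: mapping_cocylinder_def)
  from pushout_factor[OF this, of w a u] show thesis using uw that by auto
qed

lemma mapping_cocylinder_unique:
  assumes mc: "mapping_cocylinder x y f n \<pi>1 \<pi>2"
    and k: "k \<in> hom A a n" "k' \<in> hom A a n" "\<pi>1 \<cdot> k = \<pi>1 \<cdot> k'" "\<pi>2 \<cdot> k = \<pi>2 \<cdot> k'"
  shows "k = k'"
proof -
  note [simp] = homD[OF mapping_cocylinder_arr(3)[OF mc]]
  have "is_pushout (op_cat A) (e0 y) f \<pi>2 \<pi>1" using mc by (simp add: mapping_cocylinder_def)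
  from cocyl.pushout_eq[OF this, of k a k'] show ?thesis using k by simp
qed

text \<open>A point of the mapping co-cylinder is a path, and moving its end along \<open>h\<close> lifts to
  the concatenation of that path with growing initial pieces of \<open>h\<close>, which the connection
  provides. Strictness of identities makes the lift start at the given point.\<close>

lemma mapping_cocylinder_Fib:
  assumes mc: "mapping_cocylinder x y f n \<pi>1 \<pi>2"
  shows "e1 y \<cdot> \<pi>2 \<in> Fib"
proof -
  note arr = mapping_cocylinder_arr[OF mc]
  note [simp] = homD[OF arr(1)] cyl.Obj_hom[OF arr(1)] homD[OF arr(2)] homD[OF arr(3)] cyl.Obj_hom[OF arr(2)]
  have q: "e1 y \<cdot> \<pi>2 \<in> hom A n y" by (simp add: in_hom)
  show ?thesis
    unfolding Fib_cylinders[OF q]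
  proof (intro allI ballI impI)
    fix a g h assume g: "g \<in> hom A a n" and h: "h \<in> hom A (omap Cyl a) y" and eq: "h \<cdot> i0 a = (e1 y \<cdot> \<pi>2) \<cdot> g"
    note [simp] = homD[OF g] homD[OF h] cyl.Obj_hom[OF g]
    define D where "D = adj (omap Cyl a) y (h \<cdot> \<Gamma>lr a)"
    have D: "D \<in> hom A (omap Cyl a) (omap P y)" by (simp add: D_def in_hom)
    note [simp] = homD[OF D]
    have eD: "e0 y \<cdot> D = e1 y \<cdot> (\<pi>2 \<cdot> (g \<cdot> p a))" "e1 y \<cdot> D = h"
      using cyl.reassoc[OF eq, of "p a"] by (simp_all add: D_def)
    have D0: "D \<cdot> i0 a = c y \<cdot> (e1 y \<cdot> (\<pi>2 \<cdot> g))"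
    proof -
      have "D \<cdot> i0 a = adj a y ((h \<cdot> i0 a) \<cdot> p a)"
        unfolding D_def by (subst adj_comp) simp_all
      also have "\<dots> = c y \<cdot> (h \<cdot> i0 a)" by (rule adj_p) simp_all
      finally show ?thesis by (simp add: eq)
    qed
    define k2 where "k2 = pcat y (\<pi>2 \<cdot> (g \<cdot> p a)) D"
    have k2: "k2 \<in> hom A (omap Cyl a) (omap P y)" "e0 y \<cdot> k2 = e0 y \<cdot> (\<pi>2 \<cdot> (g \<cdot> p a))" "e1 y \<cdot> k2 = h"
      by (simp_all add: k2_def in_hom eD)
    have k2_0: "k2 \<cdot> i0 a = \<pi>2 \<cdot> g"
    proof -
      have "k2 \<cdot> i0 a = pcat y (\<pi>2 \<cdot> g) (c y \<cdot> (e1 y \<cdot> (\<pi>2 \<cdot> g)))"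
        by (simp add: k2_def eD D0)
      also have "\<dots> = \<pi>2 \<cdot> g" by (rule pcat_const) simp_all
      finally show ?thesis .
    qed
    have "\<pi>1 \<cdot> (g \<cdot> p a) \<in> hom A (omap Cyl a) x" "f \<cdot> (\<pi>1 \<cdot> (g \<cdot> p a)) = e0 y \<cdot> k2"
      using cyl.reassoc[OF arr(4), of "g \<cdot> p a"] by (simp_all add: k2(2) in_hom)
    then obtain k where k: "k \<in> hom A (omap Cyl a) n" "\<pi>1 \<cdot> k = \<pi>1 \<cdot> (g \<cdot> p a)" "\<pi>2 \<cdot> k = k2"
      using mapping_cocylinder_factor[OF mc _ k2(1)] by blast
    note [simp] = homD[OF k(1)]
    have "k \<cdot> i0 a = g"
    proof (rule mapping_cocylinder_unique[OF mc, of _ a])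
      show "\<pi>1 \<cdot> (k \<cdot> i0 a) = \<pi>1 \<cdot> g" using cyl.reassoc[OF k(2), of "i0 a"] by simp
      show "\<pi>2 \<cdot> (k \<cdot> i0 a) = \<pi>2 \<cdot> g" using cyl.reassoc[OF k(3), of "i0 a"] k2_0 by simp
    qed (simp_all add: in_hom)
    moreover have "(e1 y \<cdot> \<pi>2) \<cdot> k = h" by (simp add: k(3) k2(3))
    ultimately show "\<exists>k\<in>hom A (omap Cyl a) n. (e1 y \<cdot> \<pi>2) \<cdot> k = h \<and> k \<cdot> i0 a = g"
      using k(1) by blast
  qed
qed

lemma i0_lifts_Fib:
  assumes f: "f \<in> Fib" and a: "a \<in> Obj A"
  shows "lifts_against A (i0 a) f"
proof -
  obtain e b where fh: "f \<in> hom A e b" using f unfolding cocyl_fibrations_def by blast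
  then show ?thesis
    using f a unfolding Fib_cylinders[OF fh] lifts_against_def by (simp add: homD[OF fh]) metis
qed

text \<open>The arrow \<open>d1\<close> is a pushout of \<open>i0 x\<close>, against which fibrations lift.\<close>

lemma mapping_cylinder_llp_Fib:
  assumes mc: "mapping_cylinder x y f m d0 d1"
  shows "d1 \<in> llp A Fib"
proof -
  note arr = mapping_cylinder_arr[OF mc]
  note [simp] = homD[OF arr(1)] cyl.Obj_hom[OF arr(1)] homD[OF arr(2)] homD[OF arr(3)] cyl.Obj_hom[OF arr(3)]
  have "lifts_against A d1 q" if Fib: "q \<in> Fib" for q
  proof -
    obtain e b where q: "q \<in> hom A e b" using Fib unfolding cocyl_fibrations_def by blast
    note [simp] = homD[OF q] cyl.Obj_hom[OF q]
    show ?thesis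
      unfolding lifts_against_def
    proof (intro ballI impI)
      fix u w assume "u \<in> hom A (Dom A d1) (Dom A q)" "w \<in> hom A (Cod A d1) (Cod A q)" and eq: "q \<cdot> u = w \<cdot> d1"
      then have u: "u \<in> hom A y e" and w: "w \<in> hom A m b" by simp_all
      note [simp] = homD[OF u] homD[OF w]
      have "u \<cdot> f \<in> hom A x e" "w \<cdot> d0 \<in> hom A (omap Cyl x) b" "(w \<cdot> d0) \<cdot> i0 x = q \<cdot> (u \<cdot> f)"
        using cyl.reassoc[OF eq, of f] by (simp_all add: in_hom arr(4))
      then obtain k where k: "k \<in> hom A (omap Cyl x) e" "q \<cdot> k = w \<cdot> d0" "k \<cdot> i0 x = u \<cdot> f"
        using Fib unfolding Fib_cylinders[OF q] by blast
      obtain l where l: "l \<in> hom A m e" "l \<cdot> d0 = k" "l \<cdot> d1 = u"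
        using mapping_cylinder_factor[OF mc k(1) u k(3)] .
      note [simp] = homD[OF l(1)]
      have "q \<cdot> l = w"
        by (rule mapping_cylinder_unique[OF mc, of _ b]) (simp_all add: in_hom l(2,3) k(2) eq)
      then show "\<exists>l\<in>hom A (Cod A d1) (Dom A q). l \<cdot> d1 = u \<and> q \<cdot> l = w"
        using l by auto
    qed
  qed
  then show ?thesis by (simp add: llp_def)
qed

text \<open>The inclusion of \<open>x\<close> into the mapping co-cylinder \<open>n\<close> of \<open>f\<close> need not be a cofibration.
  Gluing instead the start of a cylinder on \<open>n\<close> to \<open>x\<close> along the projection gives \<open>z\<close>, in which
  \<open>x\<close> is included by a pushout of \<open>i0 n\<close>, with \<open>q\<close> from \<open>z\<close> to \<open>y\<close> evaluating paths.
  The end of the cylinder is an arrow \<open>\<sigma>\<close> over \<open>y\<close> to \<open>z\<close> from \<open>n\<close>, which is fibred over \<open>y\<close>, so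
  it suffices to move a point of \<open>z\<close> inside its fibre to the image of a point of \<open>n\<close>. Retract
  \<open>z\<close> to \<open>x\<close>, which runs over the reverse of some path \<open>\<gamma>\<close> in \<open>y\<close>, and then follow the
  cylinder at the point \<open>\<gamma>\<close> of \<open>n\<close> to its end, which runs over \<open>\<gamma>\<close>. As inverses are strict,
  the composite is constant over \<open>y\<close>.\<close>

lemma factor_llp_Fib:
  assumes f: "f \<in> hom A x y"
  obtains z d q where "d \<in> hom A x z" "q \<in> hom A z y" "f = q \<cdot> d" "d \<in> W" "d \<in> llp A Fib" "q \<in> Fib"
proof -
  obtain n \<pi>1 \<pi>2 where mn: "mapping_cocylinder x y f n \<pi>1 \<pi>2"
    using mapping_cocylinder_exists[OF f] .
  note n = mapping_cocylinder_arr[OF mn]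
  obtain z d0 d where mz: "mapping_cylinder n x \<pi>1 z d0 d"
    using mapping_cylinder_exists[OF n(2)] .
  note z = mapping_cylinder_arr[OF mz]
  note [simp] = homD[OF n(1)] cyl.Obj_hom[OF n(1)] homD[OF n(2)] cyl.Obj_hom[OF n(2)] homD[OF n(3)]
    homD[OF z(2)] homD[OF z(3)] cyl.Obj_hom[OF z(3)]
  obtain \<rho> K where sh: "shrinking z x \<rho> d K" and \<rho>: "\<rho> \<cdot> d0 = \<pi>1 \<cdot> p n"
    using mapping_cylinder_shrinking[OF mz] .
  note [simp] = shrinking_simps[OF sh]
  obtain ev where ev: "ev \<in> hom A (omap Cyl n) y" "adj n y ev = \<pi>2"
    using adj_surj[OF n(3)] by auto
  note [simp] = homD[OF ev(1)]
  have ev0: "ev \<cdot> i0 n = f \<cdot> \<pi>1" and ev1: "ev \<cdot> i1 n = e1 y \<cdot> \<pi>2"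
    using e_adj(1,2)[of ev n y] n(4) by (simp_all add: ev(2))
  obtain q where q: "q \<in> hom A z y" "q \<cdot> d0 = ev" "q \<cdot> d = f"
    using mapping_cylinder_factor[OF mz ev(1) f ev0] .
  note [simp] = homD[OF q(1)]
  define E where "E = adj n z d0"
  have E: "E \<in> hom A n (omap P z)" "e0 z \<cdot> E = d \<cdot> \<pi>1" "e1 z \<cdot> E = d0 \<cdot> i1 n" "amap P q \<cdot> E = \<pi>2"
    by (simp_all add: E_def in_hom z(4) q(2) ev(2))
  note [simp] = homD[OF E(1)]
  have qd: "q \<cdot> (d \<cdot> w) = f \<cdot> w" if "w \<in> Arr A" "Cod A w = x" for w
    using cyl.reassoc[OF q(3), of w] that by simp
  have "f \<cdot> \<rho> = e0 y \<cdot> (amap P q \<cdot> K)"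
    using qd[of \<rho>] by simp
  then obtain \<theta> where \<theta>: "\<theta> \<in> hom A z n" "\<pi>1 \<cdot> \<theta> = \<rho>" "\<pi>2 \<cdot> \<theta> = amap P q \<cdot> K"
    using mapping_cocylinder_factor[OF mn, of \<rho> z "amap P q \<cdot> K"] by (auto simp: in_hom)
  note [simp] = homD[OF \<theta>(1)]
  have "q \<in> Fib"
    unfolding Fib_paths[OF q(1)]
  proof (intro allI ballI impI)
    fix a g h assume g: "g \<in> hom A a z" and h: "h \<in> hom A a (omap P y)" and eq: "e0 y \<cdot> h = q \<cdot> g"
    note [simp] = homD[OF g] homD[OF h]
    have e: "e1 y \<cdot> \<pi>2 \<in> hom A n y" by (simp add: in_hom)
    have \<pi>2\<theta>: "\<pi>2 \<cdot> (\<theta> \<cdot> g) = amap P q \<cdot> (K \<cdot> g)"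
      using cyl.reassoc[OF \<theta>(3), of g] by simp
    have "\<theta> \<cdot> g \<in> hom A a n" "e0 y \<cdot> h = (e1 y \<cdot> \<pi>2) \<cdot> (\<theta> \<cdot> g)"
      by (simp_all add: in_hom \<pi>2\<theta> eq)
    then obtain l where l: "l \<in> hom A a (omap P n)" "amap P (e1 y \<cdot> \<pi>2) \<cdot> l = h" "e0 n \<cdot> l = \<theta> \<cdot> g"
      using mapping_cocylinder_Fib[OF mn] h unfolding Fib_paths[OF e] by blast
    note [simp] = homD[OF l(1)]
    define \<sigma> where "\<sigma> = d0 \<cdot> i1 n"
    have \<sigma>: "\<sigma> \<in> hom A n z" and q\<sigma>: "q \<cdot> \<sigma> = e1 y \<cdot> \<pi>2"
      using cyl.reassoc[OF q(2), of "i1 n"] by (simp_all add: \<sigma>_def in_hom ev1)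
    note [simp] = homD[OF \<sigma>]
    have Pq\<sigma>: "amap P q \<cdot> (amap P \<sigma> \<cdot> l) = h"
      using arg_cong[OF q\<sigma>, of "\<lambda>w. amap P w \<cdot> l"] l(2) by simp
    have E\<theta>: "e0 z \<cdot> (E \<cdot> (\<theta> \<cdot> g)) = d \<cdot> (\<rho> \<cdot> g)" "e1 z \<cdot> (E \<cdot> (\<theta> \<cdot> g)) = \<sigma> \<cdot> (\<theta> \<cdot> g)"
      "amap P q \<cdot> (E \<cdot> (\<theta> \<cdot> g)) = amap P q \<cdot> (K \<cdot> g)"
      using cyl.reassoc[OF E(2), of "\<theta> \<cdot> g"] cyl.reassoc[OF \<theta>(2), of g]
        cyl.reassoc[OF E(3), of "\<theta> \<cdot> g"] cyl.reassoc[OF E(4), of "\<theta> \<cdot> g"] \<pi>2\<theta>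
      by (simp_all add: \<sigma>_def)
    define V where "V = pcat z (v' z \<cdot> (K \<cdot> g)) (E \<cdot> (\<theta> \<cdot> g))"
    have V: "V \<in> hom A a (omap P z)" "e0 z \<cdot> V = g" "e1 z \<cdot> V = \<sigma> \<cdot> (\<theta> \<cdot> g)"
      by (simp_all add: V_def in_hom E\<theta>)
    note [simp] = homD[OF V(1)]
    have "amap P q \<cdot> V = pcat y (v' y \<cdot> (amap P q \<cdot> (K \<cdot> g))) (amap P q \<cdot> (K \<cdot> g))"
      by (simp add: V_def E\<theta>)
    also have "\<dots> = c y \<cdot> (q \<cdot> g)"
      by (rule pcat_const) simp_all
    finally have qV: "amap P q \<cdot> V = c y \<cdot> (q \<cdot> g)" .
    have "amap P q \<cdot> pcat z V (amap P \<sigma> \<cdot> l) = pcat y (c y \<cdot> (q \<cdot> g)) h"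
      by (simp add: V(3) l(3) qV Pq\<sigma>)
    also have "\<dots> = h"
      by (rule pcat_const) (simp_all add: eq)
    finally show "\<exists>k\<in>hom A a (omap P z). amap P q \<cdot> k = h \<and> e0 z \<cdot> k = g"
      by (intro bexI[of _ "pcat z V (amap P \<sigma> \<cdot> l)"]) (simp_all add: in_hom V(2,3) l(3))
  qed
  then show thesis
    using that[OF z(3) q(1)] q(3) shrinking_W(2)[OF sh] mapping_cylinder_llp_Fib[OF mz] by simp
qed

end

section \<open>The model structure\<close>

lemma (in category) lifts_against_retract_left:
  assumes lift: "lifts_against C i f" and f: "f \<in> Arr C" and i: "i \<in> hom C x m" and j: "j \<in> hom C x b"
    and l: "l \<in> hom C b m" and q: "q \<in> hom C m b"
    and eq: "l \<cdot> j = i" "q \<cdot> i = j" "q \<cdot> l = \<one> b"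
  shows "lifts_against C j f"
  unfolding lifts_against_def
proof (intro ballI impI)
  note [simp] = homD[OF i] homD[OF j] homD[OF l] homD[OF q] f Obj_hom[OF j]
  fix u w assume "u \<in> hom C (Dom C j) (Dom C f)" "w \<in> hom C (Cod C j) (Cod C f)" and sq: "f \<cdot> u = w \<cdot> j"
  then have u: "u \<in> hom C x (Dom C f)" and w: "w \<in> hom C b (Cod C f)" by simp_all
  have [simp]: "u \<in> Arr C" "Dom C u = x" "Cod C u = Dom C f" "w \<in> Arr C" "Dom C w = b" "Cod C w = Cod C f"
    using u w by (simp_all add: in_hom)
  have "w \<cdot> q \<in> hom C m (Cod C f)" "f \<cdot> u = (w \<cdot> q) \<cdot> i"
    by (simp_all add: in_hom eq sq)
  then obtain k where k: "k \<in> hom C m (Dom C f)" "k \<cdot> i = u" "f \<cdot> k = w \<cdot> q"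
    using lift u unfolding lifts_against_def by (metis homD(2,3) i)
  have [simp]: "k \<in> Arr C" "Dom C k = m" "Cod C k = Dom C f"
    using k(1) by (simp_all add: in_hom)
  have "f \<cdot> (k \<cdot> l) = w" using reassoc[OF k(3), of l] eq(3) by simp
  then show "\<exists>l\<in>hom C (Cod C j) (Dom C f). l \<cdot> j = u \<and> f \<cdot> l = w"
    by (intro bexI[of _ "k \<cdot> l"]) (simp_all add: in_hom eq(1) k(2))
qed

text \<open>The retract argument: an arrow which lifts against the second factor of one of its
  factorisations is a retract of the first.\<close>

lemma (in category) lift_retract:
  assumes "lifts_against C j q" "j \<in> hom C x b" "q \<in> hom C m b" "i \<in> hom C x m" "j = q \<cdot> i"
  obtains l where "l \<in> hom C b m" "l \<cdot> j = i" "q \<cdot> l = \<one> b"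
proof -
  note [simp] = homD[OF assms(2)] homD[OF assms(3)] Obj_hom[OF assms(2)]
  have "\<forall>u\<in>hom C x m. \<forall>w\<in>hom C b b. q \<cdot> u = w \<cdot> j \<longrightarrow>
      (\<exists>l\<in>hom C b m. l \<cdot> j = u \<and> q \<cdot> l = w)"
    using assms(1) by (simp add: lifts_against_def)
  moreover have "\<one> b \<in> hom C b b" by (simp add: in_hom)
  moreover have "q \<cdot> i = \<one> b \<cdot> j" by (simp add: assms(5)[symmetric])
  ultimately show thesis
    using assms(4) that by blast
qed

context cylinder_adjunction
begin

lemma Fib_W_iff: "f \<in> Fib \<inter> W \<longleftrightarrow> (\<exists>e b t K. shrinking e b f t K)"
proof
  assume f: "f \<in> Fib \<inter> W"
  then obtain e b where fh: "f \<in> hom A e b" unfolding cocyl_fibrations_def by blast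
  obtain t K where "shrinking e b f t K"
    using Fib_W_shrinking[OF IntD1[OF f] IntD2[OF f] fh] .
  then show "\<exists>e b t K. shrinking e b f t K" by blast
next
  assume "\<exists>e b t K. shrinking e b f t K"
  then show "f \<in> Fib \<inter> W" using shrinking_Fib shrinking_W(1) by blast
qed

lemma Arr_classes: "W \<subseteq> Arr A" "Fib \<subseteq> Arr A" "Cof \<subseteq> Arr A"
proof -
  show "W \<subseteq> Arr A"
  proof
    fix f assume "f \<in> W"
    then show "f \<in> Arr A" unfolding W_iff by (elim exE conjE) (rule homD(1))
  qed
  show "Fib \<subseteq> Arr A"
  proof
    fix f assume "f \<in> Fib"
    then show "f \<in> Arr A"
      unfolding cocyl_fibrations_def mem_Collect_eq by (elim exE conjE) (rule homD(1))
  qed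
  show "Cof \<subseteq> Arr A"
  proof
    fix f assume "f \<in> Cof"
    then show "f \<in> Arr A"
      unfolding normally_cloven_cofibrations_def mem_Collect_eq by (elim exE conjE) (rule homD(1))
  qed
qed

lemma Cof_lifts: "j \<in> Cof \<Longrightarrow> f \<in> Fib \<inter> W \<Longrightarrow> lifts_against A j f"
  unfolding Fib_W_iff using Cof_lifts_shrinking by blast

lemma Cof_retract:
  assumes i: "i \<in> Cof" "i \<in> hom A x m" and j: "j \<in> hom A x b"
    and l: "l \<in> hom A b m" and q: "q \<in> hom A m b"
    and eq: "l \<cdot> j = i" "q \<cdot> i = j" "q \<cdot> l = \<one> b"
  shows "j \<in> Cof"
  unfolding Cof_iff[OF j]
proof (intro allI impI, elim conjE)
  note [simp] = homD[OF i(2)] homD[OF j] homD[OF l] homD[OF q] cyl.Obj_hom[OF j]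
  fix e d f g h assume f: "f \<in> hom A e d" and g: "g \<in> hom A b e" and h: "h \<in> hom A x (omap P e)"
    and h0: "e0 e \<cdot> h = g \<cdot> j" and fh: "amap P f \<cdot> h = c d \<cdot> (f \<cdot> (g \<cdot> j))"
  note [simp] = homD[OF f] homD[OF g] cyl.Obj_hom[OF f]
  have "g \<cdot> q \<in> hom A m e" "e0 e \<cdot> h = (g \<cdot> q) \<cdot> i" "amap P f \<cdot> h = c d \<cdot> (f \<cdot> ((g \<cdot> q) \<cdot> i))"
    by (simp_all add: in_hom eq(2) h0 fh)
  then obtain k where k: "k \<in> hom A m (omap P e)" "e0 e \<cdot> k = g \<cdot> q" "k \<cdot> i = h"
    "amap P f \<cdot> k = c d \<cdot> (f \<cdot> (g \<cdot> q))"
    using i(1) f h unfolding Cof_iff[OF i(2)] by blast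
  note [simp] = homD[OF k(1)]
  have "e0 e \<cdot> (k \<cdot> l) = g" "amap P f \<cdot> (k \<cdot> l) = c d \<cdot> (f \<cdot> g)"
    using cyl.reassoc[OF k(2), of l] cyl.reassoc[OF k(4), of l] by (simp_all add: eq(3))
  then show "\<exists>k\<in>hom A b (omap P e). e0 e \<cdot> k = g \<and> k \<cdot> j = h \<and> amap P f \<cdot> k = c d \<cdot> (f \<cdot> g)"
    by (intro bexI[of _ "k \<cdot> l"]) (simp_all add: in_hom eq(1) k(3))
qed

lemma shrinking_retract:
  assumes sh: "shrinking m b q t K" and f: "f \<in> hom A x b" and i: "i \<in> hom A x m" and l: "l \<in> hom A m x"
    and eq: "l \<cdot> i = \<one> x" "f \<cdot> l = q" "q \<cdot> i = f"
  shows "shrinking x b f (l \<cdot> t) (amap P l \<cdot> (K \<cdot> i))"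
proof -
  note [simp] = shrinking_simps[OF sh] homD[OF f] homD[OF i] homD[OF l] cyl.Obj_hom[OF f]
  have 1: "f \<cdot> (l \<cdot> t) = \<one> b"
    using cyl.reassoc[OF eq(2), of t] by simp
  have 2: "amap P f \<cdot> (amap P l \<cdot> (K \<cdot> i)) = c b \<cdot> f"
    using arg_cong[OF eq(2), of "\<lambda>w. amap P w \<cdot> (K \<cdot> i)"] by (simp add: eq(3))
  show ?thesis
    unfolding shrinking_def using 1 2 by (simp add: in_hom eq)
qed

lemma Cof_eq: "Cof = llp A (Fib \<inter> W)"
proof (intro equalityI subsetI)
  fix j assume "j \<in> Cof"
  then show "j \<in> llp A (Fib \<inter> W)"
    using Cof_lifts Arr_classes(3) by (auto simp: llp_def)
next
  fix j assume j: "j \<in> llp A (Fib \<inter> W)"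
  then obtain x b where jh: "j \<in> hom A x b" by (auto simp: llp_def in_hom)
  obtain m i q t K where fac: "i \<in> hom A x m" "i \<in> Cof" "shrinking m b q t K" "j = q \<cdot> i"
    using factor_Cof_shrinking[OF jh] .
  have q: "q \<in> Fib \<inter> W" and qh: "q \<in> hom A m b"
    using fac(3) Fib_W_iff unfolding shrinking_def by blast+
  obtain l where "l \<in> hom A b m" "l \<cdot> j = i" "q \<cdot> l = \<one> b"
    using cyl.lift_retract[OF _ jh qh fac(1,4)] j q by (auto simp: llp_def)
  then show "j \<in> Cof" using Cof_retract fac jh qh by metis
qed

lemma Fib_W_eq: "Fib \<inter> W = rlp A Cof"
proof (intro equalityI subsetI)
  fix f assume "f \<in> Fib \<inter> W"
  then show "f \<in> rlp A Cof"
    using Cof_lifts Arr_classes(2) by (auto simp: rlp_def)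
next
  fix f assume f: "f \<in> rlp A Cof"
  then obtain x b where fh: "f \<in> hom A x b" by (auto simp: rlp_def in_hom)
  note [simp] = homD[OF fh] cyl.Obj_hom[OF fh]
  obtain m i q t K where fac: "i \<in> hom A x m" "i \<in> Cof" "shrinking m b q t K" "f = q \<cdot> i"
    using factor_Cof_shrinking[OF fh] .
  note [simp] = homD[OF fac(1)]
  have qh: "q \<in> hom A m b" using fac(3) unfolding shrinking_def by blast
  have one: "\<one> x \<in> hom A x x" "f \<cdot> \<one> x = q \<cdot> i" by (simp_all add: in_hom fac(4)[symmetric])
  have "lifts_against A i f" using f fac(2) by (simp add: rlp_def)
  then have "\<forall>u\<in>hom A x x. \<forall>w\<in>hom A m b. f \<cdot> u = w \<cdot> i \<longrightarrow>
      (\<exists>l\<in>hom A m x. l \<cdot> i = u \<and> f \<cdot> l = w)"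
    by (simp add: lifts_against_def)
  then obtain l where l: "l \<in> hom A m x" "l \<cdot> i = \<one> x" "f \<cdot> l = q"
    using one qh by blast
  have "shrinking x b f (l \<cdot> t) (amap P l \<cdot> (K \<cdot> i))"
    by (rule shrinking_retract[OF fac(3) fh fac(1) l fac(4)[symmetric]])
  then show "f \<in> Fib \<inter> W" unfolding Fib_W_iff by blast
qed

lemma llp_Fib_eq: "Cof \<inter> W = llp A Fib"
proof (intro equalityI subsetI)
  fix j assume j: "j \<in> Cof \<inter> W"
  then obtain x b where jh: "j \<in> hom A x b" using Arr_classes by (auto simp: in_hom)
  obtain z d q where fac: "d \<in> hom A x z" "q \<in> hom A z b" "j = q \<cdot> d" "d \<in> W" "d \<in> llp A Fib" "q \<in> Fib"
    using factor_llp_Fib[OF jh] .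
  have "q \<in> Fib \<inter> W"
    using W_two_of_three(2)[OF fac(1,2)] fac(3,4,6) j by auto
  then have "lifts_against A j q" using Cof_lifts j by blast
  then obtain l where l: "l \<in> hom A b z" "l \<cdot> j = d" "q \<cdot> l = \<one> b"
    using cyl.lift_retract[OF _ jh fac(2,1,3)] by auto
  have "lifts_against A j f" if "f \<in> Fib" for f
    using cyl.lifts_against_retract_left[OF _ _ fac(1) jh l(1) fac(2) l(2) fac(3)[symmetric] l(3)]
      that fac(5) Arr_classes(2) by (auto simp: llp_def)
  then show "j \<in> llp A Fib" using j Arr_classes(1) by (auto simp: llp_def)
next
  fix j assume j: "j \<in> llp A Fib"
  then have "j \<in> Cof" unfolding Cof_eq by (auto simp: llp_def)
  obtain x b where jh: "j \<in> hom A x b" using j by (auto simp: llp_def in_hom)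
  obtain z d q where fac: "d \<in> hom A x z" "q \<in> hom A z b" "j = q \<cdot> d" "d \<in> W" "d \<in> llp A Fib" "q \<in> Fib"
    using factor_llp_Fib[OF jh] .
  obtain l where l: "l \<in> hom A b z" "l \<cdot> j = d" "q \<cdot> l = \<one> b"
    using cyl.lift_retract[OF _ jh fac(2,1,3)] j fac(6) by (auto simp: llp_def)
  obtain g where g: "g \<in> hom A z x" "homotopic x x (g \<cdot> d) (\<one> x)" "homotopic z z (d \<cdot> g) (\<one> z)"
    using WE[OF fac(4,1)] .
  note [simp] = homD[OF jh] homD[OF fac(1)] homD[OF fac(2)] homD[OF l(1)] homD[OF g(1)] cyl.Obj_hom[OF fac(2)]
  have gl: "g \<cdot> l \<in> hom A b x" by (simp add: in_hom)
  have "homotopic b b (q \<cdot> (d \<cdot> (g \<cdot> l))) (q \<cdot> l)"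
    using homotopic_comp(2)[OF homotopic_comp(1)[OF g(3) l(1)] fac(2)] by simp
  then have "homotopic b b (j \<cdot> (g \<cdot> l)) (\<one> b)"
    using fac(3) l(3) by simp
  moreover have "homotopic x x ((g \<cdot> l) \<cdot> j) (\<one> x)"
    using g(2) l(2) by simp
  ultimately have "j \<in> W" using jh gl by (auto intro: WI)
  with \<open>j \<in> Cof\<close> show "j \<in> Cof \<inter> W" by blast
qed

lemma Fib_eq: "Fib = rlp A (Cof \<inter> W)"
proof (intro equalityI subsetI)
  fix f assume "f \<in> Fib"
  then show "f \<in> rlp A (Cof \<inter> W)"
    using Arr_classes(2) unfolding llp_Fib_eq by (auto simp: rlp_def llp_def)
next
  fix f assume f: "f \<in> rlp A (Cof \<inter> W)"
  then obtain e b where fh: "f \<in> hom A e b" by (auto simp: rlp_def in_hom)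
  show "f \<in> Fib"
    unfolding Fib_cylinders[OF fh]
  proof (intro allI ballI impI)
    fix a g h assume g: "g \<in> hom A a e" and h: "h \<in> hom A (omap Cyl a) b" and eq: "h \<cdot> i0 a = f \<cdot> g"
    note [simp] = homD[OF fh] cyl.Obj_hom[OF g]
    have "i0 a \<in> llp A Fib" using i0_lifts_Fib by (simp add: llp_def)
    then have "lifts_against A (i0 a) f" using f unfolding llp_Fib_eq by (simp add: rlp_def)
    then have "\<forall>u\<in>hom A a e. \<forall>w\<in>hom A (omap Cyl a) b. f \<cdot> u = w \<cdot> i0 a \<longrightarrow>
        (\<exists>l\<in>hom A (omap Cyl a) e. l \<cdot> i0 a = u \<and> f \<cdot> l = w)"
      by (simp add: lifts_against_def)
    then show "\<exists>k\<in>hom A (omap Cyl a) e. f \<cdot> k = h \<and> k \<cdot> i0 a = g"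
      using g h eq[symmetric] by blast
  qed
qed

lemma model_structure: "model_structure A W Fib Cof"
  unfolding model_structure_def
proof (intro conjI Arr_classes Fib_eq Fib_W_eq Cof_eq llp_Fib_eq allI ballI impI)
  fix a b d f g assume fg: "f \<in> hom A a b" "g \<in> hom A b d"
  show "f \<in> W \<and> g \<in> W \<Longrightarrow> g \<cdot> f \<in> W" "f \<in> W \<and> g \<cdot> f \<in> W \<Longrightarrow> g \<in> W" "g \<in> W \<and> g \<cdot> f \<in> W \<Longrightarrow> f \<in> W"
    using W_two_of_three[OF fg] by blast+
next
  fix a b f assume f: "f \<in> hom A a b"
  obtain m i q t K where fac: "i \<in> hom A a m" "i \<in> Cof" "shrinking m b q t K" "f = q \<cdot> i"
    using factor_Cof_shrinking[OF f] .
  have "q \<in> Fib \<inter> W" "q \<in> hom A m b"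
    using fac(3) Fib_W_iff unfolding shrinking_def by blast+
  then show "\<exists>m. \<exists>j\<in>hom A a m. \<exists>q\<in>hom A m b. j \<in> Cof \<and> q \<in> Fib \<inter> W \<and> f = q \<cdot> j"
    using fac by blast
  show "\<exists>m. \<exists>j\<in>hom A a m. \<exists>q\<in>hom A m b. j \<in> Cof \<inter> W \<and> q \<in> Fib \<and> f = q \<cdot> j"
    unfolding llp_Fib_eq using factor_llp_Fib[OF f] by metis
qed

end

theorem mainTheorem2:
  fixes A :: "('o, 'a) cat"
    and Cyl S coCyl S' :: "('o, 'a) endo"
    and i0 i1 p v r0 r1 s \<Gamma>ul \<Gamma>lr :: "'o \<Rightarrow> 'a"
    and e0 e1 c v' r0' r1' s' \<Gamma>ul' \<Gamma>lr' \<Gamma>ur' :: "'o \<Rightarrow> 'a"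
    and adj :: "'o \<Rightarrow> 'o \<Rightarrow> 'a \<Rightarrow> 'a"
  assumes "category A"
    and "has_finite_limits A"
    and "has_finite_colimits A"
    and "cylinder A Cyl i0 i1"
    and "contraction A Cyl i0 i1 p"
    and "involution A Cyl i0 i1 v"
    and "involution_compatible A p v"
    and "subdivision A Cyl i0 i1 S r0 r1 s"
    and "subdivision_compatible A p S r0 r1 s"
    and "upper_left_connection A Cyl i0 i1 p \<Gamma>ul"
    and "lower_right_connection A Cyl i0 i1 p \<Gamma>lr"
    and "lower_right_compatible A Cyl p \<Gamma>lr"
    and "preserves_mapping_cylinders A Cyl i0"
    and "strictness_of_identities A Cyl i0 i1 p S r0 r1 s"
    and "cylinder (op_cat A) coCyl e0 e1"
    and "contraction (op_cat A) coCyl e0 e1 c"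
    and "involution (op_cat A) coCyl e0 e1 v'"
    and "involution_compatible (op_cat A) c v'"
    and "subdivision (op_cat A) coCyl e0 e1 S' r0' r1' s'"
    and "subdivision_compatible (op_cat A) c S' r0' r1' s'"
    and "upper_left_connection (op_cat A) coCyl e0 e1 c \<Gamma>ul'"
    and "lower_right_connection (op_cat A) coCyl e0 e1 c \<Gamma>lr'"
    and "lower_right_compatible (op_cat A) coCyl c \<Gamma>lr'"
    and "upper_right_connection (op_cat A) coCyl e0 e1 c v' \<Gamma>ur'"
    and "connections_subdivision_compatible (op_cat A) coCyl c S' r0' r1' s' \<Gamma>lr' \<Gamma>ur'"
    and "preserves_mapping_cylinders (op_cat A) coCyl e0"
    and "strictness_of_identities (op_cat A) coCyl e0 e1 c S' r0' r1' s'"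
    and "cylinder_left_adjoint A Cyl i0 i1 coCyl e0 e1 adj"
    and "adjunction_compatible A p c adj"
  shows "model_structure A
           (cyl_homotopy_equivalences A Cyl i0 i1)
           (cocyl_fibrations A coCyl e0)
           (normally_cloven_cofibrations A Cyl i0 p) \<and>
         cyl_homotopy_equivalences A Cyl i0 i1 = cocyl_homotopy_equivalences A coCyl e0 e1"
proof -
  interpret A: category A by fact
  interpret op: category "op_cat A" by (rule category_op_cat) fact
  have "has_pushouts A" "has_pushouts (op_cat A)"
    using assms(2,3) A.has_pushouts_finite_colimits op.has_pushouts_finite_colimits
    by (simp_all add: has_finite_colimits_def)
  then interpret cylinder_adjunction A Cyl S coCyl S' i0 i1 p r0 r1 s e0 e1 c r0' r1' s' \<Gamma>lr v' \<Gamma>lr' \<Gamma>ur' adj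
    by (intro cylinder_adjunction.intro subdivided_cylinder.intro subdivided_cylinder_axioms.intro
      cylinder_adjunction_axioms.intro assms category_op_cat)
  show ?thesis using model_structure W_eq by blast
qed

end
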